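(* Let $V$ be a finite-dimensional indecomposable metric 3-Lie algebra of index $r>0$ with a maximally isotropic centre. Then $V$ admits a vector space decomposition into $r+M+N+1$ orthogonal subspaces $$V = \bigoplus_{i=1}^r \left(\mathbb{R} u_i \oplus \mathbb{R} v_i\right) \oplus \bigoplus_{\alpha =1}^N W_\alpha \oplus \bigoplus_{\pi=1}^M E_\pi \oplus E_0,$$ where $W_\alpha$, $E_\pi$ and $E_0$ are positive-definite subspaces with each $E_\pi$ two-dimensional, and where $\langle u_i,u_j\rangle = \langle v_i,v_j\rangle = 0$ and $\langle u_i,v_j\rangle = \delta_{ij}$. The 3-Lie algebra is determined by the following data: - vectors $\eta^\pi,\zeta^\pi\in\mathbb{R}^r$ with $0 \neq \eta^\pi \wedge \zeta^\pi \in \Lambda^2 \mathbb{R}^r$ for each $\pi=1,\dots,M$; - $0 \neq \kappa^\alpha \in \mathbb{R}^r$ (components $\kappa^\alpha_i$) for each $\alpha =1, \dots, N$; - a metric simple Lie algebra structure $\mathfrak{g}_\alpha$, with bracket $[-,-]$, on each $W_\alpha$ (invariant with respect to the restricted inner product); - $L \in \Lambda^4\mathbb{R}^r$ (components $L_{ijk\ell}$); - $K \in \Lambda^3\mathbb{R}^r \otimes E_0$ (components $K_{ijk}\in E_0$, totally skewsymmetric) subject to $$\langle K_{ijn},K_{k\ell m}\rangle + \langle K_{ij\ell},K_{mnk}\rangle - \langle K_{ijm},K_{nk\ell}\rangle - \langle K_{ijk},K_{\ell mn}\rangle = 0 \quad\text{for all indices},$$ via the following 3-brackets (any 3-bracket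 not listed, nor obtained from these by alternation and trilinearity, vanishes; no summation over $\pi$): $$\begin{aligned} [u_i,u_j,u_k] &= K_{ijk} + \textstyle\sum_{\ell=1}^r L_{ijk\ell} v_\ell\\ [u_i,u_j,x_0] &= - \textstyle\sum_{k=1}^r \langle K_{ijk},x_0\rangle v_k\\ [u_i,u_j,x_\pi] &= J^\pi_{ij} H_\pi x_\pi\\ [u_i,x_\pi,y_\pi] &= - \textstyle\sum_{j=1}^r \langle x_\pi,J^\pi_{ij} H_\pi y_\pi\rangle v_j\\ [u_i,x_\alpha,y_\alpha] &= \kappa_i^\alpha [x_\alpha,y_\alpha]\\ [x_\alpha,y_\alpha,z_\alpha] &= - \langle [x_\alpha,y_\alpha],z_\alpha\rangle \textstyle\sum_{i=1}^r \kappa_i^\alpha v_i, \end{aligned}$$ for all $x_0 \in E_0$, $x_\pi,y_\pi \in E_\pi$ and $x_\alpha, y_\alpha, z_\alpha \in W_\alpha$, where $J^\pi_{ij} = \eta^\pi_i \zeta^\pi_j - \eta^\pi_j \zeta^\pi_i$ and $H_\pi$ is a complex structure on the 2-plane $E_\pi$ (skewsymmetric with respect to the inner product, $H_\pi^2=-1$). The resulting 3-Lie algebra is indecomposable provided that there is no nonzero $x_0 \in E_0$ which is perpendicular to all the $K_{ijk}$, whence in particular $\dim E_0 \leq \binom{r}{3}$.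
   Context: A metric 3-Lie algebra is a real vector space $V$ with a nondegenerate symmetric bilinear form $\langle-,-\rangle$ and an alternating trilinear map $[-,-,-]:V^3\to V$ satisfying the fundamental identity $[x,y,[z_1,z_2,z_3]] = [[x,y,z_1],z_2,z_3] + [z_1,[x,y,z_2],z_3] + [z_1,z_2,[x,y,z_3]]$ and the metricity condition $\langle [x,y,z_1],z_2\rangle = - \langle z_1,[x,y,z_2]\rangle$ for all $x,y,z_i\in V$. It is indecomposable if it is not isomorphic to an orthogonal direct sum of nontrivial metric 3-Lie algebras. Its index is the dimension of a maximal negative-definite subspace. A maximally isotropic centre is a subspace $Z\subset V$ of dimension equal to the index, on which the inner product vanishes identically, and which is central: $[z,x,y]=0$ for all $z\in Z$, $x,y\in V$.
   Formalization: The last sentence is proved as necessity: for the indecomposable V no nonzero x_0 in E_0 is perpendicular to all K_ijk, giving the bound. Sufficiency is omitted; it fails for r=2, E_0=0, M=0, L=0, two so(3) factors with κ^1=(1,0), κ^2=(0,1), which splits. *)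

theory Defs
  imports "HOL-Analysis.Analysis"
begin

definition fin_dim_space :: "'v::real_vector itself \<Rightarrow> bool" where
  "fin_dim_space _ \<longleftrightarrow> (\<exists>S::'v set. finite S \<and> span S = UNIV)"

definition metric_3Lie :: "('v::real_vector \<Rightarrow> 'v \<Rightarrow> real) \<Rightarrow> ('v \<Rightarrow> 'v \<Rightarrow> 'v \<Rightarrow> 'v) \<Rightarrow> bool" where
  "metric_3Lie B T \<longleftrightarrow>
     bilinear B \<and> (\<forall>x y. B x y = B y x) \<and> (\<forall>x. (\<forall>y. B x y = 0) \<longrightarrow> x = 0) \<and>
     (\<forall>y z. linear (\<lambda>x. T x y z)) \<and> (\<forall>x z. linear (\<lambda>y. T x y z)) \<and> (\<forall>x y. linear (\<lambda>z. T x y z)) \<and>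
     (\<forall>x z. T x x z = 0) \<and> (\<forall>x y. T x y y = 0) \<and> (\<forall>x y. T x y x = 0) \<and>
     (\<forall>x y z1 z2 z3. T x y (T z1 z2 z3) =
         T (T x y z1) z2 z3 + T z1 (T x y z2) z3 + T z1 z2 (T x y z3)) \<and>
     (\<forall>x y z1 z2. B (T x y z1) z2 = - B z1 (T x y z2))"

text \<open>Indecomposable: V is not (isometrically isomorphic to) an orthogonal direct sum of two
  nontrivial metric 3-Lie algebras; stated internally: there is no nonzero proper subspace A
  such that V is the orthogonal direct sum of A and its orthogonal complement with both
  A and its complement being ideals.\<close>
definition orth_compl :: "('v \<Rightarrow> 'v \<Rightarrow> real) \<Rightarrow> 'v set \<Rightarrow> 'v set" where
  "orth_compl B A = {x. \<forall>a\<in>A. B a x = 0}"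

definition is_ideal3 :: "('v \<Rightarrow> 'v \<Rightarrow> 'v \<Rightarrow> 'v) \<Rightarrow> 'v set \<Rightarrow> bool" where
  "is_ideal3 T A \<longleftrightarrow> (\<forall>a\<in>A. \<forall>x y. T a x y \<in> A)"

definition indecomposable3 :: "('v::real_vector \<Rightarrow> 'v \<Rightarrow> real) \<Rightarrow> ('v \<Rightarrow> 'v \<Rightarrow> 'v \<Rightarrow> 'v) \<Rightarrow> bool" where
  "indecomposable3 B T \<longleftrightarrow>
     \<not> (\<exists>A. subspace A \<and> A \<noteq> {0} \<and> A \<noteq> UNIV \<and>
            A \<inter> orth_compl B A = {0} \<and> A + orth_compl B A = UNIV \<and>
            is_ideal3 T A \<and> is_ideal3 T (orth_compl B A))"

definition neg_definite :: "('v::real_vector \<Rightarrow> 'v \<Rightarrow> real) \<Rightarrow> 'v set \<Rightarrow> bool" where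
  "neg_definite B S \<longleftrightarrow> subspace S \<and> (\<forall>x\<in>S. x \<noteq> 0 \<longrightarrow> B x x < 0)"

definition pos_definite :: "('v::real_vector \<Rightarrow> 'v \<Rightarrow> real) \<Rightarrow> 'v set \<Rightarrow> bool" where
  "pos_definite B S \<longleftrightarrow> subspace S \<and> (\<forall>x\<in>S. x \<noteq> 0 \<longrightarrow> B x x > 0)"

definition has_index :: "('v::real_vector \<Rightarrow> 'v \<Rightarrow> real) \<Rightarrow> nat \<Rightarrow> bool" where
  "has_index B r \<longleftrightarrow> (\<exists>S. neg_definite B S \<and> dim S = r) \<and> (\<forall>S. neg_definite B S \<longrightarrow> dim S \<le> r)"

definition max_isotropic_centre ::
  "('v::real_vector \<Rightarrow> 'v \<Rightarrow> real) \<Rightarrow> ('v \<Rightarrow> 'v \<Rightarrow> 'v \<Rightarrow> 'v) \<Rightarrow> nat \<Rightarrow> 'v set \<Rightarrow> bool" where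
  "max_isotropic_centre B T r Z \<longleftrightarrow> subspace Z \<and> dim Z = r \<and>
     (\<forall>z\<in>Z. \<forall>w\<in>Z. B z w = 0) \<and> (\<forall>z\<in>Z. \<forall>x y. T z x y = 0)"

definition metric_simple_Lie_on ::
  "('v::real_vector \<Rightarrow> 'v \<Rightarrow> real) \<Rightarrow> 'v set \<Rightarrow> ('v \<Rightarrow> 'v \<Rightarrow> 'v) \<Rightarrow> bool" where
  "metric_simple_Lie_on B W br \<longleftrightarrow>
     subspace W \<and>
     (\<forall>x\<in>W. \<forall>y\<in>W. br x y \<in> W) \<and>
     (\<forall>a::real. \<forall>x\<in>W. \<forall>y\<in>W. \<forall>z\<in>W. br (a *\<^sub>R x + y) z = a *\<^sub>R br x z + br y z) \<and>
     (\<forall>x\<in>W. \<forall>y\<in>W. br x y = - br y x) \<and>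
     (\<forall>x\<in>W. \<forall>y\<in>W. \<forall>z\<in>W. br x (br y z) + br y (br z x) + br z (br x y) = 0) \<and>
     (\<forall>x\<in>W. \<forall>y\<in>W. \<forall>z\<in>W. B (br x y) z = B x (br y z)) \<and>
     (\<exists>x\<in>W. \<exists>y\<in>W. br x y \<noteq> 0) \<and>
     (\<forall>I. subspace I \<and> I \<subseteq> W \<and> (\<forall>x\<in>W. \<forall>y\<in>I. br x y \<in> I) \<longrightarrow> I = {0} \<or> I = W)"

definition complex_structure_on ::
  "('v::real_vector \<Rightarrow> 'v \<Rightarrow> real) \<Rightarrow> 'v set \<Rightarrow> ('v \<Rightarrow> 'v) \<Rightarrow> bool" where
  "complex_structure_on B E H \<longleftrightarrow>
     (\<forall>x\<in>E. H x \<in> E) \<and>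
     (\<forall>a::real. \<forall>x\<in>E. \<forall>y\<in>E. H (a *\<^sub>R x + y) = a *\<^sub>R H x + H y) \<and>
     (\<forall>x\<in>E. H (H x) = - x) \<and>
     (\<forall>x\<in>E. \<forall>y\<in>E. B (H x) y = - B x (H y))"

definition skew3 :: "nat \<Rightarrow> (nat \<Rightarrow> nat \<Rightarrow> nat \<Rightarrow> 'a::ab_group_add) \<Rightarrow> bool" where
  "skew3 r K \<longleftrightarrow> (\<forall>i<r. \<forall>j<r. \<forall>k<r. K i j k = - K j i k \<and> K i j k = - K i k j)"

definition skew4 :: "nat \<Rightarrow> (nat \<Rightarrow> nat \<Rightarrow> nat \<Rightarrow> nat \<Rightarrow> 'a::ab_group_add) \<Rightarrow> bool" where
  "skew4 r L \<longleftrightarrow> (\<forall>i<r. \<forall>j<r. \<forall>k<r. \<forall>l<r.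
      L i j k l = - L j i k l \<and> L i j k l = - L i k j l \<and> L i j k l = - L i j l k)"

datatype piece = P0 | PE nat | PW nat

fun piece_set :: "'v set \<Rightarrow> (nat \<Rightarrow> 'v set) \<Rightarrow> (nat \<Rightarrow> 'v set) \<Rightarrow> piece \<Rightarrow> 'v set" where
  "piece_set E0 E W P0 = E0"
| "piece_set E0 E W (PE p) = E p"
| "piece_set E0 E W (PW a) = W a"

fun valid_piece :: "nat \<Rightarrow> nat \<Rightarrow> piece \<Rightarrow> bool" where
  "valid_piece M N P0 = True"
| "valid_piece M N (PE p) = (p < M)"
| "valid_piece M N (PW a) = (a < N)"

end

theory Submission
  imports Defs
begin

text \<open>
  Let \<open>Q\<close> be the orthogonal complement of the centre \<open>Z\<close>. The form is positive semidefinite on \<open>Q\<close>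
  with radical \<open>Z\<close>, and all brackets lie in \<open>Q\<close>, so every computation takes place modulo \<open>Z\<close> on a
  Euclidean space. A complement of \<open>Q\<close> is spanned by vectors \<open>u i\<close> dual to a basis of \<open>Z\<close>, and each
  \<open>u i\<close> may be changed by an element of \<open>Q\<close>. Every unwanted component of the bracket is removed by the
  same device: choose the change of the \<open>u i\<close> as a least squares solution; the fundamental identity
  then expresses the squared norm of what is left as an inner product with the range of the
  least squares problem, so that it vanishes. In this way the derived ideal of the derived ideal of
  \<open>Q\<close> is seen to meet \<open>Z\<close> trivially, hence to split off, so \<open>[Q, Q, Q] \<subseteq> Z\<close> by indecomposability;
  next the operators \<open>J i j = [u i, u j, -]\<close> become central for the brackets \<open>[u i, -, -]\<close>; finally
  the \<open>J i j\<close> annihilate the vectors \<open>[u i, u j, u k]\<close>.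

  What remains is a family of skew operators on a Euclidean space. It decomposes orthogonally into
  irreducible pieces and the common kernel \<open>E0\<close>. By Schur's lemma for symmetric operators,
  on an irreducible piece either the brackets \<open>[u i, -, -]\<close> are proportional to a simple
  Lie bracket or the piece is a plane on which the \<open>J i j\<close> are multiples of a rotation.
\<close>

section \<open>Symmetric bilinear forms on finite-dimensional spaces\<close>

text \<open>The order of the normalisations is dictated by least squares, which needs the unwanted
  tensor to depend affinely on the change \<open>e i\<close> of the \<open>u i\<close>. In
  \<open>[u, c, d]\<close> with \<open>c\<close>, \<open>d\<close> in \<open>Q\<close> the vector
  \<open>u\<close> occurs once, so nothing has to be prepared. In \<open>[u i, u j, c]\<close> the
  change also produces \<open>[e i, e j, c]\<close>, which is negligible only once
  \<open>[Q, Q, Q]\<close> is contained in \<open>Z\<close>. In \<open>[u i, u j, u k]\<close> there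
  are terms such as \<open>[e i, e j, u k]\<close>; these fall into \<open>Z\<close> if the
  \<open>e i\<close> are taken central for the brackets \<open>[u i, -, -]\<close>, and this
  restriction also leaves the \<open>J i j\<close> unchanged modulo \<open>Z\<close>, so the last
  normalisation does not undo the one before. Passing to \<open>Q\<close> modulo \<open>Z\<close>
  loses nothing: metricity recovers the components along the \<open>v i\<close>, and the last of
  them, the products of \<open>[u i, u j, u k]\<close> with \<open>u l\<close>, are the free tensor
  \<open>L\<close>. The form \<open>eta\<close> wedge \<open>zeta\<close> of the coefficients on a
  plane is the Pluecker relation, which the fundamental identity yields once the
  \<open>[u i, u j, u k]\<close> are central.\<close>

lemma least_squares:
  fixes b :: "'s \<Rightarrow> 'i \<Rightarrow> real" and w :: "'i \<Rightarrow> real"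
  assumes "finite S" "finite I"
  shows "\<exists>c. \<forall>t\<in>S. (\<Sum>i\<in>I. (w i - (\<Sum>s\<in>S. c s * b s i)) * b t i) = 0"
  using assms(1)
proof (induction S arbitrary: w rule: finite_induct)
  case empty
  then show ?case by simp
next
  case (insert a S)
  define P where "P f g = (\<Sum>i\<in>I. f i * g i)" for f g :: "'i \<Rightarrow> real"
  have Pc: "P f g = P g f" for f g
    by (simp add: P_def mult.commute)
  have Pdiff: "P (\<lambda>i. f i - g i) h = P f h - P g h" for f g h
    by (simp add: P_def left_diff_distrib sum_subtractf)
  have Pscale: "P (\<lambda>i. k * f i) h = k * P f h" for k f h
    by (simp add: P_def sum_distrib_left mult.assoc)
  have Pcomb: "P (\<lambda>i. \<Sum>s\<in>S. k s * b s i) h = (\<Sum>s\<in>S. k s * P (b s) h)" for k h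
    by (simp add: P_def sum_distrib_left sum_distrib_right mult.assoc, rule sum.swap)
  \<comment> \<open>Gram-Schmidt in coordinates: the induction hypothesis is applied both to the
    target \<open>w\<close> and to the new vector \<open>b a\<close>. The remainders
    \<open>w'\<close> and \<open>a'\<close> are orthogonal to the old vectors, so a single
    coefficient \<open>m\<close> remains to be found.\<close>
  obtain c where c: "\<And>t. t \<in> S \<Longrightarrow> P (\<lambda>i. w i - (\<Sum>s\<in>S. c s * b s i)) (b t) = 0"
    unfolding P_def using insert.IH[of w] by blast
  obtain d where d: "\<And>t. t \<in> S \<Longrightarrow> P (\<lambda>i. b a i - (\<Sum>s\<in>S. d s * b s i)) (b t) = 0"
    unfolding P_def using insert.IH[of "b a"] by blast
  define a' where "a' = (\<lambda>i. b a i - (\<Sum>s\<in>S. d s * b s i))"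
  define w' where "w' = (\<lambda>i. w i - (\<Sum>s\<in>S. c s * b s i))"
  have comb0: "P (\<lambda>i. \<Sum>s\<in>S. k s * b s i) a' = 0" for k
    unfolding Pcomb using d[folded a'_def] by (simp add: Pc[of _ a'])
  have combw: "P (\<lambda>i. \<Sum>s\<in>S. k s * b s i) w' = 0" for k
    unfolding Pcomb using c[folded w'_def] by (simp add: Pc[of _ w'])
  define m where "m = P w' a' / P a' a'"
  define e where "e s = (if s = a then m else c s - m * d s)" for s
  have eq: "w i - (\<Sum>s\<in>insert a S. e s * b s i) = w' i - m * a' i" for i
  proof -
    have "(\<Sum>s\<in>insert a S. e s * b s i) = m * b a i + (\<Sum>s\<in>S. (c s - m * d s) * b s i)"
      using insert.hyps by (auto simp: e_def intro!: sum.cong)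
    then show ?thesis
      by (simp add: w'_def a'_def algebra_simps sum_subtractf sum_distrib_left sum.distrib)
  qed
  \<comment> \<open>If \<open>a'\<close> vanishes on \<open>I\<close>, both sides are zero whatever
    \<open>m\<close> is; this covers linearly dependent families \<open>b\<close>.\<close>
  have ma: "m * P a' a' = P w' a'"
  proof (cases "P a' a' = 0")
    case True
    then have "\<forall>i\<in>I. a' i = 0"
      unfolding P_def using assms(2) by (simp add: sum_nonneg_eq_0_iff)
    then show ?thesis using True by (simp add: P_def)
  qed (simp add: m_def)
  have "P (\<lambda>i. w' i - m * a' i) (b t) = 0" if "t \<in> insert a S" for t
  proof (cases "t = a")
    case True
    have "P a' (b a) = P a' a'"
      using comb0[of d] Pdiff[of "b a" "\<lambda>i. \<Sum>s\<in>S. d s * b s i" a']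
      by (simp add: a'_def[symmetric] Pc[of "b a" a'])
    moreover have "P w' (b a) = P w' a'"
      using combw[of d] Pdiff[of "b a" "\<lambda>i. \<Sum>s\<in>S. d s * b s i" w']
      by (simp add: a'_def[symmetric] Pc[of "b a" w'] Pc[of a' w'])
    ultimately show ?thesis using ma True by (simp add: Pdiff Pscale)
  next
    case False
    then show ?thesis using that c d by (simp add: Pdiff Pscale a'_def[symmetric] w'_def[symmetric])
  qed
  then show ?case
    unfolding eq[symmetric] P_def by blast
qed

section \<open>Symmetric, possibly indefinite forms: orthonormal families and projections\<close>

locale sym_form =
  fixes B :: "'v::real_vector \<Rightarrow> 'v \<Rightarrow> real"
  assumes bil: "bilinear B" and sym: "B x y = B y x"
begin

lemma lin_left: "linear (\<lambda>x. B x y)" and lin_right: "linear (B x)"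
  using bil by (auto simp: bilinear_def)

lemma form_simps [simp]:
  "B (x + y) z = B x z + B y z" "B z (x + y) = B z x + B z y"
  "B (x - y) z = B x z - B y z" "B z (x - y) = B z x - B z y"
  "B (a *\<^sub>R x) z = a * B x z" "B z (a *\<^sub>R x) = a * B z x"
  "B (- x) z = - B x z" "B z (- x) = - B z x"
  "B 0 z = 0" "B z 0 = 0"
  using bil
  by (simp_all add: bilinear_ladd bilinear_radd bilinear_lsub bilinear_rsub bilinear_lmul
      bilinear_rmul bilinear_lneg bilinear_rneg bilinear_lzero bilinear_rzero)

lemma sum_left: "B (sum f A) z = (\<Sum>i\<in>A. B (f i) z)"
  using linear_sum[OF lin_left] .

lemma sum_right: "B z (sum f A) = (\<Sum>i\<in>A. B z (f i))"
  using linear_sum[OF lin_right] .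

lemma subspace_perp: "subspace {x. \<forall>a\<in>A. B a x = 0}"
  by (auto simp: subspace_def)

lemma perp_span: "(\<And>a. a \<in> A \<Longrightarrow> B a x = 0) \<Longrightarrow> y \<in> span A \<Longrightarrow> B y x = 0"
  using span_minimal[of A "{y. B y x = 0}"] by (auto simp: subspace_def)

definition orthonormal :: "'v set \<Rightarrow> bool" where
  "orthonormal A \<longleftrightarrow> (\<forall>x\<in>A. \<forall>y\<in>A. B x y = (if x = y then 1 else 0))"

lemma orthonormal_coeff:
  assumes "orthonormal A" "finite A" "a \<in> A"
  shows "B (\<Sum>x\<in>A. f x *\<^sub>R x) a = f a"
proof -
  have "B (\<Sum>x\<in>A. f x *\<^sub>R x) a = (\<Sum>x\<in>A. if x = a then f x else 0)"
    unfolding sum_left using assms by (intro sum.cong) (auto simp: orthonormal_def)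
  then show ?thesis using assms by simp
qed

lemma orthonormal_expansion:
  assumes "orthonormal A" "finite A" "x \<in> span A"
  shows "x = (\<Sum>a\<in>A. B x a *\<^sub>R a)"
proof -
  obtain f where "x = (\<Sum>a\<in>A. f a *\<^sub>R a)"
    using assms(3) by (auto simp: span_finite[OF assms(2)])
  then show ?thesis using orthonormal_coeff[OF assms(1,2)] by simp
qed

lemma orthonormal_independent:
  assumes "orthonormal A" "finite A"
  shows "independent A"
proof (rule independent_if_scalars_zero[OF assms(2)])
  fix f x assume "(\<Sum>x\<in>A. f x *\<^sub>R x) = 0" "x \<in> A"
  then show "f x = 0" using orthonormal_coeff[OF assms \<open>x \<in> A\<close>, of f] by simp
qed

lemma orthonormal_norm:
  assumes "orthonormal A" "finite A" "x \<in> span A"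
  shows "B x x = (\<Sum>a\<in>A. (B x a)\<^sup>2)"
  by (subst (2) orthonormal_expansion[OF assms]) (simp add: sum_right power2_eq_square)

lemma orthonormal_pos:
  assumes "orthonormal A" "finite A" "x \<in> span A" "x \<noteq> 0"
  shows "B x x > 0"
proof -
  have "\<exists>a\<in>A. B x a \<noteq> 0"
    using orthonormal_expansion[OF assms(1-3)] assms(4)
    by (metis (no_types, lifting) scaleR_zero_left sum.neutral)
  then show ?thesis
    unfolding orthonormal_norm[OF assms(1-3)] using assms(2)
    by (meson sum_pos2 zero_le_power2 zero_less_power2)
qed

lemma gram_schmidt:
  assumes "finite F" "\<And>x. x \<in> span F \<Longrightarrow> x \<noteq> 0 \<Longrightarrow> B x x > 0"
  shows "\<exists>A. finite A \<and> orthonormal A \<and> span A = span F"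
  using assms
proof (induction F rule: finite_induct)
  case empty
  then show ?case by (intro exI[of _ "{}"]) (simp add: orthonormal_def)
next
  case (insert x F)
  have "span F \<subseteq> span (insert x F)" by (rule span_mono) blast
  then obtain A where A: "finite A" "orthonormal A" "span A = span F"
    using insert by blast
  define y where "y = x - (\<Sum>a\<in>A. B x a *\<^sub>R a)"
  have sA: "(\<Sum>a\<in>A. B x a *\<^sub>R a) \<in> span A"
    by (intro span_sum span_scale span_base)
  have ya: "B y a = 0" "B a y = 0" if "a \<in> A" for a
    using orthonormal_coeff[OF A(2,1) that, of "B x"] sym[of a y] by (simp_all add: y_def)
  have span: "span (insert c A) = span (insert x F)" if "c = k *\<^sub>R y" "k \<noteq> 0" for c k
  proof -
    have "span (insert x F) = span (insert x A)"
      by (simp add: span_insert A(3))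
    also have "\<dots> = span (insert y A)"
      by (rule eq_span_insert_eq) (simp add: y_def sA)
    also have "\<dots> = span (insert c A)"
      using that by (simp add: span_insert) (metis (no_types, lifting) divide_inverse_commute inverse_eq_divide nonzero_divide_eq_eq scaleR_scaleR)
    finally show ?thesis by simp
  qed
  show ?case
  proof (cases "y = 0")
    case True
    then have "x \<in> span F" using sA by (simp add: y_def A(3))
    then show ?thesis using A by (auto simp: span_redundant)
  next
    case False
    have "y \<in> span (insert x F)"
      using span[of y 1] span_base[of y "insert y A"] by simp
    then have pos: "B y y > 0" using insert.prems False by blast
    define k where "k = 1 / sqrt (B y y)"
    have k: "k \<noteq> 0" "k * k * B y y = 1" using pos by (simp_all add: k_def)
    have "k *\<^sub>R y \<notin> A" using ya(1)[of "k *\<^sub>R y"] k(1) pos by auto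
    then have "orthonormal (insert (k *\<^sub>R y) A)"
      using A(2) ya k by (auto simp: orthonormal_def mult.assoc)
    then show ?thesis using span[OF refl k(1)] A(1) by blast
  qed
qed

end

lemma fin_dim_subspace_finite:
  assumes "fin_dim_space TYPE('v::real_vector)" "subspace (U :: 'v set)"
  shows "\<exists>F. finite F \<and> span F = U \<and> F \<subseteq> U \<and> independent F"
proof -
  obtain S :: "'v set" where S: "finite S" "span S = UNIV"
    using assms(1) by (auto simp: fin_dim_space_def)
  obtain F where F: "F \<subseteq> U" "independent F" "U \<subseteq> span F"
    using maximal_independent_subset[of U] by blast
  have "finite F" using independent_span_bound[OF S(1) F(2)] S(2) by auto
  moreover have "span F = U"
    using F assms(2) span_minimal[of F U] by blast
  ultimately show ?thesis using F by blast
qed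

lemma fin_dim_psubset:
  assumes "fin_dim_space TYPE('v::real_vector)" "subspace (U :: 'v set)" "subspace W" "U \<subset> W"
  shows "dim U < dim W"
proof -
  obtain F :: "'v set" where F: "finite F" "span F = U" "independent F"
    using fin_dim_subspace_finite[OF assms(1,2)] by blast
  obtain G :: "'v set" where G: "finite G" "span G = W" "independent G"
    using fin_dim_subspace_finite[OF assms(1,3)] by blast
  obtain x where x: "x \<in> W" "x \<notin> U" using assms(4) by blast
  have "independent (insert x F)" using F x by (simp add: independent_insert)
  moreover have "insert x F \<subseteq> span G"
    using F G x assms(4) span_superset[of F] by auto
  ultimately have "card (insert x F) \<le> card G"
    using independent_span_bound[OF G(1)] by blast
  moreover have "x \<notin> F" using x F span_base by blast
  ultimately have "card F < card G" using F by simp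
  then show ?thesis
    using F G dim_span_eq_card_independent by metis
qed

context sym_form
begin

text \<open>Positivity is asked only on \<open>A\<close>: the projection is the Fourier sum over an
  orthonormal basis of \<open>A\<close>, so \<open>B\<close> may be indefinite on the whole
  space.\<close>

lemma orthogonal_split:
  assumes fin: "fin_dim_space TYPE('v)" and A: "subspace A"
    and pos: "\<And>x. x \<in> A \<Longrightarrow> x \<noteq> 0 \<Longrightarrow> B x x > 0"
  obtains a where "a \<in> A" "\<And>b. b \<in> A \<Longrightarrow> B b (x - a) = 0"
proof -
  obtain F where F: "finite F" "span F = A"
    using fin_dim_subspace_finite[OF fin A] by blast
  obtain N where N: "finite N" "orthonormal N" "span N = A"
    using gram_schmidt[OF F(1)] pos F(2) by metis
  let ?a = "\<Sum>a\<in>N. B x a *\<^sub>R a"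
  have "?a \<in> A" unfolding N(3)[symmetric] by (intro span_sum span_scale span_base)
  moreover have "B a (x - ?a) = 0" if "a \<in> N" for a
    using orthonormal_coeff[OF N(2,1) that, of "B x"] by (simp add: sym[of a])
  then have "B b (x - ?a) = 0" if "b \<in> A" for b
    using perp_span N(3) that by blast
  ultimately show ?thesis using that by blast
qed

text \<open>Since \<open>x\<close> is null, the form at \<open>y + t x\<close> is affine in
  \<open>t\<close>; an affine function bounded below is constant.\<close>

lemma psd_cauchy_schwarz_zero:
  assumes U: "subspace U" and psd: "\<And>z. z \<in> U \<Longrightarrow> B z z \<ge> 0"
    and x: "x \<in> U" "B x x = 0" and y: "y \<in> U"
  shows "B x y = 0"
proof (rule ccontr)
  assume ne: "B x y \<noteq> 0"
  have "B (y + t *\<^sub>R x) (y + t *\<^sub>R x) \<ge> 0" for t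
    by (intro psd subspace_add[OF U] subspace_scale[OF U] x y)
  then have "0 \<le> B y y + 2 * (t * B x y)" for t
    using x by (simp add: sym[of y x] add.assoc)
  from this[of "- (B y y + 1) / (2 * B x y)"] show False using ne by (simp add: field_simps)
qed

text \<open>In an orthonormal basis the products of coordinates are bounded by \<open>B x x\<close>;
  this replaces compactness of the unit sphere. The eigenvector argument uses it twice, with
  \<open>B\<close> first as the dominating form and then as the dominated one.\<close>

lemma pos_def_dominates:
  assumes F: "finite F" and pos: "\<And>x. x \<in> span F \<Longrightarrow> x \<noteq> 0 \<Longrightarrow> B x x > 0"
    and A: "bilinear A"
  shows "\<exists>K>0. \<forall>x\<in>span F. \<bar>A x x\<bar> \<le> K * B x x"
proof -
  obtain N where N: "finite N" "orthonormal N" "span N = span F"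
    using gram_schmidt[OF F pos] by blast
  define K where "K = (\<Sum>a\<in>N. \<Sum>b\<in>N. \<bar>A a b\<bar>) + 1"
  have "\<bar>A x x\<bar> \<le> K * B x x" if "x \<in> span F" for x
  proof -
    have x: "x = (\<Sum>a\<in>N. B x a *\<^sub>R a)"
      using orthonormal_expansion[OF N(2,1)] N(3) that by simp
    have Bx: "B x x = (\<Sum>a\<in>N. (B x a)\<^sup>2)"
      using orthonormal_norm[OF N(2,1)] N(3) that by simp
    have le: "\<bar>B x a\<bar> * \<bar>B x b\<bar> \<le> B x x" if "a \<in> N" "b \<in> N" for a b
    proof -
      have s: "(B x c)\<^sup>2 \<le> B x x" if "c \<in> N" for c
        unfolding Bx using that N(1) by (intro member_le_sum) auto
      have "2 * (\<bar>B x a\<bar> * \<bar>B x b\<bar>) \<le> (B x a)\<^sup>2 + (B x b)\<^sup>2"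
        using sum_squares_bound[of "\<bar>B x a\<bar>" "\<bar>B x b\<bar>"] by (simp add: mult.assoc)
      then show ?thesis using s[OF that(1)] s[OF that(2)] by linarith
    qed
    have "A x x = (\<Sum>a\<in>N. \<Sum>b\<in>N. A (B x a *\<^sub>R a) (B x b *\<^sub>R b))"
      by (subst x, subst (2) x) (simp add: bilinear_sum[OF A] sum.cartesian_product)
    then have "A x x = (\<Sum>a\<in>N. \<Sum>b\<in>N. B x a * B x b * A a b)"
      by (simp add: bilinear_lmul[OF A] bilinear_rmul[OF A] mult_ac)
    then have "\<bar>A x x\<bar> \<le> (\<Sum>a\<in>N. \<Sum>b\<in>N. \<bar>B x a\<bar> * \<bar>B x b\<bar> * \<bar>A a b\<bar>)"
      by (auto intro!: order_trans[OF sum_abs] sum_mono simp: abs_mult)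
    also have "\<dots> \<le> (\<Sum>a\<in>N. \<Sum>b\<in>N. B x x * \<bar>A a b\<bar>)"
      by (intro sum_mono mult_right_mono le) auto
    also have "\<dots> = (\<Sum>a\<in>N. \<Sum>b\<in>N. \<bar>A a b\<bar>) * B x x"
      by (simp add: sum_distrib_left mult.commute)
    also have "\<dots> \<le> K * B x x"
      unfolding K_def Bx by (intro mult_right_mono) (auto intro: sum_nonneg)
    finally show ?thesis .
  qed
  moreover have "K > 0" unfolding K_def
    by (intro add_nonneg_pos sum_nonneg) auto
  ultimately show ?thesis by blast
qed

text \<open>The eigenvalue is the largest \<open>l\<close> for which \<open>f - l\<close> is positive semidefinite: if
  \<open>f - l\<close> were definite, it would dominate a multiple of \<open>B\<close> and \<open>l\<close> could be increased.\<close>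
lemma symmetric_eigenvector:
  assumes F: "finite F" and pos: "\<And>x. x \<in> span F \<Longrightarrow> x \<noteq> 0 \<Longrightarrow> B x x > 0"
    and ne: "x0 \<in> span F" "x0 \<noteq> 0"
    and f: "linear f" and fF: "\<And>x. x \<in> span F \<Longrightarrow> f x \<in> span F"
    and fsym: "\<And>x y. x \<in> span F \<Longrightarrow> y \<in> span F \<Longrightarrow> B (f x) y = B x (f y)"
  shows "\<exists>l. \<exists>x\<in>span F. x \<noteq> 0 \<and> f x = l *\<^sub>R x"
proof -
  have bf: "bilinear (\<lambda>x y. B (f x) y)"
    using linear_compose[OF f lin_left] lin_right by (simp add: bilinear_def o_def)
  define D where "D = {l. \<forall>x\<in>span F. l * B x x \<le> B (f x) x}"
  obtain K where K: "K > 0" "\<And>x. x \<in> span F \<Longrightarrow> \<bar>B (f x) x\<bar> \<le> K * B x x"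
    using pos_def_dominates[OF F pos bf] by blast
  have "- K \<in> D" unfolding D_def using K(2) by (auto simp: abs_le_iff minus_le_iff)
  then have Dne: "D \<noteq> {}" by blast
  have Dbd: "l \<le> K" if "l \<in> D" for l
  proof -
    have "l * B x0 x0 \<le> K * B x0 x0"
      using that ne(1) K(2)[OF ne(1)] by (fastforce simp: D_def)
    then show ?thesis using pos[OF ne] by simp
  qed
  then have bdd: "bdd_above D" by (meson bdd_aboveI)
  define l where "l = Sup D"
  have lD: "l * B x x \<le> B (f x) x" if x: "x \<in> span F" for x
  proof (cases "x = 0")
    case True
    then show ?thesis using linear_0[OF f] by simp
  next
    case False
    have "l \<le> B (f x) x / B x x"
      unfolding l_def using x pos[OF x False]
      by (intro cSup_least[OF Dne]) (auto simp: D_def field_simps)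
    then show ?thesis using pos[OF x False] by (simp add: field_simps)
  qed
  \<comment> \<open>\<open>f\<close> is self-adjoint only on \<open>span F\<close>. The symmetrised
    form is symmetric everywhere, as the interpretation of \<open>sym_form\<close> demands, and
    agrees on \<open>span F\<close> with the form of \<open>f - l\<close>.\<close>
  define P where "P x y = (B (f x) y + B (f y) x) / 2 - l * B x y" for x y
  have "bilinear P"
    unfolding bilinear_def linear_iff P_def
    using linear_add[OF f] linear_scale[OF f] by (simp add: algebra_simps add_divide_distrib)
  then interpret P: sym_form P
    by unfold_locales (simp_all add: P_def sym)
  have PB: "P x y = B (f x - l *\<^sub>R x) y" if "x \<in> span F" "y \<in> span F" for x y
    using fsym[OF that] by (simp add: P_def sym[of "f y" x])
  have psd: "P x x \<ge> 0" if "x \<in> span F" for x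
    using lD[OF that] by (simp add: P_def)
  have "\<exists>x\<in>span F. x \<noteq> 0 \<and> P x x = 0"
  proof (rule ccontr)
    assume "\<not> ?thesis"
    then have Ppos: "P x x > 0" if "x \<in> span F" "x \<noteq> 0" for x
      using psd that by force
    obtain C where C: "C > 0" "\<And>x. x \<in> span F \<Longrightarrow> \<bar>B x x\<bar> \<le> C * P x x"
      using P.pos_def_dominates[OF F Ppos bil] by blast
    have "l + 1 / C \<in> D"
      unfolding D_def
    proof safe
      fix x assume x: "x \<in> span F"
      have "B x x \<le> C * P x x" using C(2)[OF x] by simp
      then have "B x x / C \<le> P x x" using C(1) by (simp add: field_simps)
      then show "(l + 1 / C) * B x x \<le> B (f x) x"
        by (simp add: P_def algebra_simps)
    qed
    then have "l + 1 / C \<le> l" unfolding l_def using bdd by (rule cSup_upper)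
    then show False using C(1) by simp
  qed
  then obtain x where x: "x \<in> span F" "x \<noteq> 0" "P x x = 0" by blast
  have mem: "f x - l *\<^sub>R x \<in> span F"
    by (intro span_diff span_scale fF x)
  have "P x (f x - l *\<^sub>R x) = 0"
    by (rule P.psd_cauchy_schwarz_zero[OF subspace_span psd x(1,3) mem])
  then have "f x - l *\<^sub>R x = 0"
    using PB[OF x(1) mem] pos[OF mem] by force
  then show ?thesis using x by auto
qed

end

section \<open>Metric 3-Lie algebras with a maximally isotropic centre\<close>

locale metric_3Lie_algebra =
  fixes B :: "'v::real_vector \<Rightarrow> 'v \<Rightarrow> real" and T :: "'v \<Rightarrow> 'v \<Rightarrow> 'v \<Rightarrow> 'v"
  assumes fin: "fin_dim_space TYPE('v)" and m3L: "metric_3Lie B T"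
begin

sublocale sym_form B
  using m3L by unfold_locales (auto simp: metric_3Lie_def)

lemma nondegenerate: "(\<And>y. B x y = 0) \<Longrightarrow> x = 0"
  using m3L unfolding metric_3Lie_def by auto

lemma T_linear: "linear (\<lambda>x. T x y z)" "linear (\<lambda>x. T y x z)" "linear (\<lambda>x. T y z x)"
  using m3L unfolding metric_3Lie_def by auto

lemma T_simps [simp]:
  "T (x + x') y z = T x y z + T x' y z" "T y (x + x') z = T y x z + T y x' z"
  "T y z (x + x') = T y z x + T y z x'"
  "T (x - x') y z = T x y z - T x' y z" "T y (x - x') z = T y x z - T y x' z"
  "T y z (x - x') = T y z x - T y z x'"
  "T (- x) y z = - T x y z" "T y (- x) z = - T y x z" "T y z (- x) = - T y z x"
  "T (a *\<^sub>R x) y z = a *\<^sub>R T x y z" "T y (a *\<^sub>R x) z = a *\<^sub>R T y x z"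
  "T y z (a *\<^sub>R x) = a *\<^sub>R T y z x"
  "T 0 y z = 0" "T y 0 z = 0" "T y z 0 = 0"
  by (simp_all add: linear_add[OF T_linear(1)] linear_add[OF T_linear(2)] linear_add[OF T_linear(3)]
      linear_diff[OF T_linear(1)] linear_diff[OF T_linear(2)] linear_diff[OF T_linear(3)]
      linear_neg[OF T_linear(1)] linear_neg[OF T_linear(2)] linear_neg[OF T_linear(3)]
      linear_scale[OF T_linear(1)] linear_scale[OF T_linear(2)] linear_scale[OF T_linear(3)]
      linear_0[OF T_linear(1)] linear_0[OF T_linear(2)] linear_0[OF T_linear(3)])

lemmas T_sum = linear_sum[OF T_linear(1)] linear_sum[OF T_linear(2)] linear_sum[OF T_linear(3)]

lemma T_alt [simp]: "T x x z = 0" "T x y y = 0" "T x y x = 0"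
  using m3L unfolding metric_3Lie_def by blast+

lemma T_swap12: "T x y z = - T y x z"
  using T_alt(1)[of "x + y" z] by (simp del: T_alt(1) add: T_alt(1)[of x] T_alt(1)[of y] eq_neg_iff_add_eq_0 add.commute)

lemma T_swap23: "T x y z = - T x z y"
  using T_alt(2)[of x "y + z"] by (simp del: T_alt(2) add: T_alt(2)[of x y] T_alt(2)[of x z] eq_neg_iff_add_eq_0 add.commute)

lemma T_cyc: "T x y z = T y z x"
  by (subst T_swap12, subst T_swap23) simp

lemma FI: "T x y (T a b c) = T (T x y a) b c + T a (T x y b) c + T a b (T x y c)"
  using m3L unfolding metric_3Lie_def by blast

lemma metric: "B (T x y a) b = - B a (T x y b)"
  using m3L unfolding metric_3Lie_def by blast

lemma derived_ideal:
  assumes I: "is_ideal3 T I"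
  shows "is_ideal3 T (span {T a b c | a b c. a \<in> I \<and> b \<in> I \<and> c \<in> I})" (is "is_ideal3 T (span ?G)")
proof -
  have I3: "T p q a \<in> I" if "a \<in> I" for a p q
    using I that unfolding T_cyc[of p q a] T_cyc[of q a p] is_ideal3_def by blast
  have G: "T p q g \<in> span ?G" if "g \<in> ?G" for g p q
  proof -
    obtain a b c where g: "g = T a b c" "a \<in> I" "b \<in> I" "c \<in> I" using \<open>g \<in> ?G\<close> by blast
    then show ?thesis
      unfolding g(1) FI[of p q a b c] using I3 g by (intro span_add span_base) blast+
  qed
  have "T p q g \<in> span ?G" if "g \<in> span ?G" for g p q
  proof -
    have "?G \<subseteq> {g. T p q g \<in> span ?G}" using G by blast
    moreover have "subspace {g. T p q g \<in> span ?G}"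
      by (simp add: subspace_def span_add span_scale span_zero)
    ultimately have "span ?G \<subseteq> {g. T p q g \<in> span ?G}" by (rule span_minimal)
    then show ?thesis using that by blast
  qed
  then have "T g p q \<in> span ?G" if "g \<in> span ?G" for g p q
    unfolding T_cyc[of g p q] using that by blast
  then show ?thesis unfolding is_ideal3_def by blast
qed

text \<open>A positive definite subspace splits off orthogonally, and metricity makes the orthogonal
  complement of an ideal an ideal. Indecomposability enters the development only through this
  lemma.\<close>

lemma positive_ideal_trivial:
  assumes "indecomposable3 B T" and A: "subspace A" "is_ideal3 T A" "A \<noteq> UNIV"
    and pos: "\<And>x. x \<in> A \<Longrightarrow> x \<noteq> 0 \<Longrightarrow> B x x > 0"
  shows "A = {0}"
proof (rule ccontr)
  assume "A \<noteq> {0}"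
  have "A \<inter> orth_compl B A \<subseteq> {0}"
    using pos by (fastforce simp: orth_compl_def)
  moreover have "0 \<in> A \<inter> orth_compl B A"
    using subspace_0[OF A(1)] by (simp add: orth_compl_def)
  moreover have "x \<in> A + orth_compl B A" for x
  proof -
    obtain a where a: "a \<in> A" "\<And>b. b \<in> A \<Longrightarrow> B b (x - a) = 0"
      using orthogonal_split[OF fin A(1)] pos by metis
    then have "x - a \<in> orth_compl B A" by (simp add: orth_compl_def)
    then show ?thesis using set_plus_intro[OF a(1), of "x - a"] by simp
  qed
  moreover have "is_ideal3 T (orth_compl B A)"
    unfolding is_ideal3_def orth_compl_def
  proof safe
    fix x p q a assume x: "\<forall>a\<in>A. B a x = 0" and a: "a \<in> A"
    have "T p q a \<in> A"
      using A(2) a unfolding T_cyc[of p q a] T_cyc[of q a p] is_ideal3_def by blast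
    then show "B a (T x p q) = 0"
      using x metric[of p q a x] by (simp add: T_cyc[of x p q])
  qed
  ultimately show False
    using assms(1) A \<open>A \<noteq> {0}\<close> unfolding indecomposable3_def by blast
qed

end

locale max_isotropic = metric_3Lie_algebra B T
  for B :: "'v::real_vector \<Rightarrow> 'v \<Rightarrow> real" and T +
  fixes r :: nat and Z :: "'v set"
  assumes idx: "has_index B r" and cent: "max_isotropic_centre B T r Z"
begin

lemma Z_subspace: "subspace Z" and Z_dim: "dim Z = r"
  and Z_isotropic: "z \<in> Z \<Longrightarrow> w \<in> Z \<Longrightarrow> B z w = 0"
  and Z_central1: "z \<in> Z \<Longrightarrow> T z x y = 0"
  using cent unfolding max_isotropic_centre_def by blast+

lemma Z_central2: "z \<in> Z \<Longrightarrow> T x z y = 0" and Z_central3: "z \<in> Z \<Longrightarrow> T x y z = 0"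
  using Z_central1 T_cyc by metis+

lemmas Z_central = Z_central1 Z_central2 Z_central3

lemmas Z_closed = subspace_add[OF Z_subspace] subspace_diff[OF Z_subspace]
  subspace_scale[OF Z_subspace] subspace_neg[OF Z_subspace] subspace_0[OF Z_subspace]
  subspace_sum[OF Z_subspace]

definition Q :: "'v set" where "Q = {x. \<forall>z\<in>Z. B z x = 0}"

lemma Q_subspace: "subspace Q" unfolding Q_def by (rule subspace_perp)

lemmas Q_closed = subspace_add[OF Q_subspace] subspace_diff[OF Q_subspace]
  subspace_scale[OF Q_subspace] subspace_neg[OF Q_subspace] subspace_0[OF Q_subspace]
  subspace_sum[OF Q_subspace]

lemma Z_Q: "z \<in> Z \<Longrightarrow> z \<in> Q" unfolding Q_def using Z_isotropic by blast

lemma B_Z_Q: "z \<in> Z \<Longrightarrow> x \<in> Q \<Longrightarrow> B z x = 0" "z \<in> Z \<Longrightarrow> x \<in> Q \<Longrightarrow> B x z = 0"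
  unfolding Q_def using sym by auto

lemma T_Q: "T x y z \<in> Q"
  unfolding Q_def using metric[of x y z] by (auto simp: Z_central sym[of _ "T x y z"])

text \<open>As \<open>Z\<close> has dimension \<open>r\<close>, the \<open>v i\<close> form a basis
  of \<open>Z\<close>. The pairing fixes each \<open>u i\<close> only up to \<open>Q\<close>, and
  this freedom is spent on the later normalisations.\<close>

definition dual_frame :: "(nat \<Rightarrow> 'v) \<Rightarrow> (nat \<Rightarrow> 'v) \<Rightarrow> bool" where
  "dual_frame u v \<longleftrightarrow> span (v ` {..<r}) = Z \<and>
     (\<forall>i<r. \<forall>j<r. B (u i) (v j) = (if i = j then 1 else 0))"

definition isotropic_frame :: "(nat \<Rightarrow> 'v) \<Rightarrow> bool" where
  "isotropic_frame u \<longleftrightarrow> (\<forall>i<r. \<forall>j<r. B (u i) (u j) = 0)"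

lemma dual_frame_v: "dual_frame u v \<Longrightarrow> i < r \<Longrightarrow> v i \<in> Z"
  unfolding dual_frame_def using span_base[of "v i" "v ` {..<r}"] by blast

lemma sum_delta: "j < r \<Longrightarrow> (\<Sum>k<r. f k * (if j = k then 1 else 0)) = (f j :: real)"
    "j < r \<Longrightarrow> (\<Sum>k<r. f k * (if k = j then 1 else 0)) = f j"
  by (simp_all add: if_distrib cong: if_cong)

lemma ex_dual_frame: "\<exists>u v. dual_frame u v"
proof -
  obtain F where F: "finite F" "span F = Z" "independent F"
    using fin_dim_subspace_finite[OF fin Z_subspace] by blast
  have "card F = r" using F Z_dim dim_span_eq_card_independent by metis
  then obtain v where v: "bij_betw v {..<r} F"
    using ex_bij_betw_nat_finite[OF F(1)] by (auto simp: atLeast0LessThan)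
  obtain G :: "'v set" where G: "finite G" "span G = UNIV"
    using fin by (auto simp: fin_dim_space_def)
  have "\<exists>u. \<forall>j<r. B u (v j) = (if i = j then 1 else 0)" for i
  proof -
    let ?w = "\<lambda>j. if i = j then 1 else 0 :: real"
    \<comment> \<open>Least squares solves the linear system for \<open>u\<close>: the combination
      \<open>x\<close> of the \<open>v j\<close> formed from the residual is orthogonal to the whole
      space, so nondegeneracy and independence of the \<open>v j\<close> make the residual
      vanish.\<close>
    obtain c where c: "\<And>t. t \<in> G \<Longrightarrow> (\<Sum>j<r. (?w j - (\<Sum>s\<in>G. c s * B s (v j))) * B t (v j)) = 0"
      using least_squares[OF G(1) finite_lessThan, of ?w "\<lambda>s j. B s (v j)"] by blast
    define u where "u = (\<Sum>s\<in>G. c s *\<^sub>R s)"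
    define x where "x = (\<Sum>j<r. (?w j - B u (v j)) *\<^sub>R v j)"
    have "B t x = 0" if "t \<in> G" for t
      using c[OF that] by (simp add: x_def sum_right u_def sum_left)
    then have "B t x = 0" for t
      using perp_span[of G x t] G(2) by auto
    then have x0: "x = 0" using nondegenerate sym by metis
    have inj: "inj_on v {..<r}" and im: "v ` {..<r} = F" using v by (auto simp: bij_betw_def)
    have "x = (\<Sum>y\<in>F. (?w (the_inv_into {..<r} v y) - B u y) *\<^sub>R y)"
      unfolding x_def im[symmetric] sum.reindex[OF inj]
      by (intro sum.cong) (auto simp: the_inv_into_f_f[OF inj])
    then have z: "?w (the_inv_into {..<r} v y) - B u y = 0" if "y \<in> F" for y
      using independentD[OF F(3,1) order_refl _ that, of "\<lambda>y. ?w (the_inv_into {..<r} v y) - B u y"] x0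
      by simp
    have "B u (v j) = ?w j" if "j < r" for j
      using z[of "v j"] that im by (auto simp: the_inv_into_f_f[OF inj] split: if_splits)
    then show ?thesis by blast
  qed
  then obtain u where "\<forall>i. \<forall>j<r. B (u i) (v j) = (if i = j then 1 else 0)" by metis
  then have "dual_frame u v"
    using F(2) v unfolding dual_frame_def bij_betw_def by blast
  then show ?thesis by blast
qed

lemma dual_frame_isotropic:
  assumes f: "dual_frame u v"
  shows "\<exists>u'. dual_frame u' v \<and> isotropic_frame u' \<and> (\<forall>i. u' i - u i \<in> Z)"
proof -
  \<comment> \<open>The factor is one half because each of the two arguments of
    \<open>B (u' i) (u' j)\<close> removes its share of the Gram matrix.\<close>
  define u' where "u' i = u i - (1/2) *\<^sub>R (\<Sum>k<r. B (u i) (u k) *\<^sub>R v k)" for i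
  have z: "(\<Sum>k<r. B (u i) (u k) *\<^sub>R v k) \<in> Z" for i
    using dual_frame_v[OF f] by (auto intro!: Z_closed)
  have uv: "B (u i) (v j) = (if i = j then 1 else 0)" if "i < r" "j < r" for i j
    using f that by (simp add: dual_frame_def)
  have vv: "B (v i) (v j) = 0" if "i < r" "j < r" for i j
    using Z_isotropic dual_frame_v[OF f] that by blast
  have 1: "B (\<Sum>k<r. c k *\<^sub>R v k) (v j) = 0" if "j < r" for c j
    using vv that by (simp add: sum_left)
  have 2: "B (u j) (\<Sum>k<r. c k *\<^sub>R v k) = c j" if "j < r" for c j
    using that by (simp add: sum_right uv sum_delta)
  have 3: "B (\<Sum>k<r. c k *\<^sub>R v k) (\<Sum>k<r. d k *\<^sub>R v k) = 0" for c d
    unfolding sum_right using 1 by simp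
  have "dual_frame u' v"
    using f 1 by (simp add: dual_frame_def u'_def)
  moreover have "isotropic_frame u'"
    unfolding isotropic_frame_def
    by (simp add: u'_def 2 3 sym[of "sum _ _" "u _"]) (simp add: sym)
  moreover have "u' i - u i \<in> Z" for i
    using z[of i] by (simp add: u'_def Z_closed)
  ultimately show ?thesis by blast
qed

section \<open>Positive definiteness of the orthogonal complement of a frame\<close>

definition frame_compl :: "(nat \<Rightarrow> 'v) \<Rightarrow> (nat \<Rightarrow> 'v) \<Rightarrow> 'v set" where
  "frame_compl u v = {x. \<forall>i<r. B (u i) x = 0 \<and> B (v i) x = 0}"

lemma frame_compl_subspace: "subspace (frame_compl u v)"
  by (auto simp: frame_compl_def subspace_def)

definition frame_proj :: "(nat \<Rightarrow> 'v) \<Rightarrow> (nat \<Rightarrow> 'v) \<Rightarrow> 'v \<Rightarrow> 'v" where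
  "frame_proj u v x = x - (\<Sum>i<r. B (u i) x *\<^sub>R v i) - (\<Sum>i<r. B (v i) x *\<^sub>R u i)"

context
  fixes u v assumes f: "dual_frame u v" "isotropic_frame u"
begin

lemma frame_uv: "i < r \<Longrightarrow> j < r \<Longrightarrow> B (u i) (v j) = (if i = j then 1 else 0)"
  and frame_vu: "i < r \<Longrightarrow> j < r \<Longrightarrow> B (v i) (u j) = (if i = j then 1 else 0)"
  and frame_uu: "i < r \<Longrightarrow> j < r \<Longrightarrow> B (u i) (u j) = 0"
  and frame_vv: "i < r \<Longrightarrow> j < r \<Longrightarrow> B (v i) (v j) = 0"
  using f sym[of "v i" "u j"] Z_isotropic dual_frame_v[OF f(1)]
  by (auto simp: dual_frame_def isotropic_frame_def)

lemma frame_proj_compl: "frame_proj u v x \<in> frame_compl u v"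
  unfolding frame_compl_def frame_proj_def
  by (auto simp: sum_right frame_uv frame_vu frame_uu frame_vv sum_delta)

lemma Q_iff_v: "x \<in> Q \<longleftrightarrow> (\<forall>i<r. B (v i) x = 0)"
proof
  show "x \<in> Q \<Longrightarrow> \<forall>i<r. B (v i) x = 0"
    using dual_frame_v[OF f(1)] by (auto simp: Q_def)
  assume "\<forall>i<r. B (v i) x = 0"
  then have "B z x = 0" if "z \<in> Z" for z
    using perp_span[of "v ` {..<r}" x z] f(1) that by (auto simp: dual_frame_def)
  then show "x \<in> Q" by (simp add: Q_def)
qed

lemma frame_compl_Q: "x \<in> frame_compl u v \<Longrightarrow> x \<in> Q"
  unfolding Q_iff_v by (simp add: frame_compl_def)

lemma frame_proj_Q: "x \<in> Q \<Longrightarrow> frame_proj u v x = x - (\<Sum>i<r. B (u i) x *\<^sub>R v i)"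
  by (simp add: frame_proj_def Q_iff_v)

lemma frame_proj_diff: "x \<in> Q \<Longrightarrow> x - frame_proj u v x \<in> Z"
  using dual_frame_v[OF f(1)] by (simp add: frame_proj_Q) (auto intro!: Z_closed)

text \<open>A negative vector orthogonal to the frame, together with the \<open>r\<close> negative
  vectors \<open>u i - v i\<close>, would span a negative definite subspace of dimension
  \<open>r + 1\<close>, against the index.\<close>

lemma frame_compl_index_nonneg:
  assumes w: "w \<in> frame_compl u v"
  shows "B w w \<ge> 0"
proof (rule ccontr)
  assume "\<not> B w w \<ge> 0"
  then have neg: "B w w < 0" by simp
  \<comment> \<open>Passing to \<open>- B\<close> makes the results on orthonormal families
    available for negative definite subspaces.\<close>
  interpret N: sym_form "\<lambda>x y. - B x y"
    using bil by unfold_locales (auto simp: bilinear_def linear_iff sym)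
  define g where "g i = (1 / sqrt 2) *\<^sub>R (u i - v i)" for i
  define h where "h = (1 / sqrt (- B w w)) *\<^sub>R w"
  have gg: "B (g i) (g j) = (if i = j then - 1 else 0)" if "i < r" "j < r" for i j
    using that by (simp add: g_def frame_uv frame_vu frame_uu frame_vv)
  have gh: "B (g i) h = 0" if "i < r" for i
    using w that by (simp add: g_def h_def frame_compl_def)
  have hh: "B h h = - 1" using neg by (simp add: h_def)
  have hg0: "B h (g i) = 0" if "i < r" for i using gh[OF that] sym by metis
  have inj: "inj_on g {..<r}"
  proof (rule inj_onI)
    fix i j assume ij: "i \<in> {..<r}" "j \<in> {..<r}" "g i = g j"
    then show "i = j" using gg[of i j] gg[of j j] by (auto split: if_splits)
  qed
  have hg: "h \<notin> g ` {..<r}" using gh hh by force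
  have on: "N.orthonormal (insert h (g ` {..<r}))"
    unfolding N.orthonormal_def using gg gh hh hg hg0 inj
    by (auto split: if_splits dest: inj_onD)
  have fi: "finite (insert h (g ` {..<r}))" by simp
  have "neg_definite B (span (insert h (g ` {..<r})))"
    unfolding neg_definite_def using N.orthonormal_pos[OF on fi] by auto
  moreover have "dim (span (insert h (g ` {..<r}))) = Suc r"
    using dim_span_eq_card_independent[OF N.orthonormal_independent[OF on fi]] hg card_image[OF inj]
    by simp
  ultimately show False using idx unfolding has_index_def by (metis not_less_eq_eq order_refl)
qed

text \<open>A null vector of the semidefinite complement is orthogonal to the complement by
  Cauchy-Schwarz and to the frame by definition, hence zero by nondegeneracy.\<close>

lemma frame_compl_pos:
  assumes w: "w \<in> frame_compl u v" "w \<noteq> 0"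
  shows "B w w > 0"
proof (rule ccontr)
  assume "\<not> B w w > 0"
  then have 0: "B w w = 0" using frame_compl_index_nonneg[OF w(1)] by simp
  have "B w y = 0" for y
  proof -
    have "B w (frame_proj u v y) = 0"
      by (rule psd_cauchy_schwarz_zero[OF frame_compl_subspace frame_compl_index_nonneg w(1) 0 frame_proj_compl])
    moreover have "B w (u i) = 0" "B w (v i) = 0" if "i < r" for i
      using w(1) that by (auto simp: frame_compl_def sym[of w])
    ultimately show ?thesis by (simp add: frame_proj_def sum_right)
  qed
  then show False using nondegenerate w(2) by blast
qed

end

end

section \<open>Normalising the complement of the centre\<close>

text \<open>\<open>N\<close> represents an orthonormal basis of \<open>Q\<close> modulo
  \<open>Z\<close>. Equations in this Euclidean quotient are written as membership of a difference
  in \<open>Z\<close>.\<close>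

locale max_isotropic_basis = max_isotropic B T r Z
  for B :: "'v::real_vector \<Rightarrow> 'v \<Rightarrow> real" and T r Z +
  fixes N :: "'v set"
  assumes N_fin: "finite N" and N_Q: "N \<subseteq> Q" and N_on: "orthonormal N"
    and N_span: "x \<in> Q \<Longrightarrow> x - (\<Sum>c\<in>N. B x c *\<^sub>R c) \<in> Z"
begin

lemma Q_decomp:
  assumes "x \<in> Q"
  obtains z where "z \<in> Z" "x = (\<Sum>c\<in>N. B x c *\<^sub>R c) + z"
  using N_span[OF assms] by (metis add.commute diff_add_cancel)

lemma parseval:
  assumes x: "x \<in> Q" and y: "y \<in> Q"
  shows "B x y = (\<Sum>c\<in>N. B x c * B y c)"
proof -
  obtain z where z: "z \<in> Z" "y = (\<Sum>c\<in>N. B y c *\<^sub>R c) + z" using Q_decomp[OF y] .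
  show ?thesis by (subst z(2)) (simp add: sum_right B_Z_Q[OF z(1) x] mult.commute)
qed

lemma Q_nonneg: "x \<in> Q \<Longrightarrow> B x x \<ge> 0"
  by (simp add: parseval sum_nonneg)

lemma Z_iff_N: "x \<in> Q \<Longrightarrow> x \<in> Z \<longleftrightarrow> (\<forall>c\<in>N. B x c = 0)"
proof
  assume "x \<in> Q" "x \<in> Z"
  then show "\<forall>c\<in>N. B x c = 0" using B_Z_Q(1) N_Q by blast
next
  assume "x \<in> Q" "\<forall>c\<in>N. B x c = 0"
  then show "x \<in> Z" using N_span[of x] by simp
qed

lemma Z_iff_norm: "x \<in> Q \<Longrightarrow> x \<in> Z \<longleftrightarrow> B x x = 0"
  using N_fin by (simp add: Z_iff_N parseval sum_nonneg_eq_0_iff)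

lemma B_cong_Z:
  assumes "x - y \<in> Z" "q \<in> Q"
  shows "B x q = B y q" "B q x = B q y"
  using B_Z_Q[OF assms] by simp_all

text \<open>In the basis \<open>N\<close> the operator \<open>D\<close> is a skew matrix;
  contracting it with a bilinear \<open>F\<close> that ignores \<open>Z\<close> changes sign when
  \<open>D\<close> moves to the other slot.\<close>

lemma Q_skew_sum:
  assumes F: "\<And>x. linear (F x)" "\<And>y. linear (\<lambda>x. F x y)"
    and FZ: "\<And>x z. z \<in> Z \<Longrightarrow> F x z = 0" "\<And>x z. z \<in> Z \<Longrightarrow> F z x = 0"
    and D: "\<And>x. x \<in> Q \<Longrightarrow> D x \<in> Q" "\<And>x y. x \<in> Q \<Longrightarrow> y \<in> Q \<Longrightarrow> B (D x) y = - B x (D y)"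
  shows "(\<Sum>c\<in>N. F c (D c)) = - (\<Sum>c\<in>N. F (D c) c :: real)"
proof -
  have l: "F c (D c) = (\<Sum>e\<in>N. B (D c) e * F c e)" if "c \<in> N" for c
  proof -
    have "D c \<in> Q" using that N_Q D(1) by blast
    then obtain z where z: "z \<in> Z" "D c = (\<Sum>e\<in>N. B (D c) e *\<^sub>R e) + z"
      by (rule Q_decomp)
    show ?thesis
      by (subst z(2)) (simp add: linear_add[OF F(1)] linear_sum[OF F(1)] linear_scale[OF F(1)] FZ z(1))
  qed
  have r: "F (D c) c = (\<Sum>e\<in>N. B (D c) e * F e c)" if "c \<in> N" for c
  proof -
    have "D c \<in> Q" using that N_Q D(1) by blast
    then obtain z where z: "z \<in> Z" "D c = (\<Sum>e\<in>N. B (D c) e *\<^sub>R e) + z"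
      by (rule Q_decomp)
    show ?thesis
      by (subst z(2)) (simp add: linear_add[OF F(2)] linear_sum[OF F(2)] linear_scale[OF F(2)] FZ z(1))
  qed
  have "(\<Sum>c\<in>N. F (D c) c) = (\<Sum>c\<in>N. \<Sum>e\<in>N. B (D c) e * F e c)"
    using r by simp
  also have "\<dots> = (\<Sum>e\<in>N. \<Sum>c\<in>N. B (D c) e * F e c)" by (rule sum.swap)
  also have "\<dots> = (\<Sum>e\<in>N. \<Sum>c\<in>N. - (B (D e) c * F e c))"
  proof (intro sum.cong refl)
    fix c e assume "c \<in> N" "e \<in> N"
    then have "B (D c) e = - B (D e) c"
      using D(2)[of c e] N_Q sym[of c "D e"] by auto
    then show "B (D c) e * F e c = - (B (D e) c * F e c)" by simp
  qed
  also have "\<dots> = - (\<Sum>e\<in>N. F e (D e))"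
    using l by (simp add: sum_negf)
  finally show ?thesis by simp
qed

lemma T_Z_from_N:
  assumes "\<And>c. c \<in> N \<Longrightarrow> T x y c \<in> Z" "q \<in> Q"
  shows "T x y q \<in> Z"
proof -
  obtain z where z: "z \<in> Z" "q = (\<Sum>c\<in>N. B q c *\<^sub>R c) + z" using Q_decomp[OF assms(2)] .
  show ?thesis by (subst z(2)) (auto simp: T_sum Z_central[OF z(1)] intro!: Z_closed assms(1))
qed

subsection \<open>The bracket of three elements orthogonal to the centre\<close>

text \<open>Minimises the Euclidean norm of the tensor \<open>T (p - e) c d\<close> over
  \<open>e\<close> in \<open>Q\<close>; the conclusion is the system of normal equations.\<close>

lemma twist_single:
  "\<exists>e\<in>Q. \<forall>a\<in>Q. (\<Sum>c\<in>N. \<Sum>d\<in>N. B (T (p - e) c d) (T a c d)) = 0"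
proof -
  define w where "w = (\<lambda>(c, d, f). B (T p c d) f)"
  define b where "b s = (\<lambda>(c, d, f). B (T s c d) f)" for s
  obtain k where k: "\<And>t. t \<in> N \<Longrightarrow> (\<Sum>i\<in>N\<times>N\<times>N. (w i - (\<Sum>s\<in>N. k s * b s i)) * b t i) = 0"
    using least_squares[OF N_fin, of "N \<times> N \<times> N" w b] N_fin by blast
  define e where "e = (\<Sum>s\<in>N. k s *\<^sub>R s)"
  have e: "e \<in> Q" unfolding e_def using N_Q by (auto intro!: Q_closed)
  have wb: "w (c, d, f) - (\<Sum>s\<in>N. k s * b s (c, d, f)) = B (T (p - e) c d) f" for c d f
    by (simp add: w_def b_def e_def T_sum sum_left)
  have t: "(\<Sum>c\<in>N. \<Sum>d\<in>N. B (T (p - e) c d) (T t c d)) = 0" if "t \<in> N" for t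
  proof -
    have "(\<Sum>c\<in>N. \<Sum>d\<in>N. B (T (p - e) c d) (T t c d)) =
      (\<Sum>c\<in>N. \<Sum>d\<in>N. \<Sum>f\<in>N. B (T (p - e) c d) f * B (T t c d) f)"
      by (simp add: parseval[OF T_Q T_Q] del: T_simps)
    also have "\<dots> = (\<Sum>i\<in>N\<times>N\<times>N. (w i - (\<Sum>s\<in>N. k s * b s i)) * b t i)"
    proof -
      have bt: "b t (c, d, f) = B (T t c d) f" for c d f by (simp add: b_def)
      show ?thesis
        unfolding sum.cartesian_product by (intro sum.cong refl) (auto simp: wb bt simp del: T_simps)
    qed
    finally show ?thesis using k[OF that] by simp
  qed
  have "(\<Sum>c\<in>N. \<Sum>d\<in>N. B (T (p - e) c d) (T a c d)) = 0" if "a \<in> Q" for a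
  proof -
    obtain z where z: "z \<in> Z" "a = (\<Sum>s\<in>N. B a s *\<^sub>R s) + z" using Q_decomp[OF \<open>a \<in> Q\<close>] .
    have a: "T a c d = (\<Sum>s\<in>N. B a s *\<^sub>R T s c d)" for c d
      by (subst z(2)) (simp add: T_sum Z_central[OF z(1)])
    have "(\<Sum>c\<in>N. \<Sum>d\<in>N. B (T (p - e) c d) (T a c d)) =
       (\<Sum>c\<in>N. \<Sum>d\<in>N. \<Sum>s\<in>N. B a s * B (T (p - e) c d) (T s c d))"
      unfolding a sum_right by (simp del: T_simps)
    also have "\<dots> = (\<Sum>s\<in>N. B a s * (\<Sum>c\<in>N. \<Sum>d\<in>N. B (T (p - e) c d) (T s c d)))"
      unfolding sum_distrib_left
      by (subst sum.swap[of _ N N], subst (2) sum.swap, subst sum.swap) (rule sum.cong[OF refl sum.swap])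
    finally show ?thesis using t by simp
  qed
  then show ?thesis using e by blast
qed

text \<open>Put \<open>D = T x y\<close> and \<open>q = D p\<close>. By the fundamental identity the
  tensor \<open>T q\<close> is the derivative of \<open>T p\<close> along \<open>D\<close>. As
  \<open>D\<close> is skew, the squared norm of \<open>T q\<close> is minus the product of
  \<open>T p\<close> with the derivative of \<open>T q\<close>, that is with \<open>T (D q)\<close>.
  Since \<open>D q\<close> lies in \<open>Q\<close>, the hypothesis makes this zero.\<close>

lemma twisted_central:
  assumes ort: "\<And>a. a \<in> Q \<Longrightarrow> (\<Sum>c\<in>N. \<Sum>d\<in>N. B (T p c d) (T a c d)) = 0"
    and x: "x \<in> Q" and y: "y \<in> Q" and w: "w1 \<in> Q" "w2 \<in> Q"
  shows "T (T p x y) w1 w2 \<in> Z"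
proof -
  define q where "q = T x y p"
  have skew: "B (T x y a) b = - B a (T x y b)" for a b by (rule metric)
  have T1: "(\<Sum>c\<in>N. B (T q c d) (T p (T x y c) d)) = - (\<Sum>c\<in>N. B (T q (T x y c) d) (T p c d))" for d
    by (rule Q_skew_sum) (auto intro!: linearI simp: Z_central T_Q skew)
  have T2: "(\<Sum>d\<in>N. B (T q c d) (T p c (T x y d))) = - (\<Sum>d\<in>N. B (T q c (T x y d)) (T p c d))" for c
    by (rule Q_skew_sum) (auto intro!: linearI simp: Z_central T_Q skew)
  have q: "T q c d = T x y (T p c d) - T p (T x y c) d - T p c (T x y d)" for c d
    unfolding q_def using FI[of x y p c d] by simp
  have 1: "B (T q c d) (T q c d) = - B (T x y (T q c d)) (T p c d)
      - B (T q c d) (T p (T x y c) d) - B (T q c d) (T p c (T x y d))" for c d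
    by (subst (2) q) (simp add: skew)
  have S1: "(\<Sum>c\<in>N. \<Sum>d\<in>N. B (T q c d) (T p (T x y c) d)) =
      - (\<Sum>c\<in>N. \<Sum>d\<in>N. B (T q (T x y c) d) (T p c d))"
    by (subst sum.swap, subst (2) sum.swap) (simp add: T1 sum_negf)
  have S2: "(\<Sum>c\<in>N. \<Sum>d\<in>N. B (T q c d) (T p c (T x y d))) =
      - (\<Sum>c\<in>N. \<Sum>d\<in>N. B (T q c (T x y d)) (T p c d))"
    by (simp add: T2 sum_negf)
  have "(\<Sum>c\<in>N. \<Sum>d\<in>N. B (T q c d) (T q c d)) =
      - (\<Sum>c\<in>N. \<Sum>d\<in>N. B (T x y (T q c d)) (T p c d))
      - (\<Sum>c\<in>N. \<Sum>d\<in>N. B (T q c d) (T p (T x y c) d))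
      - (\<Sum>c\<in>N. \<Sum>d\<in>N. B (T q c d) (T p c (T x y d)))"
    by (subst 1) (simp add: sum_subtractf sum_negf)
  also have "\<dots> = - (\<Sum>c\<in>N. \<Sum>d\<in>N. B (T x y (T q c d) - T q (T x y c) d - T q c (T x y d)) (T p c d))"
    unfolding S1 S2 by (simp add: sum_subtractf)
  also have "\<dots> = - (\<Sum>c\<in>N. \<Sum>d\<in>N. B (T p c d) (T (T x y q) c d))"
    by (subst FI[of x y q]) (simp add: sym)
  also have "\<dots> = 0" using ort[OF T_Q] by simp
  finally have "(\<Sum>c\<in>N. \<Sum>d\<in>N. B (T q c d) (T q c d)) = 0" .
  then have "\<forall>c\<in>N. \<forall>d\<in>N. B (T q c d) (T q c d) = 0"
    using N_fin by (simp add: sum_nonneg_eq_0_iff sum_nonneg Q_nonneg T_Q)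
  then have cd: "T q c d \<in> Z" if "c \<in> N" "d \<in> N" for c d
    using that by (simp add: Z_iff_norm T_Q)
  have "T q c w2 \<in> Z" if "c \<in> N" for c
    by (rule T_Z_from_N[OF _ w(2)]) (rule cd[OF that])
  then have "T w2 q c \<in> Z" if "c \<in> N" for c
    using that by (simp add: T_cyc[of w2 q c])
  then have "T w2 q w1 \<in> Z" by (rule T_Z_from_N[OF _ w(1)])
  then show ?thesis by (simp add: q_def T_cyc[of p x y] T_cyc[of w2])
qed

definition S1 :: "'v set" where
  "S1 = span {T a b c | a b c. a \<in> Q \<and> b \<in> Q \<and> c \<in> Q}"

definition S2 :: "'v set" where
  "S2 = span {T a b c | a b c. a \<in> S1 \<and> b \<in> S1 \<and> c \<in> S1}"

lemma span_T_Q: "span {T a b c | a b c. P a b c} \<subseteq> Q"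
  by (rule span_minimal[OF _ Q_subspace]) (use T_Q in blast)

lemma S1_Q: "x \<in> S1 \<Longrightarrow> x \<in> Q"
  unfolding S1_def by (rule subsetD[OF span_T_Q])

lemma S1_T: "a \<in> Q \<Longrightarrow> b \<in> Q \<Longrightarrow> c \<in> Q \<Longrightarrow> T a b c \<in> S1"
  unfolding S1_def by (rule span_base) blast

lemma S2_ideal: "is_ideal3 T S2"
  unfolding S2_def S1_def
  by (intro derived_ideal) (simp add: is_ideal3_def T_Q)

text \<open>Metricity turns a product of \<open>S1\<close> with \<open>T p x y\<close> into a
  bracket that \<open>twisted_central\<close> puts in \<open>Z\<close>. A second use of metricity
  extracts \<open>p\<close> from a product with a bracket of elements of \<open>S1\<close>, which is
  why the derived ideal is formed twice.\<close>

lemma S2_perp: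
  assumes ort: "\<And>a. a \<in> Q \<Longrightarrow> (\<Sum>c\<in>N. \<Sum>d\<in>N. B (T p c d) (T a c d)) = 0"
    and s: "s \<in> S2"
  shows "B s p = 0"
proof -
  have 1: "B (T p x y) s = 0" if "x \<in> Q" "y \<in> Q" "s \<in> S1" for x y s
  proof -
    have "B (T a b c) (T p x y) = 0" if "a \<in> Q" "b \<in> Q" "c \<in> Q" for a b c
    proof -
      have "T (T p x y) a b \<in> Z"
        by (rule twisted_central[OF ort]) (use that \<open>x \<in> Q\<close> \<open>y \<in> Q\<close> in auto)
      then have "T a b (T p x y) \<in> Z" by (simp add: T_cyc[of "T p x y" a b])
      then show ?thesis using B_Z_Q \<open>c \<in> Q\<close> metric by simp
    qed
    then show ?thesis
      using perp_span[OF _ \<open>s \<in> S1\<close>[unfolded S1_def], of "T p x y"] by (auto simp: sym)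
  qed
  have "B (T a b c) p = 0" if "a \<in> S1" "b \<in> S1" "c \<in> S1" for a b c
  proof -
    have "B (T a b c) p = - B c (T p a b)" using metric T_cyc by simp
    also have "\<dots> = 0" using 1[of a b c] that S1_Q sym by auto
    finally show ?thesis .
  qed
  then show ?thesis using perp_span[OF _ s[unfolded S2_def], of p] by blast
qed

lemma S2_Q: "x \<in> S2 \<Longrightarrow> x \<in> Q"
  unfolding S2_def by (rule subsetD[OF span_T_Q])

text \<open>Replacing \<open>p\<close> by \<open>p - e\<close> with \<open>e\<close> in
  \<open>Q\<close> does not change its product with an element of \<open>Z\<close>, so every
  \<open>p\<close> may be given its own twist.\<close>

lemma S2_Z: "x \<in> S2 \<Longrightarrow> x \<in> Z \<Longrightarrow> x = 0"
proof (rule nondegenerate)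
  fix p assume x: "x \<in> S2" "x \<in> Z"
  obtain e where e: "e \<in> Q" "\<And>a. a \<in> Q \<Longrightarrow> (\<Sum>c\<in>N. \<Sum>d\<in>N. B (T (p - e) c d) (T a c d)) = 0"
    using twist_single[of p] by blast
  have "B x (p - e) = 0" using S2_perp[OF e(2) x(1)] .
  then show "B x p = 0" using B_Z_Q(1)[OF x(2) e(1)] by simp
qed

lemma T_QQQ:
  assumes "indecomposable3 B T" "r > 0" "x \<in> Q" "y \<in> Q" "z \<in> Q"
  shows "T x y z \<in> Z"
proof -
  \<comment> \<open>Here \<open>r > 0\<close> matters: a nonzero element of \<open>Z\<close> cannot
    lie in \<open>S2\<close>, so the ideal \<open>S2\<close> is proper.\<close>
  obtain z0 where z0: "z0 \<in> Z" "z0 \<noteq> 0"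
  proof -
    have "Z \<noteq> {0}" using Z_dim assms(2) dim_span[of "{} :: 'v set"] dim_eq_card_independent[OF real_vector.independent_empty, where 'a='v] by auto
    then show ?thesis using Z_closed(5) that by blast
  qed
  have "S2 = {0}"
  proof (rule positive_ideal_trivial[OF assms(1)])
    show "subspace S2" by (simp add: S2_def)
    show "is_ideal3 T S2" by (rule S2_ideal)
    show "S2 \<noteq> UNIV" using S2_Z z0 by blast
    fix x assume x: "x \<in> S2" "x \<noteq> 0"
    then show "B x x > 0"
      using S2_Z Q_nonneg[OF S2_Q[OF x(1)]] Z_iff_norm[OF S2_Q[OF x(1)]] by fastforce
  qed
  then have 0: "T a b c = 0" if "a \<in> S1" "b \<in> S1" "c \<in> S1" for a b c
    using that span_base[of "T a b c" "{T a b c |a b c. a \<in> S1 \<and> b \<in> S1 \<and> c \<in> S1}"] unfolding S2_def by blast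
  \<comment> \<open>A skew operator on a Euclidean space whose square kills \<open>d\<close> kills
    \<open>d\<close>. Three applications trade the slots in \<open>S1\<close> for slots in
    \<open>Q\<close> one at a time.\<close>
  have norm: "T a b d \<in> Z" if "T a b (T a b d) \<in> Z" "d \<in> Q" for a b d
    unfolding Z_iff_norm[OF T_Q] metric using B_Z_Q that by simp
  have 1: "T a b d \<in> Z" if "a \<in> S1" "b \<in> S1" "d \<in> Q" for a b d
  proof (rule norm)
    have "T a b d \<in> S1" using that S1_T S1_Q by blast
    then show "T a b (T a b d) \<in> Z" using that 0 Z_closed(5) by simp
  qed (rule that)
  have 2: "T a d e \<in> Z" if "a \<in> S1" "d \<in> Q" "e \<in> Q" for a d e
  proof (rule norm)
    have "T a d e \<in> S1" using that S1_T S1_Q by blast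
    then have "T a (T a d e) d \<in> Z" using that 1 by blast
    then show "T a d (T a d e) \<in> Z" unfolding T_swap23[of a d] by (rule Z_closed(4))
  qed (use that in auto)
  show ?thesis
  proof (rule norm)
    have "T (T x y z) x y \<in> Z" using assms S1_T 2 by blast
    then show "T x y (T x y z) \<in> Z" unfolding T_cyc[of "T x y z" x y] .
  qed (use assms in auto)
qed

end

locale normalisable = max_isotropic_basis B T r Z N
  for B :: "'v::real_vector \<Rightarrow> 'v \<Rightarrow> real" and T r Z N +
  assumes indec: "indecomposable3 B T" and rpos: "r > 0"
begin

section \<open>Consequences of the fundamental identity modulo the centre\<close>

lemmas TQ = T_QQQ[OF indec rpos]

lemma TQ_perm:
  assumes "x \<in> Q" "y \<in> Q" "T p x y \<in> Z"
  shows "T p y x \<in> Z" "T x p y \<in> Z" "T y p x \<in> Z" "T x y p \<in> Z" "T y x p \<in> Z"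
  using assms(3) Z_closed(4)[of "- T p x y"] Z_closed(4)[of "T p x y"]
    T_swap23[of p y x] T_swap12[of x p y] T_cyc[of p x y] T_cyc[of y p x] T_swap12[of y x p]
  by auto

lemma Z_neg_iff: "- x \<in> Z \<longleftrightarrow> x \<in> Z"
  using Z_closed(4)[of x] Z_closed(4)[of "- x"] by auto

lemma sum_cartesian4:
  "sum g (I \<times> J \<times> K \<times> L) = (\<Sum>i\<in>I. \<Sum>j\<in>J. \<Sum>k\<in>K. \<Sum>l\<in>L. g (i, j, k, l))"
  by (simp add: sum.cartesian_product split_def)

lemma sum_if_const: "(\<Sum>j\<in>A. if P then f j else 0) = (if P then sum f A else (0::real))"
  by simp

lemma sum_delta2:
  fixes f g :: "nat \<Rightarrow> nat \<Rightarrow> real"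
  assumes "l < r"
  shows "(\<Sum>i<r. \<Sum>j<r. (if i = l then f i j else 0) + (if j = l then g i j else 0)) =
    (\<Sum>j<r. f l j) + (\<Sum>i<r. g i l)"
  using assms by (simp add: sum.distrib sum_if_const)

lemma sum_delta3:
  fixes f g h :: "nat \<Rightarrow> nat \<Rightarrow> nat \<Rightarrow> real"
  assumes "l < r"
  shows "(\<Sum>i<r. \<Sum>j<r. \<Sum>k<r. (if i = l then f i j k else 0) + (if j = l then g i j k else 0)
      + (if k = l then h i j k else 0)) =
    (\<Sum>j<r. \<Sum>k<r. f l j k) + (\<Sum>i<r. \<Sum>k<r. g i l k) + (\<Sum>i<r. \<Sum>j<r. h i j l)"
  using assms by (simp add: sum.distrib sum_if_const)

text \<open>The third term of the fundamental identity is a bracket of three elements of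
  \<open>Q\<close> and drops out; the same happens in \<open>J_derivation\<close>.\<close>

lemma bracket_derivation:
  assumes "x \<in> Q" "y \<in> Q" "z \<in> Q"
  shows "T p x (T q y z) - T q (T p x y) z - T q y (T p x z) \<in> Z"
  using FI[of p x q y z] TQ[OF T_Q assms(2,3), of p x q] by simp

lemma J_derivation:
  assumes "x \<in> Q" "y \<in> Q"
  shows "T p q (T s x y) - T s (T p q x) y - T s x (T p q y) \<in> Z"
  using FI[of p q s x y] TQ[OF T_Q assms, of p q s] by simp

text \<open>The fundamental identity for \<open>T x y\<close> on \<open>T p q z\<close> has only two
  terms outside \<open>Z\<close>. This exchange of \<open>p\<close> and \<open>q\<close> later
  forces the brackets \<open>br i\<close> to be proportional on an irreducible piece.\<close>

lemma bracket_exchange: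
  assumes "x \<in> Q" "y \<in> Q" "z \<in> Q"
  shows "T q (T p x y) z - T p (T q x y) z \<in> Z"
proof -
  have "T x y (T p q z) \<in> Z" by (rule TQ[OF assms(1,2) T_Q])
  moreover have "T p q (T x y z) = 0" by (rule Z_central3[OF TQ[OF assms]])
  moreover have "T (T x y p) q z = - T q (T p x y) z"
    unfolding T_cyc[of p x y] by (rule T_swap12)
  ultimately have "- T q (T p x y) z + T p (T q x y) z \<in> Z"
    using FI[of x y p q z] T_cyc[of q x y] by simp
  then show ?thesis using Z_closed(4) by fastforce
qed

text \<open>\<open>T p x (T q s y)\<close> is computed in two ways, by \<open>J_derivation\<close>
  and by the fundamental identity for \<open>T p x\<close>; the term \<open>T q s (T p x y)\<close>
  cancels.\<close>

lemma J_bracket_cyclic: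
  assumes "x \<in> Q" "y \<in> Q"
  shows "T s (T p q x) y + T q (T s p x) y + T p (T q s x) y \<in> Z"
proof -
  have "T q s (T p x y) - T p (T q s x) y - T p x (T q s y) \<in> Z"
    by (rule J_derivation[OF assms])
  moreover have "T p x (T q s y) = T (T p x q) s y + T q (T p x s) y + T q s (T p x y)"
    by (rule FI)
  moreover have "T (T p x q) s y = T s (T p q x) y"
    by (subst T_swap12, subst T_swap23[of p x q]) simp
  moreover have "T p x s = T s p x" by (rule T_cyc[symmetric])
  ultimately have "- (T s (T p q x) y + T q (T s p x) y + T p (T q s x) y) \<in> Z"
    by (simp add: algebra_simps)
  then show ?thesis by (simp only: Z_neg_iff)
qed

subsection \<open>Twisting away the action of the frame on the brackets\<close>

text \<open>All \<open>e i\<close> vary together: \<open>b (l, a)\<close> is the first-order change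
  of the tensors \<open>T (u i) (u j)\<close> when \<open>u l\<close> moves by \<open>a\<close>. The
  quadratic term \<open>T (e i) (e j) c\<close> lies in \<open>Z\<close>, so the problem is
  linear.\<close>

lemma twist_family:
  "\<exists>e. (\<forall>i. e i \<in> Q) \<and> (\<forall>l<r. \<forall>a\<in>Q.
    (\<Sum>i<r. \<Sum>c\<in>N. B (T (u i - e i) (u l - e l) c) (T (u i - e i) a c)) = 0)"
proof -
  let ?R = "{..<r}"
  define w where "w = (\<lambda>(i, j, c, d). B (T (u i) (u j) c) d)"
  define b where "b = (\<lambda>(l, a) (i, j, c, d).
    (if i = l then B (T a (u j) c) d else 0) + (if j = l then B (T (u i) a c) d else 0))"
  obtain k where k: "\<And>t. t \<in> ?R \<times> N \<Longrightarrow>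
     (\<Sum>i\<in>?R\<times>?R\<times>N\<times>N. (w i - (\<Sum>s\<in>?R\<times>N. k s * b s i)) * b t i) = 0"
    using least_squares[of "?R \<times> N" "?R \<times> ?R \<times> N \<times> N" w b] N_fin by auto
  define e where "e i = (\<Sum>a\<in>N. k (i, a) *\<^sub>R a)" for i
  have e: "e i \<in> Q" for i unfolding e_def using N_Q by (auto intro!: Q_closed)
  define X where "X i j c = T (u i - e i) (u j - e j) c" for i j c
  have P: "(\<Sum>d\<in>N. B (X i j c) d * B y d) = B (X i j c) y" if "y \<in> Q" for i j c y
    using parseval[OF _ that, of "X i j c"] T_Q unfolding X_def by (simp del: T_simps)
  have Xswap: "X j i c = - X i j c" for i j c unfolding X_def by (rule T_swap12)
  have wb: "w (i, j, c, d) - (\<Sum>s\<in>?R\<times>N. k s * b s (i, j, c, d)) = B (X i j c) d"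
    if "i < r" "j < r" "c \<in> N" "d \<in> N" for i j c d
  proof -
    have "(\<Sum>s\<in>?R\<times>N. k s * b s (i, j, c, d)) = (\<Sum>l<r. \<Sum>a\<in>N. k (l, a) * b (l, a) (i, j, c, d))"
      by (simp add: sum.cartesian_product)
    also have "\<dots> = (\<Sum>l<r. (if i = l then \<Sum>a\<in>N. k (l, a) * B (T a (u j) c) d else 0)
       + (if j = l then \<Sum>a\<in>N. k (l, a) * B (T (u i) a c) d else 0))"
      by (intro sum.cong refl) (auto simp: b_def sum.distrib distrib_left)
    also have "\<dots> = (\<Sum>a\<in>N. k (i, a) * B (T a (u j) c) d) + (\<Sum>a\<in>N. k (j, a) * B (T (u i) a c) d)"
      using that by (simp add: sum.distrib)
    also have "\<dots> = B (T (e i) (u j) c + T (u i) (e j) c) d"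
      by (simp add: e_def T_sum sum_left)
    finally have 1: "(\<Sum>s\<in>?R\<times>N. k s * b s (i, j, c, d)) = B (T (e i) (u j) c + T (u i) (e j) c) d" .
    have "T (e i) (e j) c \<in> Z" using e N_Q that TQ by blast
    then have "B (T (e i) (e j) c) d = 0" using B_Z_Q N_Q that by blast
    then show ?thesis unfolding 1 by (simp add: w_def X_def)
  qed
  have N0: "(\<Sum>i<r. \<Sum>c\<in>N. B (X i l c) (T (u i) a c)) = 0" if l: "l < r" and a: "a \<in> N" for l a
  proof -
    have "0 = (\<Sum>i<r. \<Sum>j<r. \<Sum>c\<in>N. \<Sum>d\<in>N. B (X i j c) d * b (l, a) (i, j, c, d))"
      using k[of "(l, a)"] l a wb by (simp add: sum_cartesian4)
    also have "\<dots> = (\<Sum>i<r. \<Sum>j<r. (if i = l then \<Sum>c\<in>N. B (X i j c) (T a (u j) c) else 0)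
        + (if j = l then \<Sum>c\<in>N. B (X i j c) (T (u i) a c) else 0))"
      by (intro sum.cong refl)
        (auto simp: b_def sum.distrib distrib_left P T_Q)
    also have "\<dots> = (\<Sum>j<r. \<Sum>c\<in>N. B (X l j c) (T a (u j) c)) + (\<Sum>i<r. \<Sum>c\<in>N. B (X i l c) (T (u i) a c))"
      by (rule sum_delta2[OF l])
    \<comment> \<open>The two Kronecker terms of \<open>b\<close> contribute equally by
      antisymmetry, so twice the desired sum is zero.\<close>
    also have "(\<Sum>j<r. \<Sum>c\<in>N. B (X l j c) (T a (u j) c)) = (\<Sum>i<r. \<Sum>c\<in>N. B (X i l c) (T (u i) a c))"
      by (intro sum.cong refl, subst Xswap, subst T_swap12) simp
    finally show ?thesis by simp
  qed
  have N1: "(\<Sum>i<r. \<Sum>c\<in>N. B (X i l c) (T (u i) a c)) = 0" if l: "l < r" and a: "a \<in> Q" for l a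
  proof -
    obtain z where z: "z \<in> Z" "a = (\<Sum>s\<in>N. B a s *\<^sub>R s) + z" using Q_decomp[OF a] .
    have "T p a c = (\<Sum>s\<in>N. B a s *\<^sub>R T p s c)" for p c
      by (subst z(2)) (simp add: T_sum Z_central[OF z(1)])
    then have "(\<Sum>i<r. \<Sum>c\<in>N. B (X i l c) (T (u i) a c)) =
        (\<Sum>i<r. \<Sum>c\<in>N. \<Sum>s\<in>N. B a s * B (X i l c) (T (u i) s c))"
      by (simp add: sum_right)
    also have "\<dots> = (\<Sum>s\<in>N. B a s * (\<Sum>i<r. \<Sum>c\<in>N. B (X i l c) (T (u i) s c)))"
      unfolding sum_distrib_left
      by (subst sum.swap[of _ N N], subst sum.swap[of _ N "{..<r}"]) (rule refl)
    finally show ?thesis using N0[OF l] by simp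
  qed
  have "B (X i l c) (T (u i - e i) a c) = B (X i l c) (T (u i) a c)" if "a \<in> Q" "c \<in> N" for i l a c
  proof -
    have "T (e i) a c \<in> Z" using e that N_Q TQ by blast
    then show ?thesis using B_Z_Q T_Q by (simp add: X_def del: T_simps add: T_simps(4))
  qed
  then have "(\<Sum>i<r. \<Sum>c\<in>N. B (X i l c) (T (u i - e i) a c)) = 0" if "l < r" "a \<in> Q" for l a
    using N1[OF that] that(2) by simp
  then show ?thesis using e unfolding X_def by blast
qed

text \<open>Invariance of the trace form: the commutator with \<open>T t x\<close> moves from
  \<open>T q s\<close> to \<open>T p y\<close>, where \<open>bracket_derivation\<close> turns it
  into \<open>T p (T t x y)\<close>.\<close>

lemma J_bracket_trace:
  assumes x: "x \<in> Q" and y: "y \<in> Q"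
  shows "(\<Sum>c\<in>N. B (T p y c) (T q s (T t x c) - T t x (T q s c))) =
     (\<Sum>c\<in>N. B (T p (T t x y) c) (T q s c))"
proof -
  have a: "(\<Sum>c\<in>N. B (T p y c) (T q s (T t x c))) = - (\<Sum>c\<in>N. B (T p y (T t x c)) (T q s c))"
    by (rule Q_skew_sum) (auto intro!: linearI simp: Z_central T_Q metric[of t x])
  have b: "(\<Sum>c\<in>N. B (T p y c) (T t x (T q s c))) = - (\<Sum>c\<in>N. B (T t x (T p y c)) (T q s c))"
    by (simp add: metric[of t x] sum_negf)
  have c: "B (T t x (T p y c)) (T q s c) - B (T p y (T t x c)) (T q s c) = B (T p (T t x y) c) (T q s c)"
    if "c \<in> N" for c
  proof -
    have "B (T t x (T p y c) - T p (T t x y) c - T p y (T t x c)) (T q s c) = 0"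
      by (rule B_Z_Q(1)[OF bracket_derivation T_Q]) (use x y that N_Q in auto)
    then show ?thesis by simp
  qed
  have "(\<Sum>c\<in>N. B (T p y c) (T q s (T t x c) - T t x (T q s c))) =
     (\<Sum>c\<in>N. B (T t x (T p y c)) (T q s c) - B (T p y (T t x c)) (T q s c))"
    by (simp add: sum_subtractf a b)
  then show ?thesis using c by simp
qed

definition J_central :: "(nat \<Rightarrow> 'v) \<Rightarrow> bool" where
  "J_central u \<longleftrightarrow> (\<forall>i<r. \<forall>j<r. \<forall>k<r. \<forall>x\<in>Q. \<forall>y\<in>Q. T (u k) (T (u i) (u j) x) y \<in> Z)"

text \<open>With \<open>k\<close> and \<open>x\<close> fixed, \<open>X i j\<close> is modulo
  \<open>Z\<close> the commutator \<open>f i j\<close> of \<open>T (u i) (u j)\<close> with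
  \<open>T (u k) x\<close>. \<open>J_bracket_cyclic\<close> rewrites the other factor of the squared
  norm, and \<open>J_bracket_trace\<close> turns the result into pairings of
  \<open>T (u i) (u j)\<close> with operators \<open>T (u i) a\<close> or \<open>T (u j) a\<close>,
  \<open>a\<close> in \<open>Q\<close>. These vanish by the normal equations.\<close>

lemma twisted_J_central:
  assumes ort: "\<And>l a. l < r \<Longrightarrow> a \<in> Q \<Longrightarrow> (\<Sum>i<r. \<Sum>c\<in>N. B (T (u i) (u l) c) (T (u i) a c)) = 0"
  shows "J_central u"
proof -
  have "T (u k) (T (u i) (u j) x) y \<in> Z"
    if k: "k < r" and ij: "i < r" "j < r" and x: "x \<in> Q" and y: "y \<in> Q" for i j k x y
  proof -
    define X where "X i j c = T (u k) (T (u i) (u j) x) c" for i j c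
    define f where "f i j c = T (u i) (u j) (T (u k) x c) - T (u k) x (T (u i) (u j) c)" for i j c
    have X1: "B (X i j c) (X i j c) = - B (T (u i) (T (u j) (u k) x) c) (f i j c)
        - B (T (u j) (T (u k) (u i) x) c) (f i j c)" if c: "c \<in> N" for i j c
    proof -
      have "c \<in> Q" using c N_Q by blast
      have XQ: "X i j c \<in> Q" unfolding X_def by (rule T_Q)
      have fQ: "f i j c \<in> Q" unfolding f_def by (intro Q_closed T_Q)
      have "X i j c - (- T (u i) (T (u j) (u k) x) c - T (u j) (T (u k) (u i) x) c) \<in> Z"
        using J_bracket_cyclic[OF x \<open>c \<in> Q\<close>, of "u k" "u i" "u j"]
        unfolding X_def by (simp add: algebra_simps)
      moreover have "f i j c - X i j c \<in> Z"
        using J_derivation[OF x \<open>c \<in> Q\<close>, of "u i" "u j" "u k"]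
        unfolding X_def f_def by (simp add: algebra_simps)
      ultimately have "B (X i j c) (f i j c) = - B (T (u i) (T (u j) (u k) x) c) (f i j c)
        - B (T (u j) (T (u k) (u i) x) c) (f i j c)" "B (X i j c) (f i j c) = B (X i j c) (X i j c)"
        using B_cong_Z(1)[OF _ fQ] B_cong_Z(2)[OF _ XQ] by fastforce+
      then show ?thesis by simp
    qed
    have "(\<Sum>i<r. \<Sum>j<r. \<Sum>c\<in>N. B (X i j c) (X i j c)) =
      - (\<Sum>i<r. \<Sum>j<r. \<Sum>c\<in>N. B (T (u i) (T (u j) (u k) x) c) (f i j c))
      - (\<Sum>i<r. \<Sum>j<r. \<Sum>c\<in>N. B (T (u j) (T (u k) (u i) x) c) (f i j c))"
      by (simp add: X1 sum_subtractf sum_negf)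
    also have "(\<Sum>i<r. \<Sum>j<r. \<Sum>c\<in>N. B (T (u i) (T (u j) (u k) x) c) (f i j c)) =
      (\<Sum>i<r. \<Sum>j<r. \<Sum>c\<in>N. B (T (u i) (u j) c) (T (u i) (T (u k) x (T (u j) (u k) x)) c))"
      unfolding f_def J_bracket_trace[OF x T_Q] by (simp add: sym)
    also have "\<dots> = 0"
      by (subst sum.swap) (intro sum.neutral ballI ort T_Q, simp)
    also have "(\<Sum>i<r. \<Sum>j<r. \<Sum>c\<in>N. B (T (u j) (T (u k) (u i) x) c) (f i j c)) =
      (\<Sum>i<r. \<Sum>j<r. \<Sum>c\<in>N. B (T (u i) (u j) c) (T (u j) (T (u k) x (T (u k) (u i) x)) c))"
      unfolding f_def J_bracket_trace[OF x T_Q] by (simp add: sym)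
    also have "\<dots> = (\<Sum>i<r. - (\<Sum>j<r. \<Sum>c\<in>N. B (T (u j) (u i) c) (T (u j) (T (u k) x (T (u k) (u i) x)) c)))"
      unfolding sum_negf[symmetric]
      by (intro sum.cong refl, subst T_swap12) simp
    also have "\<dots> = 0"
      using ort[OF _ T_Q] by simp
    finally have 0: "(\<Sum>i<r. \<Sum>j<r. \<Sum>c\<in>N. B (X i j c) (X i j c)) = 0" by simp
    have XQ: "X i j c \<in> Q" for i j c unfolding X_def by (rule T_Q)
    have "X i j c \<in> Z" if "c \<in> N" for c
      using 0 ij that N_fin by (simp add: sum_nonneg_eq_0_iff sum_nonneg Q_nonneg XQ Z_iff_norm)
    then show ?thesis using T_Z_from_N y unfolding X_def by blast
  qed
  then show ?thesis unfolding J_central_def by blast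
qed

subsection \<open>Twisting away the brackets of the frame\<close>

text \<open>Modulo \<open>Z\<close> this is the common centre of the brackets \<open>T (u k)\<close>
  on \<open>Q\<close>; \<open>J_central\<close> says that the operators \<open>T (u i) (u j)\<close>
  map \<open>Q\<close> into it.\<close>

definition centraliser :: "(nat \<Rightarrow> 'v) \<Rightarrow> 'v set" where
  "centraliser u = {x \<in> Q. \<forall>k<r. \<forall>y\<in>Q. T (u k) x y \<in> Z}"

lemma centraliser_subspace: "subspace (centraliser u)"
  unfolding subspace_def centraliser_def by (simp add: Q_closed Z_closed)

lemma centraliser_D:
  assumes "x \<in> centraliser u" "k < r" "y \<in> Q"
  shows "T (u k) x y \<in> Z" "T (u k) y x \<in> Z" "T x (u k) y \<in> Z" "T x y (u k) \<in> Z"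
    "T y x (u k) \<in> Z" "T y (u k) x \<in> Z"
proof -
  have x: "x \<in> Q" and 1: "T (u k) x y \<in> Z" using assms by (auto simp: centraliser_def)
  show "T (u k) x y \<in> Z" by (rule 1)
  show "T (u k) y x \<in> Z" "T x (u k) y \<in> Z" "T x y (u k) \<in> Z"
    "T y x (u k) \<in> Z" "T y (u k) x \<in> Z"
    by (rule TQ_perm[OF x assms(3) 1])+
qed

lemma J_central_D:
  assumes "J_central u" "i < r" "j < r" "x \<in> Q"
  shows "T (u i) (u j) x \<in> centraliser u"
  using assms unfolding J_central_def centraliser_def by (auto simp: T_Q)

text \<open>By the fundamental identity \<open>T (u l) x\<close> maps
  \<open>T (u i) (u j) (u k)\<close> to a sum of values of the \<open>J\<close>, hence into the
  centraliser. Applying \<open>T (u l) x\<close> again gives an element of \<open>Z\<close>, and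
  skewness shows that already the first application did.\<close>

lemma K_central:
  assumes J: "J_central u" and ijk: "i < r" "j < r" "k < r"
  shows "T (u i) (u j) (u k) \<in> centraliser u"
proof -
  have "T (u l) x (T (u i) (u j) (u k)) \<in> Z" if l: "l < r" and x: "x \<in> Q" for l x
  proof -
    let ?X = "T (u l) x (T (u i) (u j) (u k))"
    have "T (T (u l) x (u i)) (u j) (u k) \<in> centraliser u"
      using J_central_D[OF J ijk(2,3) T_Q, of "u l" x "u i"] by (simp add: T_cyc[of "T _ _ _" "u j"])
    moreover have "T (u i) (T (u l) x (u j)) (u k) \<in> centraliser u"
      using J_central_D[OF J ijk(3,1) T_Q, of "u l" x "u j"] by (simp add: T_cyc[of "u k"])
    moreover have "T (u i) (u j) (T (u l) x (u k)) \<in> centraliser u"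
      using J_central_D[OF J ijk(1,2) T_Q] .
    ultimately have "?X \<in> centraliser u"
      unfolding FI[of "u l" x "u i" "u j" "u k"] using subspace_add[OF centraliser_subspace] by blast
    then have "T (u l) x ?X \<in> Z" by (rule centraliser_D(2)[OF _ l x])
    then have "B ?X ?X = 0" by (subst metric) (simp add: B_Z_Q T_Q)
    then show ?thesis by (simp add: Z_iff_norm T_Q)
  qed
  then have "T (u l) (T (u i) (u j) (u k)) x \<in> Z" if "l < r" "x \<in> Q" for l x
    using that TQ_perm(1)[OF that(2) T_Q] by blast
  then show ?thesis unfolding centraliser_def by (simp add: T_Q)
qed

text \<open>The changes are confined to the centraliser, so that terms of order two and three in
  \<open>e\<close> fall into \<open>Z\<close>. The normal equations accordingly hold only against
  the centraliser, and their second factor keeps the old \<open>u\<close>.\<close>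

lemma twist_family_K:
  "\<exists>e. (\<forall>i. e i \<in> centraliser u) \<and> (\<forall>l<r. \<forall>a\<in>centraliser u.
    (\<Sum>i<r. \<Sum>j<r. B (T (u i - e i) (u j - e j) (u l - e l)) (T (u i) (u j) a)) = 0)"
proof -
  let ?R = "{..<r}"
  obtain F where F: "finite F" "span F = centraliser u" "F \<subseteq> centraliser u"
    using fin_dim_subspace_finite[OF fin centraliser_subspace] by blast
  have F_Q: "a \<in> F \<Longrightarrow> a \<in> Q" for a using F(3) by (auto simp: centraliser_def)
  define w where "w = (\<lambda>(i, j, k, d). B (T (u i) (u j) (u k)) d)"
  define b where "b = (\<lambda>(l, a) (i, j, k, d).
    (if i = l then B (T a (u j) (u k)) d else 0) + (if j = l then B (T (u i) a (u k)) d else 0)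
    + (if k = l then B (T (u i) (u j) a) d else 0))"
  obtain m where m: "\<And>t. t \<in> ?R \<times> F \<Longrightarrow>
     (\<Sum>i\<in>?R\<times>?R\<times>?R\<times>N. (w i - (\<Sum>s\<in>?R\<times>F. m s * b s i)) * b t i) = 0"
    using least_squares[of "?R \<times> F" "?R \<times> ?R \<times> ?R \<times> N" w b] N_fin F(1) by auto
  define e where "e i = (\<Sum>a\<in>F. m (i, a) *\<^sub>R a)" for i
  have e: "e i \<in> centraliser u" for i
    unfolding e_def F(2)[symmetric] by (intro span_sum span_scale span_base)
  then have eQ: "e i \<in> Q" for i by (auto simp: centraliser_def)
  define X where "X i j k = T (u i - e i) (u j - e j) (u k - e k)" for i j k
  have wb: "w (i, j, k, d) - (\<Sum>s\<in>?R\<times>F. m s * b s (i, j, k, d)) = B (X i j k) d"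
    if "i < r" "j < r" "k < r" "d \<in> N" for i j k d
  proof -
    have "(\<Sum>s\<in>?R\<times>F. m s * b s (i, j, k, d)) = (\<Sum>l<r. \<Sum>a\<in>F. m (l, a) * b (l, a) (i, j, k, d))"
      by (simp add: sum.cartesian_product)
    also have "\<dots> = (\<Sum>l<r. (if i = l then \<Sum>a\<in>F. m (l, a) * B (T a (u j) (u k)) d else 0)
       + (if j = l then \<Sum>a\<in>F. m (l, a) * B (T (u i) a (u k)) d else 0)
       + (if k = l then \<Sum>a\<in>F. m (l, a) * B (T (u i) (u j) a) d else 0))"
      by (intro sum.cong refl) (auto simp: b_def sum.distrib distrib_left)
    also have "\<dots> = (\<Sum>a\<in>F. m (i, a) * B (T a (u j) (u k)) d)
        + (\<Sum>a\<in>F. m (j, a) * B (T (u i) a (u k)) d) + (\<Sum>a\<in>F. m (k, a) * B (T (u i) (u j) a) d)"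
      using that by (simp add: sum.distrib)
    also have "\<dots> = B (T (e i) (u j) (u k) + T (u i) (e j) (u k) + T (u i) (u j) (e k)) d"
      by (simp add: e_def T_sum sum_left)
    finally have 1: "(\<Sum>s\<in>?R\<times>F. m s * b s (i, j, k, d)) =
       B (T (e i) (u j) (u k) + T (u i) (e j) (u k) + T (u i) (u j) (e k)) d" .
    have "T (e i) (e j) (u k) \<in> Z" "T (e i) (u j) (e k) \<in> Z" "T (u i) (e j) (e k) \<in> Z"
      "T (e i) (e j) (e k) \<in> Z"
      by (rule centraliser_D(4)[OF e that(3) eQ] centraliser_D(6)[OF e that(2) eQ]
          centraliser_D(1)[OF e that(1) eQ] TQ[OF eQ eQ eQ])+
    then have "B (T (e i) (e j) (u k)) d = 0" "B (T (e i) (u j) (e k)) d = 0"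
      "B (T (u i) (e j) (e k)) d = 0" "B (T (e i) (e j) (e k)) d = 0"
      using B_Z_Q(1) N_Q that by blast+
    then show ?thesis unfolding 1 by (simp add: w_def X_def)
  qed
  have P: "(\<Sum>d\<in>N. B (X i j c) d * B y d) = B (X i j c) y" if "y \<in> Q" for i j c y
    using parseval[OF _ that, of "X i j c"] T_Q unfolding X_def by (simp del: T_simps)
  have X1: "X k j i = - X i j k" "X j k i = X i j k" for i j k
    unfolding X_def by (metis T_cyc T_swap12, metis T_cyc)
  have N0: "(\<Sum>i<r. \<Sum>j<r. B (X i j l) (T (u i) (u j) a)) = 0" if l: "l < r" and a: "a \<in> F" for l a
  proof -
    let ?S = "\<Sum>i<r. \<Sum>j<r. B (X i j l) (T (u i) (u j) a)"
    have "0 = (\<Sum>i<r. \<Sum>j<r. \<Sum>k<r. \<Sum>d\<in>N. B (X i j k) d * b (l, a) (i, j, k, d))"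
      using m[of "(l, a)"] l a wb by (simp add: sum_cartesian4)
    also have "\<dots> = (\<Sum>i<r. \<Sum>j<r. \<Sum>k<r. (if i = l then B (X i j k) (T a (u j) (u k)) else 0)
        + (if j = l then B (X i j k) (T (u i) a (u k)) else 0)
        + (if k = l then B (X i j k) (T (u i) (u j) a) else 0))"
      by (intro sum.cong refl)
        (auto simp: b_def sum.distrib distrib_left P T_Q)
    also have "\<dots> = (\<Sum>j<r. \<Sum>k<r. B (X l j k) (T a (u j) (u k))) +
        (\<Sum>i<r. \<Sum>k<r. B (X i l k) (T (u i) a (u k))) + ?S"
      by (rule sum_delta3[OF l])
    \<comment> \<open>By total antisymmetry all three Kronecker terms equal \<open>?S\<close>, so
      \<open>3 * ?S = 0\<close>.\<close>
    also have "(\<Sum>j<r. \<Sum>k<r. B (X l j k) (T a (u j) (u k))) = ?S"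
      by (intro sum.cong refl) (metis T_cyc X1(2))
    also have "(\<Sum>i<r. \<Sum>k<r. B (X i l k) (T (u i) a (u k))) = ?S"
    proof (intro sum.cong refl)
      fix i k
      have "X i l k = - X i k l" unfolding X_def by (rule T_swap23)
      then show "B (X i l k) (T (u i) a (u k)) = B (X i k l) (T (u i) (u k) a)"
        by (simp add: T_swap23[of "u i" a])
    qed
    finally show ?thesis by simp
  qed
  have N1: "(\<Sum>i<r. \<Sum>j<r. B (X i j l) (T (u i) (u j) a)) = 0"
    if l: "l < r" and a: "a \<in> centraliser u" for l a
  proof -
    have "subspace {a. (\<Sum>i<r. \<Sum>j<r. B (X i j l) (T (u i) (u j) a)) = 0}"
      by (simp add: subspace_def sum.distrib sum_distrib_left[symmetric])
    then show ?thesis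
      using span_minimal[of F "{a. (\<Sum>i<r. \<Sum>j<r. B (X i j l) (T (u i) (u j) a)) = 0}"] N0[OF l] a F(2)
      by blast
  qed
  show ?thesis using e N1 unfolding X_def by blast
qed

lemma centraliser_twist:
  assumes e: "\<And>i. e i \<in> centraliser u"
  shows "centraliser (\<lambda>i. u i - e i) = centraliser u"
proof -
  have "T (u k - e k) x y \<in> Z \<longleftrightarrow> T (u k) x y \<in> Z" if "x \<in> Q" "y \<in> Q" for k x y
  proof -
    have "T (e k) x y \<in> Z" using TQ e that by (auto simp: centraliser_def)
    then show ?thesis using Z_closed(1)[of "T (u k - e k) x y" "T (e k) x y"] Z_closed(2) by auto
  qed
  then show ?thesis unfolding centraliser_def by blast
qed

lemma J_twist:
  assumes e: "\<And>i. e i \<in> centraliser u" and ij: "i < r" "j < r" and x: "x \<in> Q"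
  shows "T (u i - e i) (u j - e j) x - T (u i) (u j) x \<in> Z"
proof -
  have "T (e i) (e j) x \<in> Z" using TQ e x by (auto simp: centraliser_def)
  moreover have "T (e i) (u j) x \<in> Z" "T (u i) (e j) x \<in> Z"
    using centraliser_D[OF e] ij x by blast+
  ultimately have "T (e i) (e j) x - T (e i) (u j) x - T (u i) (e j) x \<in> Z"
    by (intro Z_closed)
  then show ?thesis by (simp add: algebra_simps)
qed

lemma J_central_twist:
  assumes e: "\<And>i. e i \<in> centraliser u" and J: "J_central u"
  shows "J_central (\<lambda>i. u i - e i)"
proof -
  have "T (u i - e i) (u j - e j) x \<in> centraliser u" if "i < r" "j < r" "x \<in> Q" for i j x
  proof -
    have "T (u i - e i) (u j - e j) x - T (u i) (u j) x \<in> centraliser u"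
      using J_twist[of e u, OF e that] by (simp add: centraliser_def Z_Q Z_central Z_closed del: T_simps)
    then show ?thesis
      using subspace_add[OF centraliser_subspace _ J_central_D[OF J that]]
      by (metis diff_add_cancel)
  qed
  then show ?thesis
    unfolding centraliser_twist[of e u, OF e, symmetric]
    by (simp add: J_central_def centraliser_def del: T_simps)
qed

definition JK_central :: "(nat \<Rightarrow> 'v) \<Rightarrow> bool" where
  "JK_central u \<longleftrightarrow>
    (\<forall>i<r. \<forall>j<r. \<forall>k<r. \<forall>l<r. \<forall>m<r. T (u i) (u j) (T (u k) (u l) (u m)) \<in> Z)"

text \<open>The commutator consists of brackets containing \<open>T (u i) (u j) (u k)\<close> or
  \<open>T (u i) (u j) (u l)\<close>, which are central by \<open>K_central\<close>.\<close>

lemma J_commute: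
  assumes J: "J_central u" and ij: "i < r" "j < r" "k < r" "l < r" and x: "x \<in> Q"
  shows "T (u i) (u j) (T (u k) (u l) x) - T (u k) (u l) (T (u i) (u j) x) \<in> Z"
proof -
  have "T (T (u i) (u j) (u k)) (u l) x \<in> Z" "T (u k) (T (u i) (u j) (u l)) x \<in> Z"
    by (rule centraliser_D(3)[OF K_central[OF J ij(1-3)] ij(4) x]
        centraliser_D(1)[OF K_central[OF J ij(1,2,4)] ij(3) x])+
  then show ?thesis
    unfolding FI[of "u i" "u j" "u k" "u l" x] by (simp add: Z_closed)
qed

text \<open>The fundamental identity rewrites \<open>?J i j (?K k l m)\<close> by terms
  \<open>?J a b (?K i j n)\<close>, where \<open>?K\<close> carries the summation indices
  \<open>i\<close>, \<open>j\<close>. Skewness and commutation of the \<open>?J\<close> then bring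
  the squared norm to products of \<open>?K i j n\<close> with \<open>?J i j a\<close>,
  \<open>a\<close> in the centraliser, which are the normal equations.\<close>

lemma twisted_JK_central:
  assumes J: "J_central u"
    and ort: "\<And>l a. l < r \<Longrightarrow> a \<in> centraliser u \<Longrightarrow>
      (\<Sum>i<r. \<Sum>j<r. B (T (u i) (u j) (u l)) (T (u i) (u j) a)) = 0"
  shows "JK_central u"
proof -
  let ?J = "\<lambda>i j. T (u i) (u j)" and ?K = "\<lambda>i j k. T (u i) (u j) (u k)"
  have swap: "B (?J i j (?K k l m)) (?J a b (?K i j n)) = - B (?K i j n) (?J i j (?J a b (?K k l m)))"
    if "i < r" "j < r" "k < r" "l < r" "m < r" "a < r" "b < r" "n < r" for i j k l m a b n
  proof -
    have "B (?J i j (?K k l m)) (?J a b (?K i j n)) = - B (?J a b (?J i j (?K k l m))) (?K i j n)"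
      by (simp add: metric)
    also have "\<dots> = - B (?J i j (?J a b (?K k l m))) (?K i j n)"
      using B_cong_Z(1)[OF J_commute[OF J, of a b i j, OF _ _ _ _ T_Q] T_Q] that by simp
    finally show ?thesis by (simp add: sym)
  qed
  have z: "(\<Sum>i<r. \<Sum>j<r. B (?J i j (?K k l m)) (?J a b (?K i j n))) = 0"
    if "k < r" "l < r" "m < r" "a < r" "b < r" "n < r" for k l m a b n
  proof -
    have "(\<Sum>i<r. \<Sum>j<r. B (?J i j (?K k l m)) (?J a b (?K i j n))) =
       - (\<Sum>i<r. \<Sum>j<r. B (?K i j n) (?J i j (?J a b (?K k l m))))"
      using that by (simp add: swap sum_negf)
    also have "\<dots> = 0" using ort[OF that(6) J_central_D[OF J that(4,5) T_Q]] by simp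
    finally show ?thesis .
  qed
  have "?J i j (?K k l m) \<in> Z" if klm: "k < r" "l < r" "m < r" and ij: "i < r" "j < r" for i j k l m
  proof -
    have "?J i j (?K k l m) = ?J l m (?K i j k) + ?J m k (?K i j l) + ?J k l (?K i j m)" for i j
      unfolding FI[of "u i" "u j"] by (simp add: T_cyc[of "?K i j k"] T_cyc[of "u m" "u k"])
    then have "B (?J i j (?K k l m)) (?J i j (?K k l m)) = B (?J i j (?K k l m)) (?J l m (?K i j k))
      + B (?J i j (?K k l m)) (?J m k (?K i j l)) + B (?J i j (?K k l m)) (?J k l (?K i j m))" for i j
      by (metis form_simps(2))
    then have "(\<Sum>i<r. \<Sum>j<r. B (?J i j (?K k l m)) (?J i j (?K k l m))) = 0"
      using klm by (simp add: sum.distrib z)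
    then show ?thesis
      using ij by (simp add: sum_nonneg_eq_0_iff sum_nonneg Q_nonneg T_Q Z_iff_norm)
  qed
  then show ?thesis unfolding JK_central_def by blast
qed

lemma twisted_dual_frame:
  assumes f: "dual_frame u v" and e: "\<And>i. e i \<in> Q"
  shows "dual_frame (\<lambda>i. u i - e i) v"
proof -
  have "B (e i) (v j) = 0" if "j < r" for i j
    using B_Z_Q(2)[OF dual_frame_v[OF f that] e] .
  then show ?thesis using f by (simp add: dual_frame_def)
qed

lemma J_central_cong:
  assumes "\<And>i. u' i - u i \<in> Z"
  shows "J_central u' \<longleftrightarrow> J_central u" "JK_central u' \<longleftrightarrow> JK_central u"
proof -
  have "T (u' i) = T (u i)" "T x (u' i) = T x (u i)" "T x y (u' i) = T x y (u i)" for i x y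
    using Z_central[OF assms(1)[of i]] by (auto intro!: ext)
  then show "J_central u' \<longleftrightarrow> J_central u" "JK_central u' \<longleftrightarrow> JK_central u"
    by (simp_all add: J_central_def JK_central_def)
qed

lemma ex_normal_frame:
  "\<exists>u v. dual_frame u v \<and> isotropic_frame u \<and> J_central u \<and> JK_central u"
proof -
  obtain u0 v where 0: "dual_frame u0 v" using ex_dual_frame by blast
  obtain e where e: "\<And>i. e i \<in> Q" "\<And>l a. l < r \<Longrightarrow> a \<in> Q \<Longrightarrow>
    (\<Sum>i<r. \<Sum>c\<in>N. B (T (u0 i - e i) (u0 l - e l) c) (T (u0 i - e i) a c)) = 0"
    using twist_family[of u0] by blast
  define u1 where "u1 i = u0 i - e i" for i
  have u1: "dual_frame u1 v" "J_central u1"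
    using twisted_dual_frame[OF 0 e(1)] twisted_J_central[of u1] e(2) unfolding u1_def by auto
  obtain f where f: "\<And>i. f i \<in> centraliser u1" "\<And>l a. l < r \<Longrightarrow> a \<in> centraliser u1 \<Longrightarrow>
    (\<Sum>i<r. \<Sum>j<r. B (T (u1 i - f i) (u1 j - f j) (u1 l - f l)) (T (u1 i) (u1 j) a)) = 0"
    using twist_family_K[of u1] by blast
  define u2 where "u2 i = u1 i - f i" for i
  have C: "centraliser u2 = centraliser u1"
    unfolding u2_def by (rule centraliser_twist[OF f(1)])
  have fQ: "f i \<in> Q" for i using f(1) by (auto simp: centraliser_def)
  have u2: "dual_frame u2 v" "J_central u2"
    using twisted_dual_frame[OF u1(1) fQ] J_central_twist[OF f(1) u1(2)] unfolding u2_def by auto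
  have "JK_central u2"
  proof (rule twisted_JK_central[OF u2(2)])
    fix l a assume l: "l < r" and a: "a \<in> centraliser u2"
    have "a \<in> Q" using a by (simp add: centraliser_def)
    \<comment> \<open>The normal equations pair with the operators of the old frame
      \<open>u1\<close>; on \<open>Q\<close> those agree with the new ones modulo
      \<open>Z\<close>.\<close>
    then have "B q (T (u2 i) (u2 j) a) = B q (T (u1 i) (u1 j) a)"
      if "i < r" "j < r" "q \<in> Q" for i j q
      using B_cong_Z(2)[OF J_twist[of f u1, OF f(1) that(1,2)] that(3)] unfolding u2_def by blast
    then have "(\<Sum>i<r. \<Sum>j<r. B (T (u2 i) (u2 j) (u2 l)) (T (u2 i) (u2 j) a)) =
      (\<Sum>i<r. \<Sum>j<r. B (T (u2 i) (u2 j) (u2 l)) (T (u1 i) (u1 j) a))"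
      by (simp add: T_Q)
    also have "\<dots> = 0" using f(2)[OF l, of a] a C unfolding u2_def by simp
    finally show "(\<Sum>i<r. \<Sum>j<r. B (T (u2 i) (u2 j) (u2 l)) (T (u2 i) (u2 j) a)) = 0" .
  qed
  \<comment> \<open>Isotropy is arranged last, by changes in \<open>Z\<close>, which alter no
    bracket.\<close>
  moreover obtain u3 where "dual_frame u3 v" "isotropic_frame u3" "\<And>i. u3 i - u2 i \<in> Z"
    using dual_frame_isotropic[OF u2(1)] by blast
  ultimately show ?thesis using u2 J_central_cong[of u3 u2] by blast
qed

end

section \<open>Orthogonal decomposition under skew operators\<close>

definition op_invariant :: "('v::real_vector \<Rightarrow> 'v) set \<Rightarrow> 'v set \<Rightarrow> bool" where
  "op_invariant G U \<longleftrightarrow> subspace U \<and> (\<forall>g\<in>G. \<forall>x\<in>U. g x \<in> U)"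

definition op_irreducible :: "('v::real_vector \<Rightarrow> 'v) set \<Rightarrow> 'v set \<Rightarrow> bool" where
  "op_irreducible G U \<longleftrightarrow> op_invariant G U \<and> U \<noteq> {0} \<and>
     (\<forall>U'. op_invariant G U' \<and> U' \<subseteq> U \<longrightarrow> U' = {0} \<or> U' = U)"

text \<open>An induction principle for irreducible subspaces, applied below to properties that are
  easy to check on one nonzero vector, typically a value of a bracket.\<close>

lemma op_irreducible_all:
  assumes "op_irreducible G U" and "subspace {x \<in> U. P x}"
    and "\<And>g x. g \<in> G \<Longrightarrow> x \<in> U \<Longrightarrow> P x \<Longrightarrow> P (g x)"
    and "x0 \<in> U" "x0 \<noteq> 0" "P x0" and "x \<in> U"
  shows "P x"
proof -
  have "op_invariant G {x \<in> U. P x}"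
    using assms(1-3) unfolding op_irreducible_def op_invariant_def by blast
  then have "{x \<in> U. P x} = {0} \<or> {x \<in> U. P x} = U"
    using assms(1) unfolding op_irreducible_def by blast
  then show ?thesis using assms(4-7) by blast
qed

context sym_form
begin

text \<open>Skewness makes the orthogonal complement of an invariant subspace invariant, so
  induction on the dimension splits \<open>W\<close>. Subspaces on which every operator vanishes
  stay in the common kernel instead of being cut into lines.\<close>

lemma skew_decomposition:
  assumes fin: "fin_dim_space TYPE('v)" and W: "op_invariant G W"
    and pos: "\<And>x. x \<in> W \<Longrightarrow> x \<noteq> 0 \<Longrightarrow> B x x > 0"
    and skew: "\<And>g x y. g \<in> G \<Longrightarrow> x \<in> W \<Longrightarrow> y \<in> W \<Longrightarrow> B (g x) y = - B x (g y)"
  shows "\<exists>I. finite I \<and> (\<forall>U\<in>I. U \<subseteq> W \<and> op_irreducible G U \<and> (\<exists>g\<in>G. \<exists>x\<in>U. g x \<noteq> 0)) \<and>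
     (\<forall>U\<in>I. \<forall>V\<in>I. U \<noteq> V \<longrightarrow> (\<forall>x\<in>U. \<forall>y\<in>V. B x y = 0)) \<and>
     W \<subseteq> span (\<Union>I \<union> {x \<in> W. \<forall>g\<in>G. g x = 0})" (is "?D W")
  using W pos skew
proof (induction "dim W" arbitrary: W rule: less_induct)
  case less
  note W = less.prems(1) and pos = less.prems(2) and skew = less.prems(3)
  have sW: "subspace W" using W by (simp add: op_invariant_def)
  \<comment> \<open>The maps in \<open>G\<close> need not be linear; skewness makes
    \<open>g 0\<close> a null vector, and positivity does the rest.\<close>
  have "g 0 = 0" if "g \<in> G" for g
  proof (rule ccontr)
    assume "g 0 \<noteq> 0"
    moreover have "g 0 \<in> W" using W that subspace_0[OF sW] by (simp add: op_invariant_def)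
    ultimately show False using pos skew[OF that subspace_0[OF sW], of "g 0"] by force
  qed
  then have triv: "W = {0} \<Longrightarrow> \<forall>g\<in>G. \<forall>x\<in>W. g x = 0" by simp
  consider "\<forall>g\<in>G. \<forall>x\<in>W. g x = 0" | "op_irreducible G W" "\<exists>g\<in>G. \<exists>x\<in>W. g x \<noteq> 0"
    | U where "\<exists>g\<in>G. \<exists>x\<in>W. g x \<noteq> 0" "op_invariant G U" "U \<subseteq> W" "U \<noteq> {0}" "U \<noteq> W"
    using W triv unfolding op_irreducible_def by blast
  then show ?case
  proof cases
    case 1
    then show ?thesis by (intro exI[of _ "{}"]) (auto intro: span_base)
  next
    case 2
    then show ?thesis by (intro exI[of _ "{W}"]) (auto intro: span_base)
  next
    case U: 3
    define V where "V = {x \<in> W. \<forall>a\<in>U. B a x = 0}"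
    have sU: "subspace U" using U(2) by (simp add: op_invariant_def)
    have sV: "subspace V"
      using sW unfolding V_def subspace_def by auto
    have V: "op_invariant G V"
      unfolding op_invariant_def
    proof (intro conjI ballI sV)
      fix g x assume g: "g \<in> G" and x: "x \<in> V"
      have "B a (g x) = 0" if a: "a \<in> U" for a
      proof -
        have "g a \<in> U" using U(2) g a by (simp add: op_invariant_def)
        moreover have "B (g a) x = - B a (g x)" using skew[OF g] a x U(3) by (auto simp: V_def)
        ultimately show ?thesis using x by (simp add: V_def)
      qed
      moreover have "g x \<in> W" using W g x by (simp add: op_invariant_def V_def)
      ultimately show "g x \<in> V" by (simp add: V_def)
    qed
    obtain a where a: "a \<in> U" "a \<noteq> 0" using U(4) subspace_0[OF sU] by blast
    then have "a \<notin> V" using pos U(3) by (force simp: V_def)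
    then have VW: "V \<subset> W" using a(1) U(3) by (auto simp: V_def)
    have UW: "U \<subset> W" using U(3,5) by blast
    have DU: "?D U"
      by (rule less.hyps[OF fin_dim_psubset[OF fin sU sW UW] U(2)])
        (use pos skew U(3) in blast)+
    have DV: "?D V"
      by (rule less.hyps[OF fin_dim_psubset[OF fin sV sW VW] V])
        (use pos skew VW in blast)+
    obtain I1 where I1: "finite I1" "\<forall>X\<in>I1. X \<subseteq> U \<and> op_irreducible G X \<and> (\<exists>g\<in>G. \<exists>x\<in>X. g x \<noteq> 0)"
      "\<forall>X\<in>I1. \<forall>Y\<in>I1. X \<noteq> Y \<longrightarrow> (\<forall>x\<in>X. \<forall>y\<in>Y. B x y = 0)"
      "U \<subseteq> span (\<Union>I1 \<union> {x \<in> U. \<forall>g\<in>G. g x = 0})"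
      using DU by (elim exE conjE) (rule that, assumption+)
    obtain I2 where I2: "finite I2" "\<forall>X\<in>I2. X \<subseteq> V \<and> op_irreducible G X \<and> (\<exists>g\<in>G. \<exists>x\<in>X. g x \<noteq> 0)"
      "\<forall>X\<in>I2. \<forall>Y\<in>I2. X \<noteq> Y \<longrightarrow> (\<forall>x\<in>X. \<forall>y\<in>Y. B x y = 0)"
      "V \<subseteq> span (\<Union>I2 \<union> {x \<in> V. \<forall>g\<in>G. g x = 0})"
      using DV by (elim exE conjE) (rule that, assumption+)
    have I1sub: "X \<subseteq> U" if "X \<in> I1" for X using bspec[OF I1(2) that] by simp
    have I2sub: "X \<subseteq> V" if "X \<in> I2" for X using bspec[OF I2(2) that] by simp
    let ?S = "\<Union>(I1 \<union> I2) \<union> {x \<in> W. \<forall>g\<in>G. g x = 0}"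
    have UV: "B x y = 0" "B y x = 0" if "x \<in> U" "y \<in> V" for x y
      using that sym unfolding V_def by auto
    have orth: "\<forall>X\<in>I1 \<union> I2. \<forall>Y\<in>I1 \<union> I2. X \<noteq> Y \<longrightarrow> (\<forall>x\<in>X. \<forall>y\<in>Y. B x y = 0)"
    proof (intro ballI impI)
      fix X Y x y
      assume "X \<in> I1 \<union> I2" "Y \<in> I1 \<union> I2" "X \<noteq> Y" "x \<in> X" "y \<in> Y"
      then consider "X \<in> I1" "Y \<in> I1" | "X \<in> I2" "Y \<in> I2" | "x \<in> U" "y \<in> V" | "x \<in> V" "y \<in> U"
        using I1sub I2sub by blast
      then show "B x y = 0"
      proof cases
        case 1
        then show ?thesis using I1(3) \<open>X \<noteq> Y\<close> \<open>x \<in> X\<close> \<open>y \<in> Y\<close> by blast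
      next
        case 2
        then show ?thesis using I2(3) \<open>X \<noteq> Y\<close> \<open>x \<in> X\<close> \<open>y \<in> Y\<close> by blast
      qed (simp_all add: UV)
    qed
    have "span (\<Union>I1 \<union> {x \<in> U. \<forall>g\<in>G. g x = 0}) \<subseteq> span ?S"
      using U(3) by (intro span_mono) blast
    then have 1: "U \<subseteq> span ?S" using I1(4) by blast
    have "span (\<Union>I2 \<union> {x \<in> V. \<forall>g\<in>G. g x = 0}) \<subseteq> span ?S"
      using VW by (intro span_mono) blast
    then have 2: "V \<subseteq> span ?S" using I2(4) by blast
    have "x \<in> span ?S" if x: "x \<in> W" for x
    proof -
      obtain a where a: "a \<in> U" "\<And>b. b \<in> U \<Longrightarrow> B b (x - a) = 0"
        using orthogonal_split[OF fin sU] pos U(3) by (metis subsetD)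
      have "x - a \<in> V" using a x U(3) subspace_diff[OF sW] by (auto simp: V_def)
      then have "(x - a) + a \<in> span ?S" using 1 2 a(1) by (intro span_add) blast+
      then show ?thesis by simp
    qed
    then have "W \<subseteq> span ?S" by blast
    moreover have "X \<subseteq> W \<and> op_irreducible G X \<and> (\<exists>g\<in>G. \<exists>x\<in>X. g x \<noteq> 0)" if "X \<in> I1 \<union> I2" for X
    proof -
      have "X \<subseteq> W" using that I1sub I2sub U(3) VW by blast
      then show ?thesis using that bspec[OF I1(2), of X] bspec[OF I2(2), of X] by auto
    qed
    ultimately show ?thesis using I1(1) I2(1) orth by (intro exI[of _ "I1 \<union> I2"]) simp
  qed
qed

text \<open>Symmetry provides a real eigenvalue, and its eigenspace is invariant; the commutant of a
  real irreducible family may otherwise be larger than the reals.\<close>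

lemma schur_symmetric:
  assumes fin: "fin_dim_space TYPE('v)" and U: "op_irreducible G U"
    and pos: "\<And>x. x \<in> U \<Longrightarrow> x \<noteq> 0 \<Longrightarrow> B x x > 0"
    and G: "\<And>g x a. g \<in> G \<Longrightarrow> g (a *\<^sub>R x) = a *\<^sub>R g x"
    and f: "linear f" "\<And>x. x \<in> U \<Longrightarrow> f x \<in> U"
    and fsym: "\<And>x y. x \<in> U \<Longrightarrow> y \<in> U \<Longrightarrow> B (f x) y = B x (f y)"
    and com: "\<And>g x. g \<in> G \<Longrightarrow> x \<in> U \<Longrightarrow> f (g x) = g (f x)"
  shows "\<exists>l. \<forall>x\<in>U. f x = l *\<^sub>R x"
proof -
  have sU: "subspace U" using U by (simp add: op_irreducible_def op_invariant_def)
  obtain F where F: "finite F" "span F = U"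
    using fin_dim_subspace_finite[OF fin sU] by blast
  obtain x0 where x0: "x0 \<in> U" "x0 \<noteq> 0"
    using U subspace_0[OF sU] unfolding op_irreducible_def by blast
  obtain l x where x: "x \<in> U" "x \<noteq> 0" "f x = l *\<^sub>R x"
    using symmetric_eigenvector[of F x0 f] F pos x0 f fsym by auto
  have "f y = l *\<^sub>R y" if "y \<in> U" for y
  proof (rule op_irreducible_all[OF U, of "\<lambda>y. f y = l *\<^sub>R y", OF _ _ x that])
    show "subspace {x \<in> U. f x = l *\<^sub>R x}"
      using sU f(1) unfolding subspace_def
      by (auto simp: linear_0 linear_add linear_scale scaleR_add_right mult.commute)
  qed (simp add: com G)
  then show ?thesis by blast
qed

end

section \<open>Classification of the irreducible pieces\<close>

locale normal_frame = normalisable B T r Z N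
  for B :: "'v::real_vector \<Rightarrow> 'v \<Rightarrow> real" and T r Z N +
  fixes u v :: "nat \<Rightarrow> 'v"
  assumes dual: "dual_frame u v" and iso: "isotropic_frame u"
    and Jc: "J_central u" and JKc: "JK_central u"
begin

section \<open>A Euclidean model of \<open>Q\<close> modulo \<open>Z\<close> and the components of
  the bracket\<close>

definition W :: "'v set" where "W = frame_compl u v"
definition pr :: "'v \<Rightarrow> 'v" where "pr = frame_proj u v"
definition br :: "nat \<Rightarrow> 'v \<Rightarrow> 'v \<Rightarrow> 'v" where "br i x y = pr (T (u i) x y)"
definition J :: "nat \<Rightarrow> nat \<Rightarrow> 'v \<Rightarrow> 'v" where "J i j x = pr (T (u i) (u j) x)"

lemma W_subspace: "subspace W" unfolding W_def by (rule frame_compl_subspace)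
lemmas W_closed = subspace_add[OF W_subspace] subspace_diff[OF W_subspace]
  subspace_scale[OF W_subspace] subspace_neg[OF W_subspace] subspace_0[OF W_subspace]
  subspace_sum[OF W_subspace]
lemma W_Q: "x \<in> W \<Longrightarrow> x \<in> Q" unfolding W_def by (rule frame_compl_Q[OF dual iso])
lemma W_pos: "x \<in> W \<Longrightarrow> x \<noteq> 0 \<Longrightarrow> B x x > 0"
  unfolding W_def by (rule frame_compl_pos[OF dual iso])
lemma W_zero: "x \<in> W \<Longrightarrow> B x x = 0 \<Longrightarrow> x = 0" using W_pos by force
lemma pr_W: "pr x \<in> W" unfolding W_def pr_def by (rule frame_proj_compl[OF dual iso])
lemma pr_Z: "x \<in> Q \<Longrightarrow> x - pr x \<in> Z" unfolding pr_def by (rule frame_proj_diff[OF dual iso])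
lemma pr_eq: "x \<in> Q \<Longrightarrow> x = pr x + (\<Sum>i<r. B (u i) x *\<^sub>R v i)"
  unfolding pr_def by (simp add: frame_proj_Q[OF dual iso])
lemma W_perp: "x \<in> W \<Longrightarrow> i < r \<Longrightarrow> B (u i) x = 0" "x \<in> W \<Longrightarrow> i < r \<Longrightarrow> B (v i) x = 0"
  unfolding W_def frame_compl_def by auto

lemma pr_linear: "linear pr"
  unfolding pr_def frame_proj_def
  by (rule linearI) (simp_all add: scaleR_add_left sum.distrib scaleR_diff_right scaleR_sum_right)

lemmas pr_simps = linear_add[OF pr_linear] linear_diff[OF pr_linear] linear_neg[OF pr_linear]
  linear_scale[OF pr_linear] linear_0[OF pr_linear]

lemma pr_B: "x \<in> Q \<Longrightarrow> y \<in> Q \<Longrightarrow> B (pr x) y = B x y" "x \<in> Q \<Longrightarrow> y \<in> Q \<Longrightarrow> B y (pr x) = B y x"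
  using B_cong_Z[OF pr_Z] by metis+

lemma pr_zero: "z \<in> Z \<Longrightarrow> pr z = 0"
  by (rule W_zero[OF pr_W]) (simp add: pr_B Z_Q W_Q[OF pr_W] B_Z_Q)

lemma pr_cong: "x - y \<in> Z \<Longrightarrow> pr x = pr y"
  using pr_zero[of "x - y"] by (simp add: pr_simps)

lemma pr_T: "x \<in> Q \<Longrightarrow> T p q (pr x) = T p q x"
  using Z_central3[OF pr_Z, of x p q] by simp

lemma pr_T2: "x \<in> Q \<Longrightarrow> T p (pr x) q = T p x q"
  using Z_central2[OF pr_Z, of x p q] by simp

lemma Z_expansion: "z \<in> Z \<Longrightarrow> z = (\<Sum>i<r. B (u i) z *\<^sub>R v i)"
  using pr_eq[OF Z_Q] pr_zero by simp

lemma br_W: "br i x y \<in> W" and J_W: "J i j x \<in> W"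
  unfolding br_def J_def by (rule pr_W)+

lemma br_simps:
  "br i (x + y) z = br i x z + br i y z" "br i z (x + y) = br i z x + br i z y"
  "br i (a *\<^sub>R x) z = a *\<^sub>R br i x z" "br i z (a *\<^sub>R x) = a *\<^sub>R br i z x"
  "br i 0 z = 0" "br i z 0 = 0" "br i (- x) z = - br i x z" "br i z (- x) = - br i z x"
  unfolding br_def by (simp_all add: pr_simps)

lemma J_simps: "J i j (x + y) = J i j x + J i j y" "J i j (a *\<^sub>R x) = a *\<^sub>R J i j x" "J i j 0 = 0"
    "J i j (- x) = - J i j x"
  unfolding J_def by (simp_all add: pr_simps)

lemma br_swap: "br i x y = - br i y x"
  unfolding br_def by (subst T_swap23) (simp add: pr_simps)

lemma J_swap: "J i j x = - J j i x"
  unfolding J_def by (subst T_swap12) (simp add: pr_simps)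

lemma br_skew: "y \<in> W \<Longrightarrow> z \<in> W \<Longrightarrow> B (br i x y) z = - B y (br i x z)"
  unfolding br_def by (simp add: pr_B T_Q W_Q metric)

lemma br_inv: "x \<in> W \<Longrightarrow> y \<in> W \<Longrightarrow> z \<in> W \<Longrightarrow> B (br i x y) z = B x (br i y z)"
  using br_skew[of x z i y] br_swap[of i x y] by simp

lemma J_skew: "y \<in> W \<Longrightarrow> z \<in> W \<Longrightarrow> B (J i j y) z = - B y (J i j z)"
  unfolding J_def by (simp add: pr_B T_Q W_Q metric)

lemma br_derivation:
  assumes "x \<in> W" "y \<in> W" "z \<in> W"
  shows "br i x (br j y z) = br j (br i x y) z + br j y (br i x z)"
proof -
  have "pr (T (u i) x (T (u j) y z)) = pr (T (u j) (T (u i) x y) z + T (u j) y (T (u i) x z))"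
    using bracket_derivation[of x y z "u i" "u j"] assms W_Q
    by (intro pr_cong) (simp add: algebra_simps)
  then show ?thesis unfolding br_def by (simp add: pr_T pr_T2 T_Q pr_simps)
qed

lemma br_exchange:
  assumes "x \<in> W" "y \<in> W" "z \<in> W"
  shows "br j (br i x y) z = br i (br j x y) z"
  using pr_cong[OF bracket_exchange[of x y z "u j" "u i"]] assms W_Q
  unfolding br_def by (simp add: pr_T2 T_Q)

lemma br_J: "i < r \<Longrightarrow> j < r \<Longrightarrow> k < r \<Longrightarrow> x \<in> W \<Longrightarrow> y \<in> W \<Longrightarrow> br k (J i j x) y = 0"
  using Jc W_Q pr_zero unfolding br_def J_def J_central_def by (simp add: pr_T2 T_Q)

lemma J_comm:
  assumes "i < r" "j < r" "k < r" "l < r" "x \<in> W"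
  shows "J i j (J k l x) = J k l (J i j x)"
  using pr_cong[OF J_commute[OF Jc assms(1-4) W_Q[OF assms(5)]]]
  unfolding J_def by (simp add: pr_T T_Q)

text \<open>The adjoint statement to \<open>br_J\<close>: brackets vanish on values of the
  \<open>J\<close>, so by invariance of the form the \<open>J\<close> vanish on values of
  brackets.\<close>

lemma J_br:
  assumes "i < r" "j < r" "k < r" "x \<in> W" "y \<in> W"
  shows "J i j (br k x y) = 0"
proof (rule W_zero[OF J_W])
  let ?w = "J i j (br k x y)"
  have "B ?w ?w = - B (br k x y) (J i j ?w)" by (rule J_skew) (simp_all add: br_W J_W)
  also have "\<dots> = B y (br k x (J i j ?w))" using assms by (simp add: br_skew J_W)
  also have "\<dots> = 0" using br_J[OF assms(1-3) J_W assms(4)] by (subst br_swap) (simp add: assms)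
  finally show "B ?w ?w = 0" .
qed

text \<open>The vectors \<open>T (u j) (u k) (u l)\<close> are central, and the fundamental identity
  for \<open>T (u i) x\<close> turns this into a quadratic relation among the \<open>J\<close>.
  Where the \<open>J i j\<close> are multiples of one rotation it is the Pluecker relation.\<close>

lemma J_pluecker:
  assumes "i < r" "j < r" "k < r" "l < r" "x \<in> W"
  shows "J k l (J i j x) + J l j (J i k x) + J j k (J i l x) = 0"
proof -
  have "T (u i) x (T (u j) (u k) (u l)) \<in> Z"
    using centraliser_D(2)[OF K_central[OF Jc]] assms W_Q by blast
  moreover have "T (u i) x (T (u j) (u k) (u l)) =
      - (T (u k) (u l) (T (u i) (u j) x) + T (u l) (u j) (T (u i) (u k) x) + T (u j) (u k) (T (u i) (u l) x))"
    unfolding FI[of "u i" x "u j" "u k" "u l"]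
    by (simp add: T_swap23[of "u i" x] T_cyc[of "T _ _ _" "u k" "u l"] T_cyc[of "u l" "u j" "T _ _ _"])
  ultimately have "T (u k) (u l) (T (u i) (u j) x) + T (u l) (u j) (T (u i) (u k) x)
      + T (u j) (u k) (T (u i) (u l) x) \<in> Z"
    by (simp only: Z_neg_iff)
  from pr_zero[OF this] show ?thesis
    unfolding J_def by (simp add: pr_simps pr_T T_Q)
qed

text \<open>The coefficient of \<open>v i\<close> in an element of \<open>Z\<close> is its product
  with \<open>u i\<close>, which metricity expresses by \<open>br\<close>. The next two lemmas treat
  brackets with frame vectors in the same way.\<close>

lemma T_WWW:
  assumes "x \<in> W" "y \<in> W" "z \<in> W"
  shows "T x y z = - (\<Sum>i<r. B (br i x y) z *\<^sub>R v i)"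
proof -
  have "B (u i) (T x y z) = - B (br i x y) z" for i
    using metric[of x y "u i" z] assms by (simp add: br_def pr_B T_Q W_Q T_cyc[of "u i"])
  then show ?thesis
    using Z_expansion[OF TQ[OF assms[THEN W_Q]]] by (simp add: sum_negf)
qed

lemma T_uWW:
  assumes "x \<in> W" "y \<in> W"
  shows "T (u i) x y = br i x y - (\<Sum>j<r. B x (J i j y) *\<^sub>R v j)"
proof -
  have "B (u j) (T (u i) x y) = - B x (J i j y)" for j
  proof -
    have "B (u j) (T (u i) x y) = - B (T (u i) x (u j)) y" by (simp add: metric[of "u i" x "u j" y])
    also have "\<dots> = B (T (u i) (u j) x) y" by (simp add: T_swap23[of "u i" x "u j"])
    also have "\<dots> = - B x (J i j y)"
      using metric[of "u i" "u j" x y] assms by (simp add: J_def pr_B T_Q W_Q)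
    finally show ?thesis .
  qed
  then show ?thesis
    using pr_eq[OF T_Q, of "u i" x y] by (simp add: br_def sum_negf)
qed

lemma T_uuW:
  assumes "x \<in> W"
  shows "T (u i) (u j) x = J i j x - (\<Sum>k<r. B (pr (T (u i) (u j) (u k))) x *\<^sub>R v k)"
proof -
  have "B (u k) (T (u i) (u j) x) = - B (pr (T (u i) (u j) (u k))) x" for k
    using metric[of "u i" "u j" "u k" x] assms by (simp add: pr_B T_Q W_Q)
  then show ?thesis
    using pr_eq[OF T_Q, of "u i" "u j" x] by (simp add: J_def sum_negf)
qed

text \<open>Both kinds of operators are put into one family, so that a subspace \<open>U\<close> of
  \<open>W\<close> is invariant exactly when \<open>U + Z\<close> is an ideal.\<close>

definition G :: "('v \<Rightarrow> 'v) set" where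
  "G = {br i x | i x. i < r \<and> x \<in> W} \<union> {J i j | i j. i < r \<and> j < r}"

lemma G_scale: "g \<in> G \<Longrightarrow> g (a *\<^sub>R x) = a *\<^sub>R g x"
  unfolding G_def by (auto simp: br_simps J_simps)

lemma G_skew: "g \<in> G \<Longrightarrow> x \<in> W \<Longrightarrow> y \<in> W \<Longrightarrow> B (g x) y = - B x (g y)"
  unfolding G_def using br_skew J_skew by blast

lemma G_W: "op_invariant G W"
  unfolding op_invariant_def G_def using W_subspace br_W J_W by auto

lemma invariantD:
  assumes "op_invariant G U" "i < r" "y \<in> U"
  shows "x \<in> W \<Longrightarrow> br i x y \<in> U" "x \<in> W \<Longrightarrow> br i y x \<in> U" "j < r \<Longrightarrow> J i j y \<in> U"
proof -
  have sU: "subspace U" and g: "\<And>g. g \<in> G \<Longrightarrow> g y \<in> U" using assms by (auto simp: op_invariant_def)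
  show 1: "x \<in> W \<Longrightarrow> br i x y \<in> U" and "j < r \<Longrightarrow> J i j y \<in> U"
    by (rule g, use assms(2) in \<open>unfold G_def, blast\<close>)+
  show "x \<in> W \<Longrightarrow> br i y x \<in> U"
    unfolding br_swap[of i y x] using subspace_neg[OF sU] 1 by blast
qed

text \<open>The value lies in both subspaces and is therefore orthogonal to itself.\<close>

lemma br_orthogonal:
  assumes U: "op_invariant G U" "U \<subseteq> W" and V: "op_invariant G V" "V \<subseteq> W"
    and o: "\<And>x y. x \<in> U \<Longrightarrow> y \<in> V \<Longrightarrow> B x y = 0"
    and "x \<in> U" "y \<in> V" "i < r"
  shows "br i x y = 0"
proof (rule W_zero[OF br_W])
  have "br i x y \<in> U" "br i x y \<in> V"
    using invariantD(1)[OF V(1)] invariantD(2)[OF U(1)] assms by blast+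
  then show "B (br i x y) (br i x y) = 0" by (rule o)
qed

context
  fixes U assumes U: "op_irreducible G U" "U \<subseteq> W"
begin

lemma U_invariant: "op_invariant G U" and U_subspace: "subspace U"
  using U(1) by (simp_all add: op_irreducible_def op_invariant_def)

lemma irreducible_all:
  assumes "subspace {x \<in> U. P x}"
    and "\<And>i x y. i < r \<Longrightarrow> y \<in> W \<Longrightarrow> x \<in> U \<Longrightarrow> P x \<Longrightarrow> P (br i y x)"
    and "\<And>i j x. i < r \<Longrightarrow> j < r \<Longrightarrow> x \<in> U \<Longrightarrow> P x \<Longrightarrow> P (J i j x)"
    and "x0 \<in> U" "x0 \<noteq> 0" "P x0" and "x \<in> U"
  shows "P x"
  by (rule op_irreducible_all[OF U(1) assms(1) _ assms(4-7)]) (use assms(2,3) in \<open>auto simp: G_def\<close>)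

text \<open>The part of \<open>y\<close> orthogonal to \<open>U\<close> lies in an invariant
  subspace, so \<open>br_orthogonal\<close> removes it.\<close>

lemma br_split:
  assumes "y \<in> W"
  obtains y' where "y' \<in> U" "\<And>i z. i < r \<Longrightarrow> z \<in> U \<Longrightarrow> br i y z = br i y' z"
proof -
  obtain y' where y': "y' \<in> U" "\<And>b. b \<in> U \<Longrightarrow> B b (y - y') = 0"
    using orthogonal_split[OF fin U_subspace] W_pos U(2) by (metis subsetD)
  define V where "V = {x \<in> W. \<forall>b\<in>U. B b x = 0}"
  have sV: "subspace V" using W_subspace unfolding V_def subspace_def by auto
  have V: "op_invariant G V"
    using sV unfolding op_invariant_def V_def
  proof safe
    fix g x b assume g: "g \<in> G" and x: "x \<in> W" "\<forall>b\<in>U. B b x = 0" and b: "b \<in> U"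
    have "g b \<in> U" using U_invariant g b by (auto simp: op_invariant_def)
    then show "B b (g x) = 0" using G_skew[OF g, of b x] b x U(2) by auto
  qed (use G_W in \<open>auto simp: op_invariant_def\<close>)
  have mem: "y - y' \<in> V" using y' assms U(2) by (auto simp: V_def W_closed)
  have "br i (y - y') z = 0" if "i < r" "z \<in> U" for i z
    by (rule br_orthogonal[OF V _ U_invariant U(2) _ mem that(2,1)]) (auto simp: V_def sym)
  then have "br i y z = br i y' z" if "i < r" "z \<in> U" for i z
    using that br_simps(1)[of i "y - y'" y' z] by simp
  then show ?thesis using that y'(1) by blast
qed

text \<open>The \<open>J\<close> kill the nonzero vector \<open>br i0 x0 y0\<close> by
  \<open>J_br\<close>, and the vectors killed by all of them form an invariant subspace. An
  irreducible piece thus carries brackets or rotations, never both.\<close>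

lemma J_zero:
  assumes "i0 < r" "x0 \<in> U" "y0 \<in> W" "br i0 x0 y0 \<noteq> 0" and "i < r" "j < r" "x \<in> U"
  shows "J i j x = 0"
proof -
  have "\<forall>i<r. \<forall>j<r. J i j x = 0"
  proof (rule irreducible_all[of "\<lambda>x. \<forall>i<r. \<forall>j<r. J i j x = 0", OF _ _ _ _ assms(4) _ assms(7)])
    show "subspace {x \<in> U. \<forall>i<r. \<forall>j<r. J i j x = 0}"
      using U_subspace by (auto simp: subspace_def J_simps)
    show "br i0 x0 y0 \<in> U" using invariantD[OF U_invariant] assms by blast
    show "\<forall>i<r. \<forall>j<r. J i j (br i0 x0 y0) = 0" using J_br assms U(2) by blast
  qed (use J_br U(2) J_simps in auto)
  then show ?thesis using assms by blast
qed

context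
  fixes i0 x0 y0 assumes i0: "i0 < r" "x0 \<in> U" "y0 \<in> W" "br i0 x0 y0 \<noteq> 0"
begin

text \<open>The centre of \<open>br i0\<close> in \<open>U\<close> is invariant and does not contain
  \<open>x0\<close>.\<close>

lemma br_faithful:
  assumes "m \<in> U" "\<And>w. w \<in> W \<Longrightarrow> br i0 m w = 0"
  shows "m = 0"
proof (rule ccontr)
  assume "m \<noteq> 0"
  have "\<forall>w\<in>W. br i0 x0 w = 0"
  proof (rule irreducible_all[of "\<lambda>x. \<forall>w\<in>W. br i0 x w = 0", OF _ _ _ assms(1) \<open>m \<noteq> 0\<close> _ i0(2)])
    show "subspace {x \<in> U. \<forall>w\<in>W. br i0 x w = 0}"
      using U_subspace by (auto simp: subspace_def br_simps)
    show "\<forall>w\<in>W. br i0 (br i y x) w = 0"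
      if "i < r" "y \<in> W" "x \<in> U" "\<forall>w\<in>W. br i0 x w = 0" for i x y
      using br_derivation[of y x _ i i0] that U(2) br_W by (auto simp: br_simps)
    show "\<forall>w\<in>W. br i0 (J i j x) w = 0" if "i < r" "j < r" "x \<in> U" for i j x
      using J_zero[OF i0 that] by (simp add: br_simps)
  qed (use assms(2) in blast)
  then show False using i0 by blast
qed

text \<open>The scalar arises as an operator \<open>M\<close> with
  \<open>br j x = br i0 (M x)\<close>. \<open>br_exchange\<close> supplies \<open>M\<close> on
  values of \<open>br i0\<close>, irreducibility extends it to \<open>U\<close>,
  \<open>br_faithful\<close> makes it unique, and invariance of the form makes it symmetric, so
  Schur's lemma applies.\<close>

lemma br_scalar:
  assumes j: "j < r"
  shows "\<exists>k. \<forall>x\<in>U. \<forall>w\<in>W. br j x w = k *\<^sub>R br i0 x w"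
proof -
  let ?P = "\<lambda>x m. m \<in> U \<and> (\<forall>w\<in>W. br j x w = br i0 m w)"
  have start: "?P (br i0 x y) (br j x y)" if "x \<in> U" "y \<in> W" for x y
    using that br_exchange[of x y _ j i0] invariantD(2)[OF U_invariant j] U(2) by auto
  have step: "?P (br k y x) (br k y m)" if "k < r" "y \<in> W" "x \<in> U" "?P x m" for k x y m
  proof (intro conjI ballI)
    show "br k y m \<in> U" using that invariantD[OF U_invariant] by blast
    fix w assume w: "w \<in> W"
    have "br j (br k y x) w = br k y (br j x w) - br j x (br k y w)"
      using br_derivation[of y x w k j] that w U(2) by auto
    also have "\<dots> = br k y (br i0 m w) - br i0 m (br k y w)"
      using that w br_W by auto
    also have "\<dots> = br i0 (br k y m) w"
      using br_derivation[of y m w k i0] that w U(2) by auto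
    finally show "br j (br k y x) w = br i0 (br k y m) w" .
  qed
  have P0: "?P 0 0" using U_subspace by (simp add: subspace_0 br_simps)
  have add: "?P (x + x') (m + m')" if "?P x m" "?P x' m'" for x x' m m'
    using that U_subspace by (simp add: subspace_add br_simps)
  have scale: "?P (a *\<^sub>R x) (a *\<^sub>R m)" if "?P x m" for x m a
    using that U_subspace by (simp add: subspace_scale br_simps)
  have ex: "\<exists>m. ?P x m" if "x \<in> U" for x
  proof (rule irreducible_all[of "\<lambda>x. \<exists>m. ?P x m", OF _ _ _ _ i0(4) _ that])
    show "subspace {x \<in> U. \<exists>m. ?P x m}"
    proof (rule subspaceI)
      show "0 \<in> {x \<in> U. \<exists>m. ?P x m}" using P0 subspace_0[OF U_subspace] by blast
      fix x y a assume x: "x \<in> {x \<in> U. \<exists>m. ?P x m}"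
      then obtain m where m: "x \<in> U" "?P x m" by blast
      show "a *\<^sub>R x \<in> {x \<in> U. \<exists>m. ?P x m}"
        using scale[OF m(2)] subspace_scale[OF U_subspace m(1)] by blast
      assume "y \<in> {x \<in> U. \<exists>m. ?P x m}"
      then obtain n where n: "y \<in> U" "?P y n" by blast
      show "x + y \<in> {x \<in> U. \<exists>m. ?P x m}"
        using add[OF m(2) n(2)] subspace_add[OF U_subspace m(1) n(1)] by blast
    qed
    show "br i0 x0 y0 \<in> U" using i0 invariantD[OF U_invariant] by blast
    show "\<exists>m. ?P (br i0 x0 y0) m" using start i0 by blast
    show "\<exists>m. ?P (J i k x) m" if "i < r" "k < r" "x \<in> U" for i k x
      unfolding J_zero[OF i0 that] using P0 by blast
  qed (use step in blast)
  obtain F where F: "span F = U" "independent F" "F \<subseteq> U"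
    using fin_dim_subspace_finite[OF fin U_subspace] by blast
  have "\<forall>x\<in>F. \<exists>m. ?P x m" using ex F(3) by blast
  \<comment> \<open>Chosen witnesses need not depend linearly on \<open>x\<close>; they are taken on
    a basis only, and uniqueness later identifies the linear extension with every other
    witness.\<close>
  then obtain m where m: "\<forall>x\<in>F. ?P x (m x)" by (rule bchoice[THEN exE])
  obtain M where M: "linear M" "\<And>x. x \<in> F \<Longrightarrow> M x = m x"
    using linear_independent_extend[OF F(2), of m] by blast
  have "subspace {x. ?P x (M x)}"
    by (rule subspaceI, unfold mem_Collect_eq linear_0[OF M(1)] linear_add[OF M(1)] linear_scale[OF M(1)])
      (fact P0, rule add, assumption+, rule scale)
  then have MP: "?P x (M x)" if "x \<in> U" for x
  proof -
    have "F \<subseteq> {x. ?P x (M x)}"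
    proof
      fix x assume "x \<in> F"
      then show "x \<in> {x. ?P x (M x)}" using m M(2)[of x] by simp
    qed
    then have "span F \<subseteq> {x. ?P x (M x)}" by (rule span_minimal) fact
    then show ?thesis using F(1) that by blast
  qed
  have unique: "M x = n" if "x \<in> U" "?P x n" for x n
  proof -
    have 0: "br i0 (M x - n) w = 0" if "w \<in> W" for w
    proof -
      have "br i0 (M x) w = br i0 n w"
        using bspec[OF conjunct2[OF MP[OF \<open>x \<in> U\<close>]] that] bspec[OF conjunct2[OF \<open>?P x n\<close>] that] by simp
      then show ?thesis using br_simps(1)[of i0 "M x - n" n w] by simp
    qed
    have "M x - n \<in> U"
      by (rule subspace_diff[OF U_subspace conjunct1[OF MP[OF \<open>x \<in> U\<close>]] conjunct1[OF \<open>?P x n\<close>]])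
    then have "M x - n = 0" by (rule br_faithful[OF _ 0])
    then show ?thesis by simp
  qed
  have Mbr: "M (br k y x) = br k y (M x)" if "k < r" "y \<in> W" "x \<in> U" for k y x
  proof (rule unique)
    show "br k y x \<in> U" by (rule invariantD(1)[OF U_invariant that(1,3,2)])
    show "?P (br k y x) (br k y (M x))" by (rule step[OF that MP[OF that(3)]])
  qed
  have Msym: "\<forall>x\<in>U. B (M x) y = B x (M y)" if "y \<in> U" for y
  proof (rule irreducible_all[of "\<lambda>y. \<forall>x\<in>U. B (M x) y = B x (M y)", OF _ _ _ _ i0(4) _ that])
    show "subspace {y \<in> U. \<forall>x\<in>U. B (M x) y = B x (M y)}"
      using U_subspace M(1) by (auto simp: subspace_def linear_0 linear_add linear_scale)
    show mem: "br i0 x0 y0 \<in> U" using i0 invariantD[OF U_invariant] by blast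
    show "\<forall>x\<in>U. B (M x) (br i0 x0 y0) = B x (M (br i0 x0 y0))"
    proof
      fix x assume x: "x \<in> U"
      have "B (M x) (br i0 x0 y0) = B (br i0 (M x) x0) y0"
        using MP[OF x] U(2) i0 by (intro br_inv[symmetric]) auto
      also have "\<dots> = B (br j x x0) y0" using MP[OF x] U(2) i0 by auto
      also have "\<dots> = B x (br j x0 y0)" using x U(2) i0 by (intro br_inv) auto
      also have "br j x0 y0 = M (br i0 x0 y0)"
        by (rule unique[OF mem start[OF i0(2,3)], symmetric])
      finally show "B (M x) (br i0 x0 y0) = B x (M (br i0 x0 y0))" .
    qed
    show "\<forall>x\<in>U. B (M x) (br k w y) = B x (M (br k w y))"
      if kw: "k < r" "w \<in> W" "y \<in> U" and y: "\<forall>x\<in>U. B (M x) y = B x (M y)" for k y w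
    proof
      fix x assume x: "x \<in> U"
      have UW: "x \<in> W" "y \<in> W" "M x \<in> W" "M y \<in> W" using x kw(3) MP U(2) by auto
      have "B (M x) (br k w y) = - B (M (br k w x)) y"
        using br_skew[of "M x" y k w] UW Mbr[OF kw(1,2) x] by simp
      also have "\<dots> = - B (br k w x) (M y)"
        using y invariantD(1)[OF U_invariant kw(1) x kw(2)] by simp
      also have "\<dots> = B x (M (br k w y))"
        using br_skew[of x "M y" k w] UW Mbr[OF kw] by simp
      finally show "B (M x) (br k w y) = B x (M (br k w y))" .
    qed
    show "\<forall>x\<in>U. B (M x) (J i k y) = B x (M (J i k y))" if "i < r" "k < r" "y \<in> U" for i k y
      using J_zero[OF i0 that] M(1) by (simp add: linear_0)
  qed
  have "\<exists>l. \<forall>x\<in>U. M x = l *\<^sub>R x"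
  proof (rule schur_symmetric[OF fin U(1) _ G_scale M(1)])
    show "M (g x) = g (M x)" if "g \<in> G" "x \<in> U" for g x
      using that(1) Mbr that(2) J_zero[OF i0] MP[OF that(2)] M(1) unfolding G_def
      by (auto simp: linear_0)
  qed (use U(2) W_pos MP Msym in auto)
  then show ?thesis using MP br_simps(3) by metis
qed

text \<open>An ideal of \<open>br i0\<close> in \<open>U\<close> is invariant under all of
  \<open>G\<close>: arguments from \<open>W\<close> are replaced by arguments from \<open>U\<close>
  through \<open>br_split\<close>, every \<open>br k\<close> is a multiple of \<open>br i0\<close>,
  and the \<open>J\<close> vanish.\<close>

lemma simple_Lie: "metric_simple_Lie_on B U (br i0)"
  unfolding metric_simple_Lie_on_def
proof (intro conjI allI ballI impI)
  fix x y z :: 'v and a :: real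
  show "br i0 (a *\<^sub>R x + y) z = a *\<^sub>R br i0 x z + br i0 y z" by (simp add: br_simps)
next
  fix x y assume "x \<in> U" "y \<in> U"
  show "br i0 x y \<in> U" using invariantD(2)[OF U_invariant i0(1)] \<open>x \<in> U\<close> \<open>y \<in> U\<close> U(2) by blast
  show "br i0 x y = - br i0 y x" by (rule br_swap)
next
  fix x y z assume xyz: "x \<in> U" "y \<in> U" "z \<in> U"
  then have w: "x \<in> W" "y \<in> W" "z \<in> W" using U(2) by auto
  show "B (br i0 x y) z = B x (br i0 y z)" using w by (rule br_inv)
  show "br i0 x (br i0 y z) + br i0 y (br i0 z x) + br i0 z (br i0 x y) = 0"
    using br_derivation[OF w, of i0 i0] br_swap[of i0 "br i0 x y" z] br_swap[of i0 x z]
    by (simp add: br_simps)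
next
  \<comment> \<open>\<open>y0\<close> is known to lie only in \<open>W\<close>; by skewness
    \<open>w\<close> and \<open>x0\<close> form a noncommuting pair inside \<open>U\<close>.\<close>
  define w where "w = br i0 x0 y0"
  have w: "w \<in> U" unfolding w_def using i0 invariantD[OF U_invariant] by blast
  have "B w w = B y0 (br i0 w x0)"
    using br_skew[of y0 w i0 x0] br_swap[of i0 x0 w] i0 w U(2) unfolding w_def by auto
  then have "br i0 w x0 \<noteq> 0" using W_pos[of w] w U(2) i0(4) unfolding w_def by auto
  then show "\<exists>x\<in>U. \<exists>y\<in>U. br i0 x y \<noteq> 0" using w i0(2) by blast
next
  fix I assume I: "subspace I \<and> I \<subseteq> U \<and> (\<forall>x\<in>U. \<forall>y\<in>I. br i0 x y \<in> I)"
  have "br k y x \<in> I" if k: "k < r" and y: "y \<in> W" and x: "x \<in> I" for k y x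
  proof -
    obtain y' where y': "y' \<in> U" "\<And>i z. i < r \<Longrightarrow> z \<in> U \<Longrightarrow> br i y z = br i y' z"
      using br_split[OF y] by blast
    obtain l where "\<forall>x\<in>U. \<forall>w\<in>W. br k x w = l *\<^sub>R br i0 x w" using br_scalar[OF k] by blast
    moreover have "x \<in> U" "x \<in> W" using x I U(2) by blast+
    ultimately have "br k y x = l *\<^sub>R br i0 y' x" using y' k by simp
    then show ?thesis using I x y'(1) by (simp add: subspace_scale)
  qed
  moreover have "J i j x \<in> I" if "i < r" "j < r" "x \<in> I" for i j x
    using J_zero[OF i0 that(1,2)] that I by (auto simp: subspace_0)
  ultimately have "op_invariant G I" using I unfolding op_invariant_def G_def by auto
  then show "I = {0} \<or> I = U" using U(1) I unfolding op_irreducible_def by blast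
qed (rule U_subspace)

end

text \<open>The products of \<open>J i j\<close> with a nonzero \<open>J p q\<close> are symmetric
  and commute with \<open>G\<close>, hence are scalars on \<open>U\<close>. As \<open>J p q\<close>
  has negative square, all \<open>J i j\<close> are multiples of one complex structure
  \<open>H\<close>, and a vector with its image under \<open>H\<close> already spans an invariant
  plane.\<close>

lemma plane:
  assumes br0: "\<And>i x y. i < r \<Longrightarrow> x \<in> U \<Longrightarrow> y \<in> W \<Longrightarrow> br i x y = 0"
    and pq: "p < r" "q < r" "x0 \<in> U" "J p q x0 \<noteq> 0"
  shows "\<exists>H eta zeta. dim U = 2 \<and> complex_structure_on B U H \<and>
     (\<forall>i<r. \<forall>j<r. \<forall>x\<in>U. J i j x = (eta i * zeta j - eta j * zeta i) *\<^sub>R H x) \<and>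
     (\<exists>i<r. \<exists>j<r. eta i * zeta j - eta j * zeta i \<noteq> 0)"
proof -
  have JU: "J i j x \<in> U" if "i < r" "j < r" "x \<in> U" for i j x
    using invariantD(3)[OF U_invariant that(1,3,2)] .
  have UW: "x \<in> W" if "x \<in> U" for x using that U(2) by blast
  have Jlin: "linear (\<lambda>x. J i j (J k l x))" for i j k l
    by (rule linearI) (simp_all add: J_simps)
  have br0': "br k y x = 0" if "k < r" "y \<in> W" "x \<in> U" for k y x
    using br0[of k x y] that br_swap[of k y x] by simp
  have "\<exists>c. \<forall>x\<in>U. J i j (J p q x) = c *\<^sub>R x" if ij: "i < r" "j < r" for i j
  proof (rule schur_symmetric[OF fin U(1) _ G_scale Jlin])
    show "B (J i j (J p q x)) y = B x (J i j (J p q y))" if "x \<in> U" "y \<in> U" for x y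
      using that ij pq by (simp add: J_skew J_W UW J_comm[of i j p q y])
    show "J i j (J p q (g x)) = g (J i j (J p q x))" if "g \<in> G" "x \<in> U" for g x
      using that ij pq br0' JU J_W UW unfolding G_def by (auto simp: J_simps J_comm)
  qed (use W_pos UW JU ij pq in auto)
  then obtain c where c: "\<And>i j x. i < r \<Longrightarrow> j < r \<Longrightarrow> x \<in> U \<Longrightarrow> J i j (J p q x) = c i j *\<^sub>R x"
    by metis
  have x0: "x0 \<noteq> 0" using pq(4) J_simps(3) by auto
  have "c p q * B x0 x0 = - B (J p q x0) (J p q x0)"
    using J_skew[OF J_W UW[OF pq(3)], of p q p q x0] c[OF pq(1-3)] by simp
  moreover have "B (J p q x0) (J p q x0) > 0" "B x0 x0 > 0"
    using W_pos J_W pq x0 UW by auto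
  ultimately have neg: "c p q < 0"
    by (metis less_irrefl neg_less_0_iff_less not_less_iff_gr_or_eq zero_less_mult_iff mult_zero_left)
  \<comment> \<open>\<open>J p q\<close> squares to the negative scalar \<open>c p q\<close> on
    \<open>U\<close>, so division by \<open>m\<close> normalises the square to
    \<open>- 1\<close>.\<close>
  define m where "m = sqrt (- c p q)"
  have m: "m > 0" "m * m = - c p q" using neg by (simp_all add: m_def)
  define H where "H x = (1 / m) *\<^sub>R J p q x" for x
  define h where "h i j = c i j / c p q * m" for i j
  have HU: "H x \<in> U" if "x \<in> U" for x
    unfolding H_def using JU that pq subspace_scale[OF U_subspace] by blast
  have HH: "H (H x) = - x" if "x \<in> U" for x
  proof -
    have "H (H x) = ((1 / m) * (1 / m) * c p q) *\<^sub>R x"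
      using c[OF pq(1,2) that] by (simp add: H_def J_simps)
    also have "(1 / m) * (1 / m) * c p q = - 1" using m neg by (simp add: field_simps)
    finally show ?thesis by simp
  qed
  have Jh: "J i j x = h i j *\<^sub>R H x" if "i < r" "j < r" "x \<in> U" for i j x
  proof -
    have "c p q *\<^sub>R J i j x = c i j *\<^sub>R J p q x"
      using c[OF that(1,2) JU[OF pq(1,2) that(3)]] c[OF pq(1,2) that(3)] by (simp add: J_simps)
    then have "J i j x = (c i j / c p q) *\<^sub>R J p q x"
      using neg by (metis divide_inverse_commute less_irrefl scaleR_one scaleR_scaleR left_inverse)
    then show ?thesis using m by (simp add: H_def h_def)
  qed
  have Hskew: "B (H x) y = - B x (H y)" if "x \<in> U" "y \<in> U" for x y
    using that by (simp add: H_def J_skew UW)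
  have cs: "complex_structure_on B U H"
    unfolding complex_structure_on_def using HU HH Hskew
    by (simp add: H_def J_simps scaleR_add_right)
  have Hlin: "H (a *\<^sub>R x + b *\<^sub>R y) = a *\<^sub>R H x + b *\<^sub>R H y" for a b x y
    by (simp add: H_def J_simps scaleR_add_right)
  have Hx0: "B x0 (H x0) = 0" using Hskew[OF pq(3,3)] sym[of "H x0" x0] by simp
  have Hx0n: "H x0 \<noteq> 0" using pq(4) m by (simp add: H_def)
  have indep: "independent {x0, H x0}" and ne: "x0 \<noteq> H x0"
  proof -
    show ne: "x0 \<noteq> H x0" using Hx0 W_pos[OF UW[OF pq(3)] x0] by auto
    have "x0 \<notin> span {H x0}"
    proof
      assume "x0 \<in> span {H x0}"
      then obtain k where "x0 = k *\<^sub>R H x0" by (auto simp: span_singleton)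
      then have "B x0 x0 = k * B x0 (H x0)" by (metis form_simps(6))
      then show False using Hx0 W_pos[OF UW[OF pq(3)] x0] by simp
    qed
    then show "independent {x0, H x0}"
      using Hx0n by (simp add: independent_insert ne)
  qed
  have inv: "op_invariant G (span {x0, H x0})"
    unfolding op_invariant_def
  proof (intro conjI ballI subspace_span)
    fix g x assume g: "g \<in> G" and x: "x \<in> span {x0, H x0}"
    have xU: "x \<in> U" using x span_minimal[OF _ U_subspace, of "{x0, H x0}"] pq(3) HU by blast
    obtain a b where ab: "x = a *\<^sub>R x0 + b *\<^sub>R H x0"
      using x by (auto simp: span_insert span_singleton algebra_simps)
    have "H x = a *\<^sub>R H x0 - b *\<^sub>R x0"
      by (simp add: ab Hlin HH[OF pq(3)])
    then have "H x \<in> span {x0, H x0}" by (simp add: span_diff span_scale span_base)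
    then show "g x \<in> span {x0, H x0}"
      using g Jh[OF _ _ xU] br0'[OF _ _ xU] unfolding G_def by (auto simp: span_scale span_zero)
  qed
  have "span {x0, H x0} = U"
  proof -
    have "span {x0, H x0} \<subseteq> U" using span_minimal[OF _ U_subspace, of "{x0, H x0}"] pq(3) HU by blast
    moreover have "span {x0, H x0} \<noteq> {0}" using x0 span_base[of x0 "{x0, H x0}"] by auto
    ultimately show ?thesis using inv U(1) unfolding op_irreducible_def by blast
  qed
  then have dim: "dim U = 2"
    using dim_span_eq_card_independent[OF indep] ne by simp
  have hpq: "h p q \<noteq> 0" using neg m by (simp add: h_def)
  have hswap: "h i j = - h j i" if "i < r" "j < r" for i j
  proof -
    have "h i j *\<^sub>R H x0 = - (h j i *\<^sub>R H x0)"
      using Jh[OF that pq(3)] Jh[OF that(2,1) pq(3)] J_swap[of i j x0] by simp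
    then have "(h i j + h j i) *\<^sub>R H x0 = 0" by (simp add: scaleR_add_left)
    then show ?thesis using Hx0n by simp
  qed
  have JJ: "J i j (J k l x0) = - (h i j * h k l) *\<^sub>R x0" if "i < r" "j < r" "k < r" "l < r" for i j k l
    using Jh[OF that(1,2)] Jh[OF that(3,4) pq(3)] HU[OF pq(3)] HH[OF pq(3)] by (simp add: J_simps)
  have pl: "h k l * h i j + h l j * h i k + h j k * h i l = 0"
    if "i < r" "j < r" "k < r" "l < r" for i j k l
  proof -
    have "- (h k l * h i j + h l j * h i k + h j k * h i l) *\<^sub>R x0 = 0"
      using J_pluecker[OF that UW[OF pq(3)]] that by (simp add: JJ algebra_simps)
    then show ?thesis using x0 by (simp del: minus_add_distrib)
  qed
  \<comment> \<open>The Pluecker relation with \<open>k = p\<close> and \<open>l = q\<close>, solved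
    for \<open>h i j\<close>, exhibits the bivector \<open>h\<close> as decomposable; the nonzero
    entry \<open>h p q\<close> is the divisor.\<close>
  define eta where "eta i = h i p" for i
  define zeta where "zeta j = h j q / h p q" for j
  have hez: "h i j = eta i * zeta j - eta j * zeta i" if "i < r" "j < r" for i j
  proof -
    have "h p q * h i j + h q j * h i p + h j p * h i q = 0"
      by (rule pl) (use that pq in auto)
    then have "h p q * h i j = h i p * h j q - h j p * h i q"
      using hswap[of q j] that pq by (simp add: algebra_simps)
    then show ?thesis using hpq by (simp add: eta_def zeta_def field_simps)
  qed
  show ?thesis
  proof (rule exI[of _ H], rule exI[of _ eta], rule exI[of _ zeta], intro conjI)
    show "\<forall>i<r. \<forall>j<r. \<forall>x\<in>U. J i j x = (eta i * zeta j - eta j * zeta i) *\<^sub>R H x"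
      using Jh hez by simp
    show "\<exists>i<r. \<exists>j<r. eta i * zeta j - eta j * zeta i \<noteq> 0"
      using hez[OF pq(1,2)] hpq pq(1,2) by auto
  qed (fact dim, fact cs)
qed

end

end

section \<open>The normal form\<close>

context sym_form
begin

text \<open>The squares may have either sign, as is needed for a basis of the whole indefinite
  space.\<close>

lemma orthogonal_family_dim:
  assumes K: "finite K" and orth: "\<And>a b. a \<in> K \<Longrightarrow> b \<in> K \<Longrightarrow> a \<noteq> b \<Longrightarrow> B (f a) (f b) = 0"
    and ne: "\<And>a. a \<in> K \<Longrightarrow> B (f a) (f a) \<noteq> 0"
  shows "dim (span (f ` K)) = card K"
proof -
  have inj: "inj_on f K" using orth ne by (metis inj_onI)
  have "independent (f ` K)"
  proof (rule independent_if_scalars_zero)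
    fix c x assume c: "(\<Sum>y\<in>f ` K. c y *\<^sub>R y) = 0" and "x \<in> f ` K"
    then obtain k where k: "k \<in> K" "x = f k" by blast
    have "(\<Sum>a\<in>K. c (f a) * B (f a) x) = B (\<Sum>y\<in>f ` K. c y *\<^sub>R y) x"
      by (simp add: sum.reindex[OF inj] sum_left)
    also have "\<dots> = 0" by (simp add: c)
    also have "(\<Sum>a\<in>K. c (f a) * B (f a) x) = (\<Sum>a\<in>K. if a = k then c x * B x x else 0)"
      using orth k by (intro sum.cong) auto
    finally show "c x = 0" using k ne K by simp
  qed (use K in simp)
  then show ?thesis
    using dim_span_eq_card_independent card_image[OF inj] by metis
qed

end

context normal_frame
begin

section \<open>The common kernel and the enumeration of the pieces\<close>

definition E0 :: "'v set" where "E0 = {x \<in> W. \<forall>g\<in>G. g x = 0}"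

lemma E0_W: "x \<in> E0 \<Longrightarrow> x \<in> W" by (simp add: E0_def)

lemma E0_D:
  assumes "x \<in> E0" "i < r"
  shows "y \<in> W \<Longrightarrow> br i y x = 0" "y \<in> W \<Longrightarrow> br i x y = 0" "j < r \<Longrightarrow> J i j x = 0"
proof -
  show 1: "y \<in> W \<Longrightarrow> br i y x = 0" and "j < r \<Longrightarrow> J i j x = 0"
    using assms unfolding E0_def G_def by blast+
  show "y \<in> W \<Longrightarrow> br i x y = 0" using 1 br_swap[of i x y] by simp
qed

lemma E0_I:
  assumes "x \<in> W" "\<And>i y. i < r \<Longrightarrow> y \<in> W \<Longrightarrow> br i y x = 0" "\<And>i j. i < r \<Longrightarrow> j < r \<Longrightarrow> J i j x = 0"
  shows "x \<in> E0"
  unfolding E0_def G_def using assms by blast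

lemma E0_invariant: "op_invariant G E0"
proof -
  have lin: "g (x + y) = g x + g y" "g (a *\<^sub>R x) = a *\<^sub>R g x" "g 0 = 0" if "g \<in> G" for g x y a
    using that unfolding G_def by (auto simp: br_simps J_simps)
  have "subspace E0"
  proof (rule subspaceI)
    show "0 \<in> E0" using lin(3) W_closed(5) by (auto simp: E0_def)
    fix x y a assume x: "x \<in> E0"
    show "a *\<^sub>R x \<in> E0"
      unfolding E0_def
    proof (intro CollectI conjI ballI)
      show "g (a *\<^sub>R x) = 0" if "g \<in> G" for g
      proof -
        have "g x = 0" using x that unfolding E0_def by blast
        then show ?thesis using lin(2)[OF that, of a x] by simp
      qed
    qed (use x W_closed(3) in \<open>simp add: E0_def\<close>)
    assume y: "y \<in> E0"
    show "x + y \<in> E0"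
      unfolding E0_def
    proof (intro CollectI conjI ballI)
      show "g (x + y) = 0" if "g \<in> G" for g
      proof -
        have "g x = 0" "g y = 0" using x y that unfolding E0_def by blast+
        then show ?thesis using lin(1)[OF that, of x y] by simp
      qed
    qed (use x y W_closed(1) in \<open>simp add: E0_def\<close>)
  qed
  moreover have "g x \<in> E0" if "g \<in> G" "x \<in> E0" for g x
  proof -
    have "g x = 0" using that unfolding E0_def by blast
    then show ?thesis using subspace_0[OF \<open>subspace E0\<close>] by simp
  qed
  ultimately show ?thesis unfolding op_invariant_def by blast
qed

text \<open>\<open>skew_decomposition\<close> says nothing about products of the pieces with the
  common kernel. Kernel vectors are orthogonal to all values of the skew operators, and
  \<open>U\<close> contains a nonzero such value.\<close>

lemma E0_perp_irreducible:
  assumes U: "op_irreducible G U" "U \<subseteq> W" and g: "g \<in> G" "x0 \<in> U" "g x0 \<noteq> 0"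
    and "k \<in> E0" "x \<in> U"
  shows "B k x = 0"
proof -
  have inv: "g x \<in> U" if "g \<in> G" "x \<in> U" for g x
    using U(1) that by (auto simp: op_irreducible_def op_invariant_def)
  have sU: "subspace U" using U(1) by (simp add: op_irreducible_def op_invariant_def)
  have 0: "B k (g x) = 0" if "g \<in> G" "k \<in> E0" "x \<in> W" for g k x
  proof -
    have "g k = 0" using that(1,2) unfolding E0_def by blast
    then show ?thesis using G_skew[OF that(1) E0_W[OF that(2)] that(3)] by simp
  qed
  have "\<forall>k\<in>E0. B k x = 0"
  proof (rule op_irreducible_all[OF U(1), of "\<lambda>x. \<forall>k\<in>E0. B k x = 0", OF _ _ inv[OF g(1,2)] g(3)])
    show "subspace {x \<in> U. \<forall>k\<in>E0. B k x = 0}" using sU by (auto simp: subspace_def)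
  qed (use 0 U(2) g assms(7) in blast)+
  then show ?thesis using assms(6) by blast
qed

definition plane_data where
  "plane_data U H eta zeta \<longleftrightarrow> dim U = 2 \<and> complex_structure_on B U H \<and>
     (\<forall>i<r. \<forall>x\<in>U. \<forall>y\<in>W. br i x y = 0) \<and>
     (\<forall>i<r. \<forall>j<r. \<forall>x\<in>U. J i j x = (eta i * zeta j - eta j * zeta i) *\<^sub>R H x) \<and>
     (\<exists>i<r. \<exists>j<r. eta i * zeta j - eta j * zeta i \<noteq> (0::real))"

definition simple_data where
  "simple_data U b kappa \<longleftrightarrow> metric_simple_Lie_on B U b \<and> (\<exists>i<r. kappa i \<noteq> (0::real)) \<and>
     (\<forall>i<r. \<forall>x\<in>U. \<forall>y\<in>W. br i x y = kappa i *\<^sub>R b x y) \<and> (\<forall>i<r. \<forall>j<r. \<forall>x\<in>U. J i j x = 0)"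

lemma irreducible_classification:
  assumes U: "op_irreducible G U" "U \<subseteq> W" and nt: "\<exists>g\<in>G. \<exists>x\<in>U. g x \<noteq> 0"
  shows "(\<exists>b kappa. simple_data U b kappa) \<or> (\<exists>H eta zeta. plane_data U H eta zeta)"
proof (cases "\<exists>i0<r. \<exists>x0\<in>U. \<exists>y0\<in>W. br i0 x0 y0 \<noteq> 0")
  case True
  then obtain i0 x0 y0 where i0: "i0 < r" "x0 \<in> U" "y0 \<in> W" "br i0 x0 y0 \<noteq> 0" by blast
  obtain kappa where k: "\<And>i x w. i < r \<Longrightarrow> x \<in> U \<Longrightarrow> w \<in> W \<Longrightarrow> br i x w = kappa i *\<^sub>R br i0 x w"
    using br_scalar[OF U i0] by metis
  have "kappa i0 \<noteq> 0" using k[OF i0(1-3)] i0(4) by auto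
  then have "simple_data U (br i0) kappa"
    unfolding simple_data_def using simple_Lie[OF U i0] k J_zero[OF U i0] i0(1) by blast
  then show ?thesis by blast
next
  case False
  then have br0: "\<And>i x y. i < r \<Longrightarrow> x \<in> U \<Longrightarrow> y \<in> W \<Longrightarrow> br i x y = 0" by blast
  obtain g x where g: "g \<in> G" "x \<in> U" "g x \<noteq> 0" using nt by blast
  have "br i y x = 0" if "i < r" "y \<in> W" for i y
    using br0[OF that(1) g(2) that(2)] br_swap[of i y x] by simp
  then obtain p q where pq: "p < r" "q < r" "J p q x \<noteq> 0"
    using g unfolding G_def by blast
  then show ?thesis using plane[OF U br0 pq(1,2) g(2) pq(3)] br0 unfolding plane_data_def by blast
qed

lemma ex_pieces:
  "\<exists>M N (E :: nat \<Rightarrow> 'v set) (V :: nat \<Rightarrow> 'v set).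
    (\<forall>P. valid_piece M N P \<longrightarrow> op_invariant G (piece_set E0 E V P) \<and> piece_set E0 E V P \<subseteq> W) \<and>
    (\<forall>P Q. valid_piece M N P \<and> valid_piece M N Q \<and> P \<noteq> Q \<longrightarrow>
      (\<forall>x\<in>piece_set E0 E V P. \<forall>y\<in>piece_set E0 E V Q. B x y = 0)) \<and>
    W \<subseteq> span (\<Union>{piece_set E0 E V P | P. valid_piece M N P}) \<and>
    (\<forall>a<N. \<exists>b kappa. simple_data (V a) b kappa) \<and>
    (\<forall>p<M. \<exists>H eta zeta. plane_data (E p) H eta zeta)"
proof -
  have "\<exists>I. finite I \<and> (\<forall>U\<in>I. U \<subseteq> W \<and> op_irreducible G U \<and> (\<exists>g\<in>G. \<exists>x\<in>U. g x \<noteq> 0)) \<and>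
     (\<forall>U\<in>I. \<forall>V\<in>I. U \<noteq> V \<longrightarrow> (\<forall>x\<in>U. \<forall>y\<in>V. B x y = 0)) \<and>
     W \<subseteq> span (\<Union>I \<union> E0)"
    unfolding E0_def by (rule skew_decomposition[OF fin G_W]) (fact W_pos, rule G_skew)
  then obtain I where I: "finite I"
    "\<forall>U\<in>I. U \<subseteq> W \<and> op_irreducible G U \<and> (\<exists>g\<in>G. \<exists>x\<in>U. g x \<noteq> 0)"
    "\<forall>U\<in>I. \<forall>V\<in>I. U \<noteq> V \<longrightarrow> (\<forall>x\<in>U. \<forall>y\<in>V. B x y = 0)"
    "W \<subseteq> span (\<Union>I \<union> E0)"
    by (elim exE conjE) (rule that, assumption+)
  have irr: "U \<subseteq> W" "op_irreducible G U" "\<exists>g\<in>G. \<exists>x\<in>U. g x \<noteq> 0" if "U \<in> I" for U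
    using bspec[OF I(2) that] by auto
  have IE0: "B k x = 0" "B x k = 0" if "U \<in> I" "k \<in> E0" "x \<in> U" for U k x
    using E0_perp_irreducible[OF irr(2,1)[OF that(1)]] irr(3)[OF that(1)] that sym by metis+
  define IV where "IV = {U \<in> I. \<exists>b kappa. simple_data U b kappa}"
  define IE where "IE = I - IV"
  have fi: "finite IV" "finite IE" using I(1) by (auto simp: IV_def IE_def)
  obtain V where V: "bij_betw V {..<card IV} IV"
    using ex_bij_betw_nat_finite[OF fi(1)] by (auto simp: atLeast0LessThan)
  obtain E where E: "bij_betw E {..<card IE} IE"
    using ex_bij_betw_nat_finite[OF fi(2)] by (auto simp: atLeast0LessThan)
  let ?PS = "piece_set E0 E V" and ?v = "valid_piece (card IE) (card IV)"
  have VI: "V a \<in> IV" if "a < card IV" for a using V that by (auto simp: bij_betw_def)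
  have EI: "E p \<in> IE" if "p < card IE" for p using E that by (auto simp: bij_betw_def)
  have sub: "IV \<subseteq> I" "IE \<subseteq> I" by (auto simp: IV_def IE_def)
  have PS: "?PS P \<in> I \<or> P = P0" if "?v P" for P
    using that VI EI sub by (cases P) auto
  have inj: "?PS P \<noteq> ?PS Q" if "?v P" "?v Q" "P \<noteq> Q" "P \<noteq> P0" "Q \<noteq> P0" for P Q
  proof (cases P)
    case (PE p)
    show ?thesis
    proof (cases Q)
      case (PE q)
      then show ?thesis
        using that \<open>P = PE p\<close> bij_betw_imp_inj_on[OF E] by (auto dest: inj_onD)
    next
      case (PW a)
      then have "E p \<in> IE" "V a \<in> IV" using that \<open>P = PE p\<close> EI VI by auto
      then show ?thesis using \<open>P = PE p\<close> PW unfolding IE_def by auto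
    qed (use that in simp)
  next
    case (PW a)
    show ?thesis
    proof (cases Q)
      case (PW b)
      then show ?thesis
        using that \<open>P = PW a\<close> bij_betw_imp_inj_on[OF V] by (auto dest: inj_onD)
    next
      case (PE p)
      then have "E p \<in> IE" "V a \<in> IV" using that \<open>P = PW a\<close> EI VI by auto
      then show ?thesis using \<open>P = PW a\<close> PE unfolding IE_def by auto
    qed (use that in simp)
  qed (use that in simp)
  have "op_invariant G (?PS P) \<and> ?PS P \<subseteq> W" if "?v P" for P
    using PS[OF that] irr(1,2)[of "?PS P"] E0_invariant E0_W by (auto simp: op_irreducible_def)
  moreover have "B x y = 0" if v: "?v P" "?v Q" "P \<noteq> Q" and xy: "x \<in> ?PS P" "y \<in> ?PS Q" for P Q x y
  proof -
    consider "P = P0" "?PS Q \<in> I" | "Q = P0" "?PS P \<in> I" | "P \<noteq> P0" "Q \<noteq> P0" "?PS P \<in> I" "?PS Q \<in> I"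
      using PS[OF v(1)] PS[OF v(2)] v(3) by blast
    then show ?thesis
    proof cases
      case 1
      then show ?thesis using xy IE0(1)[OF 1(2)] by simp
    next
      case 2
      then show ?thesis using xy IE0(2)[OF 2(2)] by simp
    next
      case 3
      then show ?thesis using inj[OF v 3(1,2)] I(3) xy by blast
    qed
  qed
  moreover have "W \<subseteq> span (\<Union>{?PS P | P. ?v P})"
  proof -
    have "\<exists>P. ?v P \<and> U = ?PS P" if "U \<in> I" for U
    proof (cases "U \<in> IV")
      case True
      then obtain a where "a < card IV" "U = V a" using V by (auto simp: bij_betw_def)
      then show ?thesis by (intro exI[of _ "PW a"]) simp
    next
      case False
      then have "U \<in> IE" using that by (simp add: IE_def)
      then obtain p where "p < card IE" "U = E p" using E by (auto simp: bij_betw_def)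
      then show ?thesis by (intro exI[of _ "PE p"]) simp
    qed
    moreover have "?v P0 \<and> E0 = ?PS P0" by simp
    ultimately have "\<Union>I \<union> E0 \<subseteq> \<Union>{?PS P | P. ?v P}" by blast
    then show ?thesis using I(4) span_mono by blast
  qed
  moreover have "\<exists>b kappa. simple_data (V a) b kappa" if "a < card IV" for a
    using VI[OF that] unfolding IV_def by blast
  moreover have "\<exists>H eta zeta. plane_data (E p) H eta zeta" if "p < card IE" for p
  proof -
    have "E p \<in> I" "\<not> (\<exists>b kappa. simple_data (E p) b kappa)"
      using EI[OF that] unfolding IE_def IV_def by auto
    then show ?thesis using irreducible_classification[OF irr(2,1,3)] by blast
  qed
  ultimately show ?thesis by (intro exI[of _ "card IE"] exI[of _ "card IV"] exI[of _ E] exI[of _ V]) blast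
qed

section \<open>The tensor \<open>K\<close> and its span\<close>

definition K :: "nat \<Rightarrow> nat \<Rightarrow> nat \<Rightarrow> 'v" where "K i j k = pr (T (u i) (u j) (u k))"

text \<open>Both normalisations of the frame meet here: \<open>K_central\<close> disposes of the
  brackets, \<open>JK_central\<close> of the \<open>J\<close>.\<close>

lemma K_E0: "i < r \<Longrightarrow> j < r \<Longrightarrow> k < r \<Longrightarrow> K i j k \<in> E0"
proof (rule E0_I)
  assume ijk: "i < r" "j < r" "k < r"
  show "K i j k \<in> W" unfolding K_def by (rule pr_W)
  show "br l y (K i j k) = 0" if "l < r" "y \<in> W" for l y
    unfolding br_def K_def pr_T[OF T_Q]
    by (rule pr_zero[OF centraliser_D(2)[OF K_central[OF Jc ijk] that(1) W_Q[OF that(2)]]])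
  show "J l m (K i j k) = 0" if "l < r" "m < r" for l m
    unfolding J_def K_def pr_T[OF T_Q]
    using JKc that ijk by (intro pr_zero) (auto simp: JK_central_def)
qed

lemma K_skew: "skew3 r K"
  unfolding skew3_def K_def
  by (intro allI impI conjI, subst T_swap12, simp add: pr_simps, subst T_swap23, simp add: pr_simps)

lemma K_swap: "K i j k = - K j i k" "K i j k = - K i k j"
  unfolding K_def by (subst T_swap12, simp add: pr_simps, subst T_swap23, simp add: pr_simps)

text \<open>The fundamental identity for five frame vectors, paired with a sixth,
  \<open>u n\<close>; metricity moves one bracket across the form in every term.\<close>

lemma K_relation:
  "B (K i j n) (K k l m) + B (K i j l) (K m n k) - B (K i j m) (K n k l) - B (K i j k) (K l m n) = 0"
proof -
  let ?K = "\<lambda>i j k. T (u i) (u j) (u k)"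
  have KB: "B (K i j k) (K a b c) = B (?K i j k) (?K a b c)" for i j k a b c
    unfolding K_def by (simp add: pr_B T_Q W_Q[OF pr_W])
  have "- B (?K k l m) (?K i j n) = B (T (u i) (u j) (?K k l m)) (u n)"
    by (simp add: metric)
  also have "\<dots> = B (T (u l) (u m) (?K i j k)) (u n) + B (T (u m) (u k) (?K i j l)) (u n)
      + B (T (u k) (u l) (?K i j m)) (u n)"
    unfolding FI[of "u i" "u j" "u k" "u l" "u m"]
    by (simp add: T_cyc[of "?K i j k"] T_cyc[of "u m" "u k"])
  also have "\<dots> = - B (?K i j k) (?K l m n) - B (?K i j l) (?K m k n) - B (?K i j m) (?K k l n)"
    by (simp add: metric)
  finally show ?thesis
    unfolding KB using sym[of "?K k l m" "?K i j n"] T_swap23[of "u m" "u k" "u n"]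
      T_cyc[of "u n" "u k" "u l"] by simp
qed

text \<open>The only possible components of brackets with \<open>x\<close> are its products with the
  \<open>K i j k\<close>, so \<open>x\<close> is central and spans a positive definite
  ideal.\<close>

lemma E0_nondegenerate:
  assumes x: "x \<in> E0" and Kx: "\<And>i j k. i < r \<Longrightarrow> j < r \<Longrightarrow> k < r \<Longrightarrow> B (K i j k) x = 0"
  shows "x = 0"
proof -
  have xW: "x \<in> W" using x by (rule E0_W)
  have uux: "T (u i) (u j) x = 0" if "i < r" "j < r" for i j
    using T_uuW[OF xW, of i j] E0_D(3)[OF x that] Kx[OF that] by (simp add: K_def)
  have uxq: "T (u i) x q = 0" if "i < r" "q \<in> Q" for i q
  proof -
    have "B x (J i j (pr q)) = 0" if "j < r" for j
      using J_skew[OF xW pr_W, of i j q] E0_D(3)[OF x \<open>i < r\<close> that] by simp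
    then have "T (u i) x (pr q) = 0"
      using T_uWW[OF xW pr_W, of i q] E0_D(2)[OF x that(1) pr_W] by simp
    then show ?thesis using pr_T[OF that(2)] by simp
  qed
  have xqq: "T x q q' = 0" if "q \<in> Q" "q' \<in> Q" for q q'
  proof -
    have "T x (pr q) (pr q') = 0"
      unfolding T_WWW[OF xW pr_W pr_W] using E0_D(2)[OF x _ pr_W] by simp
    then show ?thesis using pr_T[OF that(2)] pr_T2[OF that(1)] by simp
  qed
  have ex: "\<exists>q\<in>Q. y = q + (\<Sum>i<r. B (v i) y *\<^sub>R u i)" for y
  proof -
    have "pr y + (\<Sum>i<r. B (u i) y *\<^sub>R v i) \<in> Q"
      using W_Q[OF pr_W] Z_Q dual_frame_v[OF dual] by (auto intro!: Q_closed)
    then show ?thesis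
      by (intro bexI[of _ "pr y + (\<Sum>i<r. B (u i) y *\<^sub>R v i)"]) (simp_all add: pr_def frame_proj_def)
  qed
  have xuq: "T x (\<Sum>i<r. c i *\<^sub>R u i) q = 0" if "q \<in> Q" for q c
    using uxq[OF _ that] by (simp add: T_sum T_swap12[of x "u _"])
  have xqu: "T x q (\<Sum>i<r. c i *\<^sub>R u i) = 0" if "q \<in> Q" for q c
    using uxq[OF _ that] by (simp add: T_sum T_cyc[of "u _" x q, symmetric])
  have xuu: "T x (\<Sum>i<r. c i *\<^sub>R u i) (\<Sum>i<r. d i *\<^sub>R u i) = 0" for c d
    using uux by (simp add: T_sum T_cyc[of x "u _" "u _"])
  have central: "T x y z = 0" for y z
  proof -
    obtain q where q: "q \<in> Q" "y = q + (\<Sum>i<r. B (v i) y *\<^sub>R u i)"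
      using ex[of y] by (elim bexE)
    obtain q' where q': "q' \<in> Q" "z = q' + (\<Sum>i<r. B (v i) z *\<^sub>R u i)"
      using ex[of z] by (elim bexE)
    show ?thesis
      by (subst q(2), subst q'(2)) (simp add: xqq q(1) q'(1) xuq xqu xuu)
  qed
  have "span {x} = {0}"
  proof (rule positive_ideal_trivial[OF indec])
    show "subspace (span {x})" by simp
    show "is_ideal3 T (span {x})"
      by (auto simp: is_ideal3_def span_singleton central)
    \<comment> \<open>The line through \<open>x\<close> is orthogonal to \<open>u 0\<close>, whereas
      \<open>v 0\<close> is not; this uses \<open>r > 0\<close>.\<close>
    show "span {x} \<noteq> UNIV"
    proof
      assume "span {x} = UNIV"
      then obtain k where "v 0 = k *\<^sub>R x" by (auto simp: span_singleton)
      then show False using frame_uv[OF dual iso rpos rpos] W_perp(1)[OF xW rpos] by simp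
    qed
    fix y assume "y \<in> span {x}" "y \<noteq> 0"
    then show "B y y > 0" using W_pos W_closed(3)[OF xW] by (auto simp: span_singleton)
  qed
  then show ?thesis using span_base[of x "{x}"] by simp
qed

text \<open>The \<open>K i j k\<close> with \<open>i < j < k\<close> span \<open>E0\<close>: by
  skewness what is orthogonal to them is orthogonal to all the \<open>K\<close>, hence zero. The
  triples inject into the 3-element sets of indices.\<close>

lemma E0_dim: "dim E0 \<le> r choose 3"
proof -
  define t where "t = {(i, j, k). i < j \<and> j < k \<and> k < r}"
  define S where "S = (\<lambda>(i, j, k). K i j k) ` t"
  have "t \<subseteq> {..<r} \<times> {..<r} \<times> {..<r}" by (auto simp: t_def)
  then have ft: "finite t" by (rule finite_subset) simp
  let ?s = "\<lambda>(i, j, k). set [i, j, k]" and ?A = "{A. A \<subseteq> {..<r} \<and> card A = 3}"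
  have "inj_on ?s t"
  proof (rule inj_onI)
    fix p p' assume p: "p \<in> t" "p' \<in> t" "?s p = ?s p'"
    obtain i j k i' j' k' where e: "p = (i, j, k)" "p' = (i', j', k')" by (metis prod_cases3)
    have a: "(i, j, k) \<in> t" "(i', j', k') \<in> t" "set [i, j, k] = set [i', j', k']"
      using p unfolding e by simp_all
    have "[i, j, k] = sorted_list_of_set (set [i, j, k])"
      using a(1) by (intro sorted_list_of_set.idem_if_sorted_distinct[symmetric]) (auto simp: t_def)
    also have "\<dots> = sorted_list_of_set (set [i', j', k'])" using a(3) by simp
    also have "\<dots> = [i', j', k']"
      using a(2) by (intro sorted_list_of_set.idem_if_sorted_distinct) (auto simp: t_def)
    finally show "p = p'" by (simp add: e)
  qed
  moreover have "?s ` t \<subseteq> ?A" by (auto simp: t_def)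
  moreover have "finite ?A" by (rule finite_subset[of _ "Pow {..<r}"]) auto
  ultimately have "card t \<le> card ?A" by (rule card_inj_on_le)
  then have ct: "card t \<le> r choose 3" using n_subsets[of "{..<r}" 3] by simp
  have SE0: "S \<subseteq> E0" using K_E0 by (auto simp: S_def t_def)
  have sE0: "subspace E0" using E0_invariant by (simp add: op_invariant_def)
  have "x \<in> span S" if x: "x \<in> E0" for x
  proof -
    have sp: "span S \<subseteq> E0" by (rule span_minimal[OF SE0 sE0])
    obtain a where a: "a \<in> span S" "\<And>b. b \<in> span S \<Longrightarrow> B b (x - a) = 0"
      using orthogonal_split[OF fin subspace_span, of S x] W_pos E0_W sp by blast
    define g where "g i j k = B (K i j k) (x - a)" for i j k
    have g1: "g i j k = - g j i k" and g2: "g i j k = - g i k j" for i j k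
      unfolding g_def using K_swap[of i j k] by simp_all
    have g0: "g i j k = 0" if "i < j" "j < k" "k < r" for i j k
    proof -
      have "K i j k \<in> S"
        unfolding S_def by (rule image_eqI[of _ _ "(i, j, k)"]) (use that in \<open>simp_all add: t_def\<close>)
      then show ?thesis unfolding g_def by (intro a(2) span_base)
    qed
    have "g i j k = 0" if "i < r" "j < r" "k < r" for i j k
    proof -
      consider "i = j" | "j = k" | "i = k" | "i < j" "j < k" | "i < k" "k < j" | "j < i" "i < k"
        | "j < k" "k < i" | "k < i" "i < j" | "k < j" "j < i" by linarith
      then show ?thesis
      proof cases
        case 1 then show ?thesis using g1[of i j k] by simp
      next
        case 2 then show ?thesis using g2[of i j k] by simp
      next
        case 3 then show ?thesis using g1[of i j k] g2[of j i k] g1[of j k i] by simp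
      next
        case 4 then show ?thesis using g0 that by simp
      next
        case 5 then show ?thesis using g2[of i j k] g0[of i k j] that by simp
      next
        case 6 then show ?thesis using g1[of i j k] g0[of j i k] that by simp
      next
        case 7 then show ?thesis using g1[of i j k] g2[of j i k] g0[of j k i] that by simp
      next
        case 8 then show ?thesis using g2[of i j k] g1[of i k j] g0[of k i j] that by simp
      next
        case 9 then show ?thesis
          using g1[of i j k] g2[of j i k] g1[of j k i] g0[of k j i] that by simp
      qed
    qed
    then have "x - a = 0"
      using a(1) sp x subspace_diff[OF sE0] unfolding g_def by (intro E0_nondegenerate) auto
    then show ?thesis using a(1) by simp
  qed
  then have "dim E0 \<le> card S"
    using ft by (intro dim_le_card) (auto simp: S_def)
  also have "\<dots> \<le> card t" unfolding S_def by (rule card_image_le[OF ft])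
  also have "\<dots> \<le> r choose 3" by (rule ct)
  finally show ?thesis .
qed

end

text \<open>The null vectors \<open>u i\<close>, \<open>v i\<close> are traded for
  \<open>u i + v i\<close> and \<open>u i - v i\<close>, of square 2 and -2. With orthonormal bases
  of the pieces they form an orthogonal basis without null vectors, which can be counted.\<close>

lemma (in normal_frame) dim_pieces:
  assumes piece: "\<And>P. valid_piece m n P \<Longrightarrow> op_invariant G (piece_set E0 E V P) \<and> piece_set E0 E V P \<subseteq> W"
    and orth: "\<And>P Q x y. valid_piece m n P \<Longrightarrow> valid_piece m n Q \<Longrightarrow> P \<noteq> Q \<Longrightarrow>
      x \<in> piece_set E0 E V P \<Longrightarrow> y \<in> piece_set E0 E V Q \<Longrightarrow> B x y = 0"
    and span: "W \<subseteq> span (\<Union>{piece_set E0 E V P | P. valid_piece m n P})"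
    and dim2: "\<And>p. p < m \<Longrightarrow> dim (E p) = 2"
  shows "span (u ` {..<r} \<union> v ` {..<r} \<union> \<Union>{piece_set E0 E V P | P. valid_piece m n P}) = UNIV"
    and "dim (UNIV :: 'v set) = 2 * r + 2 * m + (\<Sum>a<n. dim (V a)) + dim E0"
proof -
  let ?PS = "piece_set E0 E V" and ?v = "valid_piece m n"
  let ?S = "u ` {..<r} \<union> v ` {..<r} \<union> \<Union>{?PS P | P. ?v P}"
  have all: "x \<in> span S" if "u ` {..<r} \<subseteq> span S" "v ` {..<r} \<subseteq> span S" "W \<subseteq> span S" for S x
  proof -
    have "pr x + (\<Sum>i<r. B (u i) x *\<^sub>R v i) + (\<Sum>i<r. B (v i) x *\<^sub>R u i) \<in> span S"
      using that pr_W by (intro span_add span_sum span_scale) auto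
    then show ?thesis by (simp add: pr_def frame_proj_def)
  qed
  have "W \<subseteq> span ?S" using span span_mono[of "\<Union>{?PS P | P. ?v P}" ?S] by blast
  then show "span ?S = UNIV" using all[of ?S] span_superset[of ?S] by auto
  have "\<exists>F. finite F \<and> orthonormal F \<and> span F = ?PS P" if "?v P" for P
  proof -
    have "subspace (?PS P)" using piece[OF that] by (simp add: op_invariant_def)
    then obtain F where F: "finite F" "span F = ?PS P"
      using fin_dim_subspace_finite[OF fin] by blast
    then show ?thesis
      using gram_schmidt[OF F(1)] W_pos piece[OF that] by (metis subsetD)
  qed
  then obtain F where F: "\<And>P. ?v P \<Longrightarrow> finite (F P) \<and> orthonormal (F P) \<and> span (F P) = ?PS P"
    by metis
  have F_PS: "x \<in> ?PS P" if "?v P" "x \<in> F P" for P x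
    using F[OF that(1)] span_base[OF that(2)] by simp
  then have F_W: "x \<in> W" if "?v P" "x \<in> F P" for P x
    using piece that by blast
  have cardF: "card (F P) = dim (?PS P)" if "?v P" for P
    using F[OF that] orthonormal_independent dim_span_eq_card_independent by metis
  have vP: "{P. ?v P} = insert P0 (PE ` {..<m} \<union> PW ` {..<n})"
  proof (intro set_eqI iffI)
    fix P assume "P \<in> {P. ?v P}"
    then show "P \<in> insert P0 (PE ` {..<m} \<union> PW ` {..<n})" by (cases P) auto
  qed auto
  then have fv: "finite {P. ?v P}" by simp
  define I where "I = {..<r} <+> ({..<r} <+> (SIGMA P:{P. ?v P}. F P))"
  define f :: "nat + nat + piece \<times> 'v \<Rightarrow> 'v"
    where "f = case_sum (\<lambda>i. u i + v i) (case_sum (\<lambda>i. u i - v i) snd)"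
  note fr = frame_uv[OF dual iso] frame_vu[OF dual iso] frame_uu[OF dual iso] frame_vv[OF dual iso]
  have perp: "B (u i) x = 0" "B (v i) x = 0" "B x (u i) = 0" "B x (v i) = 0"
    if "i < r" "?v P" "x \<in> F P" for i x P
    using W_perp[OF F_W[OF that(2,3)] that(1)] by (simp_all add: sym[of x])
  have on: "B x y = (if x = y then 1 else 0)" if "?v P" "x \<in> F P" "y \<in> F P" for P x y
    using F[OF that(1)] that(2,3) by (auto simp: orthonormal_def)
  have FF: "B x y = 0" if "?v P" "?v Q" "x \<in> F P" "y \<in> F Q" "P \<noteq> Q" for P Q x y
    using orth[OF that(1,2,5)] F_PS that by blast
  have FF2: "B x y = 0" if "?v P" "?v Q" "x \<in> F P" "y \<in> F Q" "x \<noteq> y" for P Q x y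
    using FF[of P Q x y] on[of P x y] that by (cases "P = Q") auto
  have fI: "finite I"
    unfolding I_def using fv F by (intro finite_Plus finite_SigmaI) auto
  have "dim (span (f ` I)) = card I"
  proof (rule orthogonal_family_dim[OF fI])
    show "B (f a) (f b) = 0" if "a \<in> I" "b \<in> I" "a \<noteq> b" for a b
      using that unfolding I_def f_def
      by (elim PlusE SigmaE) (auto simp: fr perp intro: FF FF2)
    show "B (f a) (f a) \<noteq> 0" if "a \<in> I" for a
      using that unfolding I_def f_def
      by (elim PlusE SigmaE) (auto simp: fr on)
  qed
  moreover have "span (f ` I) = UNIV"
  proof -
    have p: "u i + v i \<in> span (f ` I)" if "i < r" for i
      by (rule span_base, rule image_eqI[of _ _ "Inl i"]) (use that in \<open>auto simp: f_def I_def\<close>)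
    have mi: "u i - v i \<in> span (f ` I)" if "i < r" for i
      by (rule span_base, rule image_eqI[of _ _ "Inr (Inl i)"]) (use that in \<open>auto simp: f_def I_def\<close>)
    have "(1/2) *\<^sub>R ((u i + v i) + (u i - v i)) \<in> span (f ` I)"
      "(1/2) *\<^sub>R ((u i + v i) - (u i - v i)) \<in> span (f ` I)" if "i < r" for i
      by (rule span_scale[OF span_add[OF p[OF that] mi[OF that]]]
          span_scale[OF span_diff[OF p[OF that] mi[OF that]]])+
    moreover have "(1/2) *\<^sub>R ((u i + v i) + (u i - v i)) = u i"
      "(1/2) *\<^sub>R ((u i + v i) - (u i - v i)) = v i" for i
      by (simp_all flip: scaleR_2)
    ultimately have uv: "u ` {..<r} \<subseteq> span (f ` I)" "v ` {..<r} \<subseteq> span (f ` I)" by auto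
    have F1: "F P \<subseteq> f ` I" if "?v P" for P
    proof
      fix x assume "x \<in> F P"
      then show "x \<in> f ` I"
        by (intro image_eqI[of _ _ "Inr (Inr (P, x))"]) (use that in \<open>auto simp: f_def I_def\<close>)
    qed
    have "?PS P \<subseteq> span (f ` I)" if "?v P" for P
      using span_mono[OF F1[OF that]] F[OF that] by simp
    then have "\<Union>{?PS P | P. ?v P} \<subseteq> span (f ` I)" by blast
    then have "W \<subseteq> span (f ` I)" using span span_minimal subspace_span by blast
    then show ?thesis using all[OF uv] by auto
  qed
  ultimately have "dim (UNIV :: 'v set) = card I" by simp
  also have "\<dots> = 2 * r + (\<Sum>P\<in>{P. ?v P}. card (F P))"
  proof -
    have "finite (SIGMA P:{P. ?v P}. F P)" using fv F by (intro finite_SigmaI) auto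
    moreover have "card (SIGMA P:{P. ?v P}. F P) = (\<Sum>P\<in>{P. ?v P}. card (F P))"
      using fv F by (intro card_SigmaI) auto
    ultimately show ?thesis unfolding I_def by (simp add: card_Plus)
  qed
  also have "(\<Sum>P\<in>{P. ?v P}. card (F P)) = (\<Sum>P\<in>{P. ?v P}. dim (?PS P))"
    using cardF by simp
  also have "\<dots> = dim E0 + ((\<Sum>P\<in>PE ` {..<m}. dim (?PS P)) + (\<Sum>P\<in>PW ` {..<n}. dim (?PS P)))"
    unfolding vP by (subst sum.insert, simp, force, subst sum.union_disjoint) auto
  also have "(\<Sum>P\<in>PE ` {..<m}. dim (?PS P)) = 2 * m"
    by (subst sum.reindex) (auto simp: inj_on_def dim2)
  also have "(\<Sum>P\<in>PW ` {..<n}. dim (?PS P)) = (\<Sum>a<n. dim (V a))"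
    by (subst sum.reindex) (auto simp: inj_on_def)
  finally show "dim (UNIV :: 'v set) = 2 * r + 2 * m + (\<Sum>a<n. dim (V a)) + dim E0" by simp
qed

text \<open>Any isotropic dual frame serves: its complement is positive definite and represents
  \<open>Q\<close> modulo \<open>Z\<close>. Only the basis is kept; the normalised frame is chosen
  afterwards.\<close>

lemma (in max_isotropic) ex_basis: "\<exists>N. max_isotropic_basis B T r Z N"
proof -
  obtain u0 v where "dual_frame u0 v" using ex_dual_frame by blast
  then obtain u where f: "dual_frame u v" "isotropic_frame u" using dual_frame_isotropic by blast
  let ?W = "frame_compl u v"
  obtain F where F: "finite F" "span F = ?W"
    using fin_dim_subspace_finite[OF fin frame_compl_subspace] by blast
  obtain N where N: "finite N" "orthonormal N" "span N = ?W"
    using gram_schmidt[OF F(1)] frame_compl_pos[OF f] F(2) by metis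
  have NW: "c \<in> ?W" if "c \<in> N" for c using N(3) span_base[OF that] by simp
  have "x - (\<Sum>c\<in>N. B x c *\<^sub>R c) \<in> Z" if x: "x \<in> Q" for x
  proof -
    let ?p = "frame_proj u v x"
    have "?p = (\<Sum>c\<in>N. B ?p c *\<^sub>R c)"
      by (rule orthonormal_expansion[OF N(2,1)]) (simp add: N(3) frame_proj_compl[OF f])
    also have "\<dots> = (\<Sum>c\<in>N. B x c *\<^sub>R c)"
    proof (rule sum.cong[OF refl])
      fix c assume "c \<in> N"
      then have "B (x - ?p) c = 0"
        using B_Z_Q(1)[OF frame_proj_diff[OF f x]] frame_compl_Q[OF f NW] by blast
      then show "B ?p c *\<^sub>R c = B x c *\<^sub>R c" by simp
    qed
    finally show ?thesis using frame_proj_diff[OF f x] by simp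
  qed
  moreover have "N \<subseteq> Q" using NW frame_compl_Q[OF f] by blast
  ultimately have "max_isotropic_basis B T r Z N"
    using N(1,2) by unfold_locales
  then show ?thesis by blast
qed

theorem mainTheorem6:
  fixes B :: "'v::real_vector \<Rightarrow> 'v \<Rightarrow> real"
    and T :: "'v \<Rightarrow> 'v \<Rightarrow> 'v \<Rightarrow> 'v"
    and r :: nat and Z :: "'v set"
  assumes fin: "fin_dim_space TYPE('v)"
    and m3L: "metric_3Lie B T"
    and indec: "indecomposable3 B T"
    and idx: "has_index B r"
    and rpos: "r > 0"
    and cent: "max_isotropic_centre B T r Z"
  shows "\<exists>(u::nat \<Rightarrow> 'v) (v::nat \<Rightarrow> 'v) (M::nat) (N::nat)
          (E :: nat \<Rightarrow> 'v set) (W :: nat \<Rightarrow> 'v set) (E0 :: 'v set)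
          (eta :: nat \<Rightarrow> nat \<Rightarrow> real) (zeta :: nat \<Rightarrow> nat \<Rightarrow> real)
          (kappa :: nat \<Rightarrow> nat \<Rightarrow> real) (br :: nat \<Rightarrow> 'v \<Rightarrow> 'v \<Rightarrow> 'v)
          (L :: nat \<Rightarrow> nat \<Rightarrow> nat \<Rightarrow> nat \<Rightarrow> real) (K :: nat \<Rightarrow> nat \<Rightarrow> nat \<Rightarrow> 'v)
          (H :: nat \<Rightarrow> 'v \<Rightarrow> 'v).
     let J = (\<lambda>p i j. eta p i * zeta p j - eta p j * zeta p i);
         PS = piece_set E0 E W
     in
     \<comment> \<open>the orthogonal vector space decomposition\<close>
     (\<forall>i<r. \<forall>j<r. B (u i) (u j) = 0 \<and> B (v i) (v j) = 0 \<and>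
                   B (u i) (v j) = (if i = j then 1 else 0)) \<and>
     pos_definite B E0 \<and>
     (\<forall>p<M. pos_definite B (E p) \<and> dim (E p) = 2) \<and>
     (\<forall>a<N. pos_definite B (W a)) \<and>
     (\<forall>P Q. valid_piece M N P \<and> valid_piece M N Q \<and> P \<noteq> Q \<longrightarrow>
        (\<forall>x\<in>PS P. \<forall>y\<in>PS Q. B x y = 0)) \<and>
     (\<forall>P. valid_piece M N P \<longrightarrow> (\<forall>i<r. \<forall>x\<in>PS P. B (u i) x = 0 \<and> B (v i) x = 0)) \<and>
     span ((u ` {..<r}) \<union> (v ` {..<r}) \<union> \<Union>{PS P | P. valid_piece M N P}) = UNIV \<and>
     dim (UNIV :: 'v set) = 2 * r + 2 * M + (\<Sum>a<N. dim (W a)) + dim E0 \<and>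
     \<comment> \<open>the data\<close>
     (\<forall>p<M. \<exists>i<r. \<exists>j<r. J p i j \<noteq> 0) \<and>
     (\<forall>a<N. \<exists>i<r. kappa a i \<noteq> 0) \<and>
     (\<forall>a<N. metric_simple_Lie_on B (W a) (br a)) \<and>
     skew4 r L \<and>
     skew3 r K \<and> (\<forall>i<r. \<forall>j<r. \<forall>k<r. K i j k \<in> E0) \<and>
     (\<forall>i<r. \<forall>j<r. \<forall>k<r. \<forall>l<r. \<forall>m<r. \<forall>n<r.
        B (K i j n) (K k l m) + B (K i j l) (K m n k) - B (K i j m) (K n k l)
          - B (K i j k) (K l m n) = 0) \<and>
     (\<forall>p<M. complex_structure_on B (E p) (H p)) \<and>
     \<comment> \<open>the nonvanishing 3-brackets\<close>
     (\<forall>i<r. \<forall>j<r. \<forall>k<r. T (u i) (u j) (u k) = K i j k + (\<Sum>l<r. L i j k l *\<^sub>R v l)) \<and>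
     (\<forall>i<r. \<forall>j<r. \<forall>x\<in>E0. T (u i) (u j) x = - (\<Sum>k<r. B (K i j k) x *\<^sub>R v k)) \<and>
     (\<forall>p<M. \<forall>i<r. \<forall>j<r. \<forall>x\<in>E p. T (u i) (u j) x = J p i j *\<^sub>R H p x) \<and>
     (\<forall>p<M. \<forall>i<r. \<forall>x\<in>E p. \<forall>y\<in>E p.
        T (u i) x y = - (\<Sum>j<r. B x (J p i j *\<^sub>R H p y) *\<^sub>R v j)) \<and>
     (\<forall>a<N. \<forall>i<r. \<forall>x\<in>W a. \<forall>y\<in>W a. T (u i) x y = kappa a i *\<^sub>R br a x y) \<and>
     (\<forall>a<N. \<forall>x\<in>W a. \<forall>y\<in>W a. \<forall>z\<in>W a.
        T x y z = - (B (br a x y) z *\<^sub>R (\<Sum>i<r. kappa a i *\<^sub>R v i))) \<and>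
     \<comment> \<open>all other 3-brackets between the summands vanish\<close>
     (\<forall>i<r. \<forall>x y. T (v i) x y = 0) \<and>
     (\<forall>a<N. \<forall>i<r. \<forall>j<r. \<forall>x\<in>W a. T (u i) (u j) x = 0) \<and>
     (\<forall>P Q. valid_piece M N P \<and> valid_piece M N Q \<and> (P \<noteq> Q \<or> P = P0) \<longrightarrow>
        (\<forall>i<r. \<forall>x\<in>PS P. \<forall>y\<in>PS Q. T (u i) x y = 0)) \<and>
     (\<forall>P Q R. valid_piece M N P \<and> valid_piece M N Q \<and> valid_piece M N R \<and>
        \<not> (\<exists>a. P = PW a \<and> Q = PW a \<and> R = PW a) \<longrightarrow>
        (\<forall>x\<in>PS P. \<forall>y\<in>PS Q. \<forall>z\<in>PS R. T x y z = 0)) \<and>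
     \<comment> \<open>indecomposability condition on E0, and the resulting dimension bound\<close>
     (\<forall>x\<in>E0. (\<forall>i<r. \<forall>j<r. \<forall>k<r. B (K i j k) x = 0) \<longrightarrow> x = 0) \<and>
     dim E0 \<le> r choose 3"
proof -
  interpret max_isotropic B T r Z
    using fin m3L idx cent by unfold_locales
  obtain N where "max_isotropic_basis B T r Z N" using ex_basis by blast
  then interpret max_isotropic_basis B T r Z N .
  interpret normalisable B T r Z N
    using indec rpos by unfold_locales
  obtain u v where "dual_frame u v" "isotropic_frame u" "J_central u" "JK_central u"
    using ex_normal_frame by blast
  then interpret normal_frame B T r Z N u v by unfold_locales
  obtain m n E V where piece: "\<forall>P. valid_piece m n P \<longrightarrow>
        op_invariant G (piece_set E0 E V P) \<and> piece_set E0 E V P \<subseteq> W"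
    and orth: "\<forall>P Q. valid_piece m n P \<and> valid_piece m n Q \<and> P \<noteq> Q \<longrightarrow>
      (\<forall>x\<in>piece_set E0 E V P. \<forall>y\<in>piece_set E0 E V Q. B x y = 0)"
    and span: "W \<subseteq> span (\<Union>{piece_set E0 E V P | P. valid_piece m n P})"
    and V: "\<forall>a<n. \<exists>b kappa. simple_data (V a) b kappa"
    and E: "\<forall>p<m. \<exists>H eta zeta. plane_data (E p) H eta zeta"
    using ex_pieces by (elim exE conjE) (rule that, assumption+)
  obtain b kappa where V: "\<And>a. a < n \<Longrightarrow> simple_data (V a) (b a) (kappa a)"
    using V by metis
  note V = V[unfolded simple_data_def]
  obtain H eta zeta where E: "\<And>p. p < m \<Longrightarrow> plane_data (E p) (H p) (eta p) (zeta p)"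
    using E by metis
  note E = E[unfolded plane_data_def]
  let ?PS = "piece_set E0 E V" and ?v = "valid_piece m n"
  \<comment> \<open>These are the coefficients called \<open>J\<close> in the statement; in the
    locale that name denotes the operators.\<close>
  define h where "h p i j = eta p i * zeta p j - eta p j * zeta p i" for p i j
  define L where "L i j k l = B (T (u i) (u j) (u k)) (u l)" for i j k l
  note fr = frame_uv[OF dual iso] frame_vu[OF dual iso] frame_uu[OF dual iso] frame_vv[OF dual iso]
  have PW: "x \<in> W" if "?v P" "x \<in> ?PS P" for P x using piece that by blast
  have E0W: "x \<in> W" if "x \<in> E0" for x using E0_W that .
  have EW: "x \<in> W" if "p < m" "x \<in> E p" for p x using PW[of "PE p"] that by simp
  have VW: "x \<in> W" if "a < n" "x \<in> V a" for a x using PW[of "PW a"] that by simp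
  have o: "B x y = 0" if "?v P" "?v Q" "P \<noteq> Q" "x \<in> ?PS P" "y \<in> ?PS Q" for P Q x y
    using orth that by blast
  have pos: "pos_definite B (?PS P)" if "?v P" for P
    using piece that W_pos PW unfolding pos_definite_def op_invariant_def by blast
  have E0E: "B x y = 0" if "x \<in> E0" "p < m" "y \<in> E p" for x y p
    using o[of P0 "PE p" x y] that by simp
  have E0V: "B x y = 0" if "x \<in> E0" "a < n" "y \<in> V a" for x y a
    using o[of P0 "PW a" x y] that by simp
  have Eb: "br i x y = 0" if "p < m" "i < r" "x \<in> E p" "y \<in> W" for p i x y
    using E[OF that(1)] that(2-4) by blast
  have EJ: "J i j x = h p i j *\<^sub>R H p x" if "p < m" "i < r" "j < r" "x \<in> E p" for p i j x
    using E[OF that(1)] that(2-4) unfolding h_def by blast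
  have Vb: "br i x y = kappa a i *\<^sub>R b a x y" if "a < n" "i < r" "x \<in> V a" "y \<in> W" for a i x y
    using V[OF that(1)] that(2-4) by blast
  have VJ: "J i j x = 0" if "a < n" "i < r" "j < r" "x \<in> V a" for a i j x
    using V[OF that(1)] that(2-4) by blast
  have brPQ: "br i x y = 0" if "?v P" "?v Q" "P \<noteq> Q" "x \<in> ?PS P" "y \<in> ?PS Q" "i < r" for P Q i x y
  proof (rule br_orthogonal[of "?PS P" "?PS Q"])
    show "B x y = 0" if "x \<in> ?PS P" "y \<in> ?PS Q" for x y
      by (rule o[OF \<open>?v P\<close> \<open>?v Q\<close> \<open>P \<noteq> Q\<close> that])
  qed (use piece that in blast)+
  have JP: "J i j x \<in> ?PS P" if "?v P" "x \<in> ?PS P" "i < r" "j < r" for P i j x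
    using invariantD(3)[of "?PS P"] piece that by blast
  have brP: "br i x y \<in> ?PS P" if "?v P" "x \<in> ?PS P" "i < r" "y \<in> W" for P i x y
    using invariantD(2)[of "?PS P"] piece that by blast
  show ?thesis
    unfolding Let_def h_def[symmetric]
  proof (rule exI[of _ u], rule exI[of _ v], rule exI[of _ m], rule exI[of _ n], rule exI[of _ E],
      rule exI[of _ V], rule exI[of _ E0], rule exI[of _ eta], rule exI[of _ zeta],
      rule exI[of _ kappa], rule exI[of _ b], rule exI[of _ L], rule exI[of _ K], rule exI[of _ H],
      unfold h_def[symmetric], intro conjI)
    show "\<forall>i<r. \<forall>j<r. B (u i) (u j) = 0 \<and> B (v i) (v j) = 0 \<and>
        B (u i) (v j) = (if i = j then 1 else 0)"
      by (simp add: fr)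
    show "pos_definite B E0" using pos[of P0] by simp
    show "\<forall>p<m. pos_definite B (E p) \<and> dim (E p) = 2" using pos[of "PE _"] E by simp
    show "\<forall>a<n. pos_definite B (V a)" using pos[of "PW _"] by simp
    show "\<forall>P Q. ?v P \<and> ?v Q \<and> P \<noteq> Q \<longrightarrow> (\<forall>x\<in>?PS P. \<forall>y\<in>?PS Q. B x y = 0)" by (rule orth)
    show "\<forall>P. ?v P \<longrightarrow> (\<forall>i<r. \<forall>x\<in>?PS P. B (u i) x = 0 \<and> B (v i) x = 0)"
      using PW W_perp by blast
    show "span (u ` {..<r} \<union> v ` {..<r} \<union> \<Union>{?PS P | P. ?v P}) = UNIV"
      by (rule dim_pieces(1)[OF _ _ span]) (use piece o E in blast)+
    show "dim (UNIV :: 'v set) = 2 * r + 2 * m + (\<Sum>a<n. dim (V a)) + dim E0"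
      by (rule dim_pieces(2)[OF _ _ span]) (use piece o E in blast)+
    show "\<forall>p<m. \<exists>i<r. \<exists>j<r. h p i j \<noteq> 0" using E unfolding h_def by blast
    show "\<forall>a<n. \<exists>i<r. kappa a i \<noteq> 0" using V by blast
    show "\<forall>a<n. metric_simple_Lie_on B (V a) (b a)" using V by blast
    show "skew4 r L"
      unfolding skew4_def L_def
    proof (intro allI impI conjI)
      fix i j k l
      show "B (T (u i) (u j) (u k)) (u l) = - B (T (u j) (u i) (u k)) (u l)"
        by (simp add: T_swap12[of "u i" "u j"])
      show "B (T (u i) (u j) (u k)) (u l) = - B (T (u i) (u k) (u j)) (u l)"
        by (simp add: T_swap23[of "u i" "u j"])
      show "B (T (u i) (u j) (u k)) (u l) = - B (T (u i) (u j) (u l)) (u k)"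
        by (simp add: metric[of "u i" "u j" "u k"] sym[of "u k"])
    qed
    show "skew3 r K" by (rule K_skew)
    show "\<forall>i<r. \<forall>j<r. \<forall>k<r. K i j k \<in> E0" by (simp add: K_E0)
    show "\<forall>i<r. \<forall>j<r. \<forall>k<r. \<forall>l<r. \<forall>m<r. \<forall>n<r.
        B (K i j n) (K k l m) + B (K i j l) (K m n k) - B (K i j m) (K n k l)
          - B (K i j k) (K l m n) = 0" by (simp add: K_relation)
    show "\<forall>p<m. complex_structure_on B (E p) (H p)" using E by blast
    show "\<forall>i<r. \<forall>j<r. \<forall>k<r. T (u i) (u j) (u k) = K i j k + (\<Sum>l<r. L i j k l *\<^sub>R v l)"
      using pr_eq[OF T_Q] by (simp add: K_def L_def sym[of "T _ _ _"])
    show "\<forall>i<r. \<forall>j<r. \<forall>x\<in>E0. T (u i) (u j) x = - (\<Sum>k<r. B (K i j k) x *\<^sub>R v k)"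
      by (simp add: T_uuW E0W E0_D(3) K_def)
    \<comment> \<open>The components along the \<open>v k\<close> vanish because the
      \<open>K i j k\<close> lie in \<open>E0\<close>, which is orthogonal to
      \<open>E p\<close>.\<close>
    show "\<forall>p<m. \<forall>i<r. \<forall>j<r. \<forall>x\<in>E p. T (u i) (u j) x = h p i j *\<^sub>R H p x"
      by (simp add: T_uuW EW EJ E0E K_E0 flip: K_def)
    show "\<forall>p<m. \<forall>i<r. \<forall>x\<in>E p. \<forall>y\<in>E p.
        T (u i) x y = - (\<Sum>j<r. B x (h p i j *\<^sub>R H p y) *\<^sub>R v j)"
      by (simp add: T_uWW EW EJ Eb)
    show "\<forall>a<n. \<forall>i<r. \<forall>x\<in>V a. \<forall>y\<in>V a. T (u i) x y = kappa a i *\<^sub>R b a x y"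
      by (simp add: T_uWW VW VJ Vb)
    show "\<forall>a<n. \<forall>x\<in>V a. \<forall>y\<in>V a. \<forall>z\<in>V a.
        T x y z = - (B (b a x y) z *\<^sub>R (\<Sum>i<r. kappa a i *\<^sub>R v i))"
      by (simp add: T_WWW VW Vb scaleR_sum_right mult.commute)
    show "\<forall>i<r. \<forall>x y. T (v i) x y = 0"
      using Z_central1 dual_frame_v[OF dual] by blast
    show "\<forall>a<n. \<forall>i<r. \<forall>j<r. \<forall>x\<in>V a. T (u i) (u j) x = 0"
      by (simp add: T_uuW VW VJ E0V K_E0 flip: K_def)
    show "\<forall>P Q. ?v P \<and> ?v Q \<and> (P \<noteq> Q \<or> P = P0) \<longrightarrow>
        (\<forall>i<r. \<forall>x\<in>?PS P. \<forall>y\<in>?PS Q. T (u i) x y = 0)"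
    proof (intro allI impI ballI, elim conjE)
      fix P Q i x y
      assume i: "i < r" and xy: "x \<in> ?PS P" "y \<in> ?PS Q" and v: "?v P" "?v Q" and PQ: "P \<noteq> Q \<or> P = P0"
      have w: "x \<in> W" "y \<in> W" using PW v xy by blast+
      have "br i x y = 0"
      proof (cases "P = P0")
        case True
        then show ?thesis using E0_D(2)[of x i y] i xy w by simp
      next
        case False
        then show ?thesis using PQ brPQ[OF v _ xy i] by simp
      qed
      \<comment> \<open>\<open>J i j y\<close> stays in the piece of \<open>y\<close>, which is
        orthogonal to that of \<open>x\<close>; if both pieces are \<open>E0\<close>, it is
        zero.\<close>
      moreover have "B x (J i j y) = 0" if "j < r" for j
      proof (cases "P = Q")
        case False
        then show ?thesis using o[OF v False xy(1) JP[OF v(2) xy(2) i that]] by blast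
      next
        case True
        then have "J i j y = 0" using PQ xy E0_D(3)[OF _ i that] by simp
        then show ?thesis by simp
      qed
      ultimately show "T (u i) x y = 0" by (simp add: T_uWW w)
    qed
    show "\<forall>P Q R. ?v P \<and> ?v Q \<and> ?v R \<and> \<not> (\<exists>a. P = PW a \<and> Q = PW a \<and> R = PW a) \<longrightarrow>
        (\<forall>x\<in>?PS P. \<forall>y\<in>?PS Q. \<forall>z\<in>?PS R. T x y z = 0)"
    proof (intro allI impI ballI, elim conjE)
      fix P Q R x y z
      assume xyz: "x \<in> ?PS P" "y \<in> ?PS Q" "z \<in> ?PS R" and v: "?v P" "?v Q" "?v R"
        and ne: "\<not> (\<exists>a. P = PW a \<and> Q = PW a \<and> R = PW a)"
      have w: "x \<in> W" "y \<in> W" "z \<in> W" using PW v xyz by blast+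
      \<comment> \<open>Three equal pieces must be \<open>E0\<close> or a plane, where
        \<open>br\<close> vanishes. If the first two differ, \<open>br\<close> vanishes too; if only
        the third differs, the value of \<open>br\<close> stays in the first piece, orthogonal to
        \<open>z\<close>.\<close>
      have "B (br i x y) z = 0" if i: "i < r" for i
      proof (cases "P = Q \<and> Q = R")
        case True
        then have "br i x y = 0"
          using ne xyz v E0_D(2)[of x i y] Eb[of _ i x y] i w by (cases P) auto
        then show ?thesis by simp
      next
        case False
        then show ?thesis
          using brPQ[OF v(1,2) _ xyz(1,2) i] o[OF v(1,3) _ brP[OF v(1) xyz(1) i w(2)] xyz(3)]
          by (cases "P = Q") auto
      qed
      then show "T x y z = 0" by (simp add: T_WWW w)
    qed
    show "\<forall>x\<in>E0. (\<forall>i<r. \<forall>j<r. \<forall>k<r. B (K i j k) x = 0) \<longrightarrow> x = 0"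
      using E0_nondegenerate by blast
    show "dim E0 \<le> r choose 3" by (rule E0_dim)
  qed
qed

end
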